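(* Let $k\ge1$, let $P_1,\dots,P_n\in\mathbf{P}^2$ be general points, let $m_1,\dots,m_n\ge0$ be integers and $Z=m_1P_1+\cdots+m_nP_n$. If $Z$ has good postulation in degrees $k$ and $k+1$, then $\mu_k$ is injective, resp. surjective, if and only if $\rho_k$ is injective, resp. surjective. Moreover, if $h^1(\mathcal{I}_Z(k))=0$, then $$\text{exp-dim cok}\,\mu_k=\text{exp-dim cok}\,\rho_k=\max(0,\,2l(Z)-k(k+2)),$$ and $$\mathrm{cok}\,\mu_k=\mathrm{cok}\,\rho_k=H^1(\Omega(k+1)\otimes\mathcal{I}_Z).$$
   Context: $K$ is an algebraically closed field, $\mathbf{P}^2=\mathbf{P}^2_K$, $\Omega$ its cotangent bundle. $Z=m_1P_1+\cdots+m_nP_n$ is the fat point scheme with homogeneous ideal $\bigcap_iI(P_i)^{m_i}$, ideal sheaf $\mathcal{I}_Z$ and length $l(Z)=\sum_i\binom{m_i+1}{2}$. $Z$ has good postulation in degree $k$ if the restriction map $H^0(\mathcal{O}_{\mathbf{P}^2}(k))\to H^0(\mathcal{O}_Z)$ has maximal rank, i.e. $h^0(\mathcal{I}_Z(k))\,h^1(\mathcal{I}_Z(k))=0$. $\mu_k=\mu_k(Z):H^0(\mathcal{I}_Z(k))\otimes H^0(\mathcal{O}_{\mathbf{P}^2}(1))\to H^0(\mathcal{I}_Z(k+1))$ is multiplication and $\rho_k=\rho_k(Z):H^0(\Omega(k+1))\to H^0(\Omega(k+1)|_Z)$ is restriction. For a linear map $f:A\to B$ of finite-dimensional vector spaces,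 $\text{exp-dim cok}(f)=\max(0,\dim B-\dim A)$. The cokernels are identified with $H^1(\Omega(k+1)\otimes\mathcal{I}_Z)$ via the connecting maps of the long exact sequences of $0\to\Omega(k+1)\otimes\mathcal{I}_Z\to\mathcal{I}_Z(k)\otimes H^0(\mathcal{O}_{\mathbf{P}^2}(1))\to\mathcal{I}_Z(k+1)\to0$ (Euler sequence) and of $0\to\Omega(k+1)\otimes\mathcal{I}_Z\to\Omega(k+1)\to\Omega(k+1)|_Z\to0$.
   Formalization: The implication "μ_k surjective ⟹ ρ_k surjective" is stated only when H^0(I_Z(k+1)) ≠ 0; it fails otherwise, e.g. for n=1, m_1=k+2, where μ_k is the map 0→0 while ρ_k is not surjective. *)

theory Defs
  imports
    "HOL-Analysis.Finite_Cartesian_Product"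
    "HOL-Analysis.Cartesian_Space"
    "HOL-Library.Poly_Mapping"
    "HOL-Library.Product_Plus"
    "HOL-Computational_Algebra.Polynomial"
    "HOL-Algebra.Ideal_Product"
    "Jordan_Normal_Form.Missing_VectorSpace"
begin

section \<open>Vector spaces over a type class field\<close>

definition field_ring :: "'a::field ring" where
  "field_ring = \<lparr>carrier = UNIV, mult = (*), one = 1, zero = 0, add = (+)\<rparr>"

text \<open>The subspace \<open>V\<close> of an ambient type with scalar multiplication \<open>sc\<close>.  The fields
  \<open>mult\<close> and \<open>one\<close> are irrelevant for a module.\<close>
definition vs_of :: "('a \<Rightarrow> 'v \<Rightarrow> 'v) \<Rightarrow> 'v set \<Rightarrow> ('a, 'v::ab_group_add) module" where
  "vs_of sc V = \<lparr>carrier = V, mult = (\<lambda>_ _. 0), one = 0, zero = 0, add = (+), smult = sc\<rparr>"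

abbreviation lin_span :: "('a::field \<Rightarrow> 'v \<Rightarrow> 'v) \<Rightarrow> 'v::ab_group_add set \<Rightarrow> 'v set" where
  "lin_span sc S \<equiv> LinearCombinations.module.span field_ring (vs_of sc UNIV) S"

abbreviation dimension :: "('a::field, 'v) module \<Rightarrow> nat" where
  "dimension V \<equiv> vectorspace.dim field_ring V"

definition quot :: "('a, 'v) module \<Rightarrow> 'v set \<Rightarrow> ('a, 'v set) module" where
  "quot V W = \<lparr>carrier = a_rcosets\<^bsub>V\<^esub> W, mult = (\<lambda>_ _. W), one = W, zero = W,
     add = set_add V, smult = (\<lambda>c X. \<Union>x\<in>X. W +>\<^bsub>V\<^esub> (c \<odot>\<^bsub>V\<^esub> x))\<rparr>"

definition cok :: "('a, 'v) module \<Rightarrow> ('a, 'w) module \<Rightarrow> ('v \<Rightarrow> 'w) \<Rightarrow> ('a, 'w set) module" where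
  "cok A B f = quot B (f ` carrier A)"

definition exp_dim_cok :: "('a::field, 'v) module \<Rightarrow> ('a, 'w) module \<Rightarrow> int" where
  "exp_dim_cok A B = max 0 (int (dimension B) - int (dimension A))"

definition injective_map :: "('a, 'v) module \<Rightarrow> ('v \<Rightarrow> 'w) \<Rightarrow> bool" where
  "injective_map A f \<longleftrightarrow> inj_on f (carrier A)"

definition surjective_map :: "('a, 'v) module \<Rightarrow> ('a, 'w) module \<Rightarrow> ('v \<Rightarrow> 'w) \<Rightarrow> bool" where
  "surjective_map A B f \<longleftrightarrow> f ` carrier A = carrier B"

definition linear_iso ::
    "('a::field, 'v) module \<Rightarrow> ('a, 'w) module \<Rightarrow> ('v \<Rightarrow> 'w) \<Rightarrow> bool" where
  "linear_iso A B f \<longleftrightarrow> linear_map field_ring A B f \<and> bij_betw f (carrier A) (carrier B)"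


section \<open>Cohomology for the standard affine cover\<close>

text \<open>
  For a nonempty \<open>S \<subseteq> {0,1,2}\<close> let \<open>U_S\<close> be the affine open subset of the projective plane
  on which the coordinates \<open>x_j\<close>, \<open>j \<in> S\<close>, do not vanish.  All sheaves below are quasi-coherent,
  and their sections over the various \<open>U_S\<close> lie in one ambient vector space, the restriction maps
  being inclusions.  Such a sheaf is represented by \<open>F\<close> with \<open>F S = \<Gamma>(U_S, F)\<close>, and its cohomology
  is the Cech cohomology of the cover \<open>U_{0}\<close>, \<open>U_{1}\<close>, \<open>U_{2}\<close>.
\<close>

definition vscale :: "('a \<Rightarrow> 'v \<Rightarrow> 'v) \<Rightarrow> 'a \<Rightarrow> 'v ^ 3 \<Rightarrow> 'v ^ 3" where
  "vscale sc c v = (\<chi> i. sc c (v $ i))"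

definition glob :: "(3 set \<Rightarrow> 'v set) \<Rightarrow> 'v set" where
  "glob F = (\<Inter>i. F {i})"

definition H0 :: "('a \<Rightarrow> 'v \<Rightarrow> 'v) \<Rightarrow> (3 set \<Rightarrow> 'v set) \<Rightarrow> ('a, 'v::ab_group_add) module" where
  "H0 sc F = vs_of sc (glob F)"

definition C0 :: "(3 set \<Rightarrow> 'v set) \<Rightarrow> ('v ^ 3) set" where
  "C0 F = {t. \<forall>i. t $ i \<in> F {i}}"

definition coboundary :: "'v::ab_group_add ^ 3 \<Rightarrow> 'v ^ 3 ^ 3" where
  "coboundary t = (\<chi> i j. t $ j - t $ i)"

text \<open>The cocycle condition forces \<open>c $ i $ i = 0\<close> and \<open>c $ j $ i = - c $ i $ j\<close>, so these are
  the alternating cocycles.\<close>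
definition Z1 :: "(3 set \<Rightarrow> 'v set) \<Rightarrow> ('v::ab_group_add ^ 3 ^ 3) set" where
  "Z1 F = {c. (\<forall>i j. c $ i $ j \<in> F {i, j}) \<and> (\<forall>i j l. c $ i $ l = c $ i $ j + c $ j $ l)}"

definition H1 ::
    "('a \<Rightarrow> 'v \<Rightarrow> 'v) \<Rightarrow> (3 set \<Rightarrow> 'v set) \<Rightarrow> ('a, ('v::ab_group_add ^ 3 ^ 3) set) module" where
  "H1 sc F = quot (vs_of (vscale (vscale sc)) (Z1 F)) (coboundary ` C0 F)"

text \<open>Global sections of the quotient sheaf \<open>F/G\<close> of \<open>F\<close> by a subsheaf \<open>G\<close>.  The sets \<open>U_S\<close> are
  affine, so \<open>\<Gamma>(U_S, F/G) = F S / G S\<close>; a global section is a family of classes of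
  \<open>t $ i \<in> F {i}\<close> that agree on the overlaps.\<close>
definition H0_quot :: "('a \<Rightarrow> 'v \<Rightarrow> 'v) \<Rightarrow> (3 set \<Rightarrow> 'v set) \<Rightarrow> (3 set \<Rightarrow> 'v set)
    \<Rightarrow> ('a, ('v::ab_group_add ^ 3) set) module" where
  "H0_quot sc F G =
     quot (vs_of (vscale sc) {t \<in> C0 F. \<forall>i j. t $ j - t $ i \<in> G {i, j}}) (C0 G)"

definition to_quot :: "('a \<Rightarrow> 'v \<Rightarrow> 'v) \<Rightarrow> (3 set \<Rightarrow> 'v set) \<Rightarrow> 'v::ab_group_add \<Rightarrow> ('v ^ 3) set" where
  "to_quot sc G s = C0 G +>\<^bsub>vs_of (vscale sc) UNIV\<^esub> (\<chi> i. s)"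


section \<open>Laurent polynomials, line bundles and ideal sheaves\<close>

text \<open>\<open>K[x_0, x_1, x_2]\<close> and all its localizations at products of the variables are
  subrings of the ring of Laurent polynomials.\<close>
type_synonym 'a laurent = "(int ^ 3) \<Rightarrow>\<^sub>0 'a"

definition lscale :: "'a::field \<Rightarrow> ('b \<Rightarrow>\<^sub>0 'a) \<Rightarrow> ('b \<Rightarrow>\<^sub>0 'a)" where
  "lscale c = Poly_Mapping.map ((*) c)"

definition X :: "3 \<Rightarrow> 'a::field laurent" where
  "X j = Poly_Mapping.single (axis j 1) 1"

definition homog :: "int \<Rightarrow> 'a::field laurent set" where
  "homog d = {f. \<forall>e \<in> Poly_Mapping.keys f. (\<Sum>j\<in>UNIV. e $ j) = d}"

definition polys :: "'a::field laurent set" where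
  "polys = {f. \<forall>e \<in> Poly_Mapping.keys f. \<forall>j. 0 \<le> e $ j}"

definition poly_ring :: "'a::field laurent ring" where
  "poly_ring = \<lparr>carrier = polys, mult = (*), one = 1, zero = 0, add = (+)\<rparr>"

text \<open>Sections over \<open>U_S\<close> of the twist by \<open>d\<close> of the sheaf associated with a homogeneous ideal
  \<open>I\<close>: the elements of degree \<open>d\<close> of the localization of \<open>I\<close> at \<open>\<Prod>j\<in>S. x_j\<close>.
  For \<open>I = polys\<close> this is the line bundle \<open>O(d)\<close>.\<close>
definition shf :: "'a::field laurent set \<Rightarrow> int \<Rightarrow> 3 set \<Rightarrow> 'a laurent set" where
  "shf I d S = {f \<in> homog d. \<exists>N::nat. (\<Prod>j\<in>S. X j) ^ N * f \<in> I}"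


section \<open>The cotangent bundle\<close>

text \<open>The differential, with \<open>f_0 dx_0 + f_1 dx_1 + f_2 dx_2\<close> represented by its coefficients.\<close>
definition differential :: "'a::field laurent \<Rightarrow> 'a laurent ^ 3" where
  "differential g = (\<chi> j. \<Sum>e\<in>Poly_Mapping.keys g.
     Poly_Mapping.single (e - axis j 1) (of_int (e $ j) * Poly_Mapping.lookup g e))"

abbreviation fscale :: "'a::field \<Rightarrow> 'a laurent ^ 3 \<Rightarrow> 'a laurent ^ 3" where
  "fscale \<equiv> vscale lscale"

text \<open>Sections over \<open>U_S\<close> of \<open>\<Omega>(d) \<otimes> I\<close>, where \<open>I\<close> stands for the ideal sheaf associated with
  a homogeneous ideal.  The Kaehler differentials of \<open>O(U_S)\<close> are generated by the \<open>dg\<close> with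
  \<open>g \<in> O(U_S)\<close>; \<open>U_S\<close> being smooth, they embed into the free module on \<open>dx_0, dx_1, dx_2\<close> over the
  Laurent polynomials.  As \<open>\<Omega>\<close> is locally free, \<open>\<Omega>(d) \<otimes> I\<close> is the subsheaf \<open>I \<cdot> \<Omega>(d)\<close> of
  \<open>\<Omega>(d)\<close>.  For \<open>I = polys\<close> this is \<open>\<Omega>(d)\<close> itself.\<close>
definition Omega :: "'a::field laurent set \<Rightarrow> int \<Rightarrow> 3 set \<Rightarrow> ('a laurent ^ 3) set" where
  "Omega I d S = lin_span fscale {f *s differential g | f g. f \<in> shf I d S \<and> g \<in> shf polys 0 S}"


section \<open>Tensor products and multiplication\<close>

definition tens :: "('b \<Rightarrow>\<^sub>0 'a::field) \<Rightarrow> ('c \<Rightarrow>\<^sub>0 'a) \<Rightarrow> ('b \<times> 'c \<Rightarrow>\<^sub>0 'a)" where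
  "tens f g = (\<Sum>a\<in>Poly_Mapping.keys f. \<Sum>b\<in>Poly_Mapping.keys g.
     Poly_Mapping.single (a, b) (Poly_Mapping.lookup f a * Poly_Mapping.lookup g b))"

text \<open>The tensor product over \<open>K\<close> of two spaces of Laurent polynomials, as a subspace of the tensor
  product of the ring of Laurent polynomials with itself (Laurent polynomials in two
  sets of variables).\<close>
definition tensor :: "'a::field laurent set \<Rightarrow> 'a laurent set \<Rightarrow> ((int ^ 3) \<times> (int ^ 3) \<Rightarrow>\<^sub>0 'a) set"
  where "tensor V W = lin_span lscale {tens f g | f g. f \<in> V \<and> g \<in> W}"

text \<open>The linear map with \<open>f \<otimes> g \<mapsto> f * g\<close>.\<close>
definition mult_map :: "((int ^ 3) \<times> (int ^ 3) \<Rightarrow>\<^sub>0 'a::field) \<Rightarrow> 'a laurent" where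
  "mult_map t = (\<Sum>(a, b)\<in>Poly_Mapping.keys t.
     Poly_Mapping.single (a + b) (Poly_Mapping.lookup t (a, b)))"

abbreviation linear_forms :: "'a::field laurent set" where
  "linear_forms \<equiv> glob (shf polys 1)"

text \<open>The inclusion \<open>f_0 dx_0 + f_1 dx_1 + f_2 dx_2 \<mapsto> \<Sum>j. f_j \<otimes> x_j\<close> of the Euler sequence.\<close>
definition euler :: "'a::field laurent ^ 3 \<Rightarrow> ((int ^ 3) \<times> (int ^ 3) \<Rightarrow>\<^sub>0 'a)" where
  "euler w = (\<Sum>j\<in>UNIV. tens (w $ j) (X j))"


section \<open>Fat points\<close>

text \<open>Points of the projective plane are given by homogeneous coordinates \<open>P \<noteq> 0\<close>.\<close>

definition eval_at :: "'a::field ^ 3 \<Rightarrow> 'a laurent \<Rightarrow> 'a" where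
  "eval_at P f = (\<Sum>e\<in>Poly_Mapping.keys f.
     Poly_Mapping.lookup f e * (\<Prod>j\<in>UNIV. (P $ j) ^ nat (e $ j)))"

definition pt_ideal :: "'a::field ^ 3 \<Rightarrow> 'a laurent set" where
  "pt_ideal P = genideal poly_ring {f \<in> polys. (\<exists>d. f \<in> homog d) \<and> eval_at P f = 0}"

primrec ideal_pow :: "'a::field laurent set \<Rightarrow> nat \<Rightarrow> 'a laurent set" where
  "ideal_pow I 0 = polys"
| "ideal_pow I (Suc r) = ideal_prod poly_ring I (ideal_pow I r)"

text \<open>The homogeneous ideal of \<open>Z = m_1 P_1 + \<dots> + m_n P_n\<close>, which represents \<open>Z\<close> below
  (the whole ring for \<open>n = 0\<close>).\<close>
definition fat_ideal :: "nat \<Rightarrow> (nat \<Rightarrow> nat) \<Rightarrow> (nat \<Rightarrow> 'a::field ^ 3) \<Rightarrow> 'a laurent set" where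
  "fat_ideal n m P = polys \<inter> (\<Inter>i\<in>{1..n}. ideal_pow (pt_ideal (P i)) (m i))"

definition fat_length :: "nat \<Rightarrow> (nat \<Rightarrow> nat) \<Rightarrow> nat" where
  "fat_length n m = (\<Sum>i=1..n. (m i + 1) choose 2)"

definition h1 :: "'a::field laurent set \<Rightarrow> int \<Rightarrow> nat" where
  "h1 Z k = dimension (H1 lscale (shf Z k))"

text \<open>Maximal rank of \<open>H^0(O(k)) \<rightarrow> H^0(O_Z(k)) = H^0(O_Z)\<close>, the twist being immaterial on the
  finite scheme \<open>Z\<close>.\<close>
definition good_postulation :: "'a::field laurent set \<Rightarrow> int \<Rightarrow> bool" where
  "good_postulation Z k \<longleftrightarrow>
     (let A = H0 lscale (shf polys k);
          B = H0_quot lscale (shf polys k) (shf Z k);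
          r = to_quot lscale (shf Z k)
      in injective_map A r \<or> surjective_map A B r)"


section \<open>The maps mu and rho\<close>

definition mu_dom ::
    "'a::field laurent set \<Rightarrow> int \<Rightarrow> ('a, (int ^ 3) \<times> (int ^ 3) \<Rightarrow>\<^sub>0 'a) module" where
  "mu_dom Z k = vs_of lscale (tensor (glob (shf Z k)) linear_forms)"

definition mu_cod :: "'a::field laurent set \<Rightarrow> int \<Rightarrow> ('a, 'a laurent) module" where
  "mu_cod Z k = H0 lscale (shf Z (k + 1))"

abbreviation mu :: "((int ^ 3) \<times> (int ^ 3) \<Rightarrow>\<^sub>0 'a::field) \<Rightarrow> 'a laurent" where
  "mu \<equiv> mult_map"

definition rho_dom :: "int \<Rightarrow> ('a::field, 'a laurent ^ 3) module" where
  "rho_dom k = H0 fscale (Omega polys (k + 1))"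

definition rho_cod :: "'a::field laurent set \<Rightarrow> int \<Rightarrow> ('a, ('a laurent ^ 3 ^ 3) set) module" where
  "rho_cod Z k = H0_quot fscale (Omega polys (k + 1)) (Omega Z (k + 1))"

definition rho :: "'a::field laurent set \<Rightarrow> int \<Rightarrow> 'a laurent ^ 3 \<Rightarrow> ('a laurent ^ 3 ^ 3) set" where
  "rho Z k = to_quot fscale (Omega Z (k + 1))"

definition H1_Omega ::
    "'a::field laurent set \<Rightarrow> int \<Rightarrow> ('a, ('a laurent ^ 3 ^ 3 ^ 3) set) module" where
  "H1_Omega Z k = H1 fscale (Omega Z (k + 1))"

text \<open>The connecting maps to \<open>H^1(\<Omega>(k+1) \<otimes> I_Z)\<close>, induced on the cokernels.  A class is sent to
  the set of all cocycles obtained from its representatives by choosing local lifts and taking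
  differences on the overlaps; by exactness this set is one cohomology class when all
  representatives lift locally.\<close>

definition delta_mu ::
    "'a::field laurent set \<Rightarrow> int \<Rightarrow> 'a laurent set \<Rightarrow> ('a laurent ^ 3 ^ 3 ^ 3) set" where
  "delta_mu Z k Y = {c. \<exists>s\<in>Y. \<exists>t.
     (\<forall>i. t $ i \<in> tensor (shf Z k {i}) linear_forms \<and> mult_map (t $ i) = s) \<and>
     (\<forall>i j. c $ i $ j \<in> Omega Z (k + 1) {i, j} \<and> euler (c $ i $ j) = t $ j - t $ i)}"

text \<open>Elements of \<open>rho_cod\<close> are themselves cosets, namely the sets of all families of local lifts.\<close>
definition delta_rho ::
    "('a::field laurent ^ 3 ^ 3) set set \<Rightarrow> ('a laurent ^ 3 ^ 3 ^ 3) set" where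
  "delta_rho Y = coboundary ` \<Union>Y"


section \<open>General points\<close>

text \<open>Polynomials in the coordinates \<open>P i $ j\<close> of \<open>n\<close> points \<open>P 1, \<dots>, P n\<close>.\<close>

definition multihomogeneous :: "nat \<Rightarrow> ((nat \<times> 3 \<Rightarrow>\<^sub>0 nat) \<Rightarrow>\<^sub>0 'a::field) \<Rightarrow> bool" where
  "multihomogeneous n F \<longleftrightarrow> (\<exists>d :: nat \<Rightarrow> nat. \<forall>e\<in>Poly_Mapping.keys F.
     Poly_Mapping.keys e \<subseteq> {1..n} \<times> UNIV \<and>
     (\<forall>i\<in>{1..n}. (\<Sum>j\<in>UNIV. Poly_Mapping.lookup e (i, j)) = d i))"

definition multi_eval ::
    "(nat \<Rightarrow> 'a::field ^ 3) \<Rightarrow> ((nat \<times> 3 \<Rightarrow>\<^sub>0 nat) \<Rightarrow>\<^sub>0 'a) \<Rightarrow> 'a" where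
  "multi_eval P F = (\<Sum>e\<in>Poly_Mapping.keys F. Poly_Mapping.lookup F e *
     (\<Prod>(i, j)\<in>Poly_Mapping.keys e. (P i $ j) ^ Poly_Mapping.lookup e (i, j)))"

text \<open>Zariski open subsets of the \<open>n\<close>-fold product of the projective plane, as sets of tuples of
  homogeneous coordinate vectors (only the values at \<open>1, \<dots>, n\<close> matter).\<close>
definition zariski_open :: "nat \<Rightarrow> (nat \<Rightarrow> 'a::field ^ 3) set \<Rightarrow> bool" where
  "zariski_open n U \<longleftrightarrow> (\<exists>\<F>. (\<forall>F\<in>\<F>. multihomogeneous n F) \<and>
     U = {P. (\<forall>i\<in>{1..n}. P i \<noteq> 0) \<and> (\<exists>F\<in>\<F>. multi_eval P F \<noteq> 0)})"

definition for_general_points :: "nat \<Rightarrow> ((nat \<Rightarrow> 'a::field ^ 3) \<Rightarrow> bool) \<Rightarrow> bool" where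
  "for_general_points n Q \<longleftrightarrow> (\<exists>U. zariski_open n U \<and> U \<noteq> {} \<and> (\<forall>P\<in>U. Q P))"

end

theory Submission
  imports Defs
begin

text \<open>
  Write \<open>I\<close> for the ideal sheaf of \<open>Z\<close> and \<open>V = H^0(O(1))\<close>.  Two exact sequences with the same kernel
  compare the two maps: the Euler sequence of \<open>\<Omega>(k+1) \<otimes> I\<close> in \<open>I(k) \<otimes> V\<close> with quotient \<open>I(k+1)\<close>, and
  the restriction sequence of \<open>\<Omega>(k+1) \<otimes> I\<close> in \<open>\<Omega>(k+1)\<close> with quotient \<open>\<Omega>(k+1)|_Z\<close>.  On global
  sections both \<open>\<mu>_k\<close> and \<open>\<rho>_k\<close> have kernel \<open>H^0(\<Omega>(k+1) \<otimes> I)\<close>, so they are injective together.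
  The connecting maps embed both cokernels in \<open>H^1(\<Omega>(k+1) \<otimes> I)\<close>.  That of \<open>\<rho>_k\<close> is everything because
  \<open>H^1(\<Omega>(k+1)) = 0\<close>; that of \<open>\<mu>_k\<close> is everything if \<open>H^1(I(k)) = 0\<close>.  Hence surjectivity of \<open>\<rho>_k\<close>
  implies that of \<open>\<mu>_k\<close>.  Conversely, if \<open>\<mu>_k\<close> is onto a nonzero space, then \<open>H^0(I(k)) \<noteq> 0\<close>, and good
  postulation in degree \<open>k\<close> becomes \<open>H^1(I(k)) = 0\<close>.

  Both connecting maps are instances of one statement about a subsheaf \<open>G\<close> of \<open>F\<close> in Cech cohomology
  (\<open>connecting_iso\<close>): a family of local sections of \<open>F\<close> that agree modulo \<open>G\<close> has a class in the sections
  of \<open>F/G\<close> and a coboundary in the cocycles of \<open>G\<close>, and both surjections pull the relevant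
  subspaces back to the same subspace.  It is applied to \<open>\<Omega>(k+1) \<otimes> I\<close> inside \<open>\<Omega>(k+1)\<close>,
  to the same sheaf inside three copies of \<open>I(k)\<close>, and to \<open>I(k)\<close> inside \<open>O(k)\<close>; the last case translates
  good postulation and \<open>h^1\<close> into one another.  That \<open>H^1(O(d)) = 0\<close> is seen monomial by monomial
  (\<open>line_bundle_H1\<close>), and \<open>H^1(\<Omega>(k+1)) = 0\<close> follows from it by the Euler sequence (\<open>Omega_eq\<close>, \<open>Omega_H1\<close>).

  The expected dimensions need \<open>dim H^0(O_Z) = l(Z)\<close> and \<open>dim H^0(\<Omega>(k+1)|_Z) = 2 l(Z)\<close>.  For general points
  no \<open>P_i\<close> is on a coordinate line, so all charts contain \<open>Z\<close>, sections over \<open>Z\<close> can be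
  computed on the intersection of the charts (\<open>cech_supported\<close>), and there they are represented by forms
  of any large degree modulo the ideal.  A linear change of coordinates
  identifies powers of the ideal of a point with orders of vanishing (\<open>ideal_pow_pt\<close>), and in large
  degrees the Taylor coefficients at the points can be prescribed (\<open>taylor_onto\<close>), so that the
  forms modulo the ideal have dimension \<open>l(Z)\<close> (\<open>point_scheme_fat_ideal\<close>).
\<close>

abbreviation "lookup \<equiv> Poly_Mapping.lookup"
abbreviation "keys \<equiv> Poly_Mapping.keys"
abbreviation "single \<equiv> Poly_Mapping.single"


section \<open>Linear algebra\<close>

lemma field_field_ring: "field (field_ring :: 'a::field ring)"
proof -
  have "cring (field_ring :: 'a ring)"
    by (rule cringI, rule abelian_groupI, auto simp: field_ring_def algebra_simps
        intro: comm_monoidI) (metis add.right_inverse add.commute)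
  then interpret cring "field_ring :: 'a ring" .
  show ?thesis
    by (rule cring_fieldI2) (auto simp: field_ring_def intro: right_inverse exI)
qed

lemma field_ring_simps [simp]:
  "carrier field_ring = UNIV" "mult field_ring = (*)" "one field_ring = 1"
  "zero field_ring = 0" "add field_ring = (+)"
  by (simp_all add: field_ring_def)

lemma vs_of_simps [simp]:
  "carrier (vs_of sc V) = V" "zero (vs_of sc V) = 0" "add (vs_of sc V) = (+)"
  "smult (vs_of sc V) = sc" "(vs_of sc V)\<lparr>carrier := W\<rparr> = vs_of sc W"
  by (simp_all add: vs_of_def)

definition is_subspace :: "('a::field \<Rightarrow> 'v \<Rightarrow> 'v) \<Rightarrow> 'v::ab_group_add set \<Rightarrow> bool" where
  "is_subspace sc V \<longleftrightarrow> 0 \<in> V \<and> (\<forall>x\<in>V. \<forall>y\<in>V. x + y \<in> V) \<and> (\<forall>c. \<forall>x\<in>V. sc c x \<in> V)"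

lemma is_subspaceI:
  "0 \<in> V \<Longrightarrow> (\<And>x y. x \<in> V \<Longrightarrow> y \<in> V \<Longrightarrow> x + y \<in> V) \<Longrightarrow> (\<And>c x. x \<in> V \<Longrightarrow> sc c x \<in> V)
   \<Longrightarrow> is_subspace sc V"
  by (simp add: is_subspace_def)

lemma is_subspaceD:
  assumes "is_subspace sc V"
  shows "0 \<in> V" "x \<in> V \<Longrightarrow> y \<in> V \<Longrightarrow> x + y \<in> V" "x \<in> V \<Longrightarrow> sc c x \<in> V"
  using assms by (auto simp: is_subspace_def)

lemma is_subspace_neg:
  assumes "vector_space sc" "is_subspace sc V" "x \<in> V"
  shows "- x \<in> V"
proof -
  interpret vector_space sc by fact
  have "sc (-1) x \<in> V" using assms is_subspaceD by blast
  then show ?thesis by simp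
qed

lemma is_subspace_diff:
  assumes "vector_space sc" "is_subspace sc V" "x \<in> V" "y \<in> V"
  shows "x - y \<in> V"
  using is_subspaceD(2)[OF assms(2) assms(3) is_subspace_neg[OF assms(1,2,4)]] by simp

lemma is_subspace_sum:
  assumes "is_subspace sc V" "\<And>i. i \<in> I \<Longrightarrow> f i \<in> V"
  shows "sum f I \<in> V"
  using assms(2) by (induction I rule: infinite_finite_induct) (auto simp: is_subspaceD[OF assms(1)])

lemma is_subspace_Int: "is_subspace sc V \<Longrightarrow> is_subspace sc W \<Longrightarrow> is_subspace sc (V \<inter> W)"
  by (auto simp: is_subspace_def)

lemma is_subspace_INT: "(\<And>i. is_subspace sc (V i)) \<Longrightarrow> is_subspace sc (\<Inter>i. V i)"
  by (auto simp: is_subspace_def)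

lemma vectorspace_vs_of:
  assumes "vector_space sc" "is_subspace sc V"
  shows "vectorspace field_ring (vs_of sc V)"
proof -
  interpret vector_space sc by fact
  note [simp] = is_subspaceD[OF assms(2)] is_subspace_neg[OF assms]
  show ?thesis
    by (rule vs_criteria) (auto simp: field_field_ring scale_left_distrib scale_right_distrib
        add.commute add.assoc intro: bexI[of _ "- _"])
qed

lemma subspace_vs_of:
  assumes "vector_space sc" "is_subspace sc V" "is_subspace sc W" "W \<subseteq> V"
  shows "submodule field_ring W (vs_of sc V)"
proof -
  interpret vectorspace field_ring "vs_of sc V" by (rule vectorspace_vs_of) fact+
  show ?thesis
    using assms(4) is_subspaceD[OF assms(3)] by unfold_locales auto
qed

text \<open>The span is characterized by the next three facts, which replace linear combinations below.\<close>
lemma lin_span_least: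
  assumes "vector_space sc" "is_subspace sc V" "S \<subseteq> V"
  shows "lin_span sc S \<subseteq> V"
proof -
  have U: "is_subspace sc UNIV" by (simp add: is_subspace_def)
  interpret vectorspace field_ring "vs_of sc UNIV" by (rule vectorspace_vs_of) (fact U assms(1))+
  show ?thesis
    using span_is_subset[OF assms(3)] subspace_vs_of[OF assms(1) U assms(2)] by simp
qed

lemma lin_span_superset:
  fixes sc :: "'a::field \<Rightarrow> 'v::ab_group_add \<Rightarrow> 'v"
  assumes "vector_space sc"
  shows "S \<subseteq> lin_span sc S"
proof -
  have U: "is_subspace sc UNIV" by (simp add: is_subspace_def)
  interpret vectorspace field_ring "vs_of sc UNIV" by (rule vectorspace_vs_of) (fact U assms)+
  show ?thesis by (rule in_own_span) simp
qed

lemma is_subspace_lin_span: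
  fixes sc :: "'a::field \<Rightarrow> 'v::ab_group_add \<Rightarrow> 'v"
  assumes "vector_space sc"
  shows "is_subspace sc (lin_span sc S)"
proof -
  have U: "is_subspace sc UNIV" by (simp add: is_subspace_def)
  interpret vectorspace field_ring "vs_of sc UNIV" by (rule vectorspace_vs_of) (fact U assms)+
  have "submodule field_ring (span S) (vs_of sc UNIV)" by (rule span_is_submodule) simp
  then interpret s: submodule field_ring "span S" "vs_of sc UNIV" .
  show ?thesis
    using s.m_closed s.zero_closed s.smult_closed by (auto simp: is_subspace_def)
qed

subsection \<open>Linear maps\<close>

lemma linear_mapI:
  assumes "vectorspace K V" "vectorspace K W"
    and "\<And>x. x \<in> carrier V \<Longrightarrow> f x \<in> carrier W"
    and "\<And>x y. x \<in> carrier V \<Longrightarrow> y \<in> carrier V \<Longrightarrow> f (x \<oplus>\<^bsub>V\<^esub> y) = f x \<oplus>\<^bsub>W\<^esub> f y"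
    and "\<And>c x. c \<in> carrier K \<Longrightarrow> x \<in> carrier V \<Longrightarrow> f (c \<odot>\<^bsub>V\<^esub> x) = c \<odot>\<^bsub>W\<^esub> f x"
  shows "linear_map K V W f"
  using assms unfolding linear_map_def mod_hom_def mod_hom_axioms_def module_hom_def
  by (auto simp: vectorspace_def)

text \<open>The axioms of a vector space pass to any image under a map that respects the operations;
  this spares their verification for quotients.\<close>
lemma vectorspace_image:
  assumes V: "vectorspace K V" and onto: "p ` carrier V = carrier Q"
    and add: "\<And>x y. x \<in> carrier V \<Longrightarrow> y \<in> carrier V \<Longrightarrow> p (x \<oplus>\<^bsub>V\<^esub> y) = p x \<oplus>\<^bsub>Q\<^esub> p y"
    and smult: "\<And>c x. c \<in> carrier K \<Longrightarrow> x \<in> carrier V \<Longrightarrow> p (c \<odot>\<^bsub>V\<^esub> x) = c \<odot>\<^bsub>Q\<^esub> p x"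
    and zero: "p \<zero>\<^bsub>V\<^esub> = \<zero>\<^bsub>Q\<^esub>"
  shows "vectorspace K Q"
proof -
  interpret V: vectorspace K V by fact
  note [simp] = add[symmetric] smult[symmetric] zero[symmetric]
    V.M.a_ac V.smult_assoc1 V.smult_l_distr V.smult_r_distr
  show ?thesis
  proof (rule vs_criteria, unfold onto[symmetric])
    show "\<forall>v\<in>p ` carrier V. \<exists>w\<in>p ` carrier V. v \<oplus>\<^bsub>Q\<^esub> w = \<zero>\<^bsub>Q\<^esub>"
    proof
      fix v assume "v \<in> p ` carrier V"
      then obtain x where x: "x \<in> carrier V" "v = p x" by blast
      have "v \<oplus>\<^bsub>Q\<^esub> p (\<ominus>\<^bsub>V\<^esub> x) = p (x \<oplus>\<^bsub>V\<^esub> \<ominus>\<^bsub>V\<^esub> x)" using x by simp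
      also have "\<dots> = \<zero>\<^bsub>Q\<^esub>" using x by (simp only: V.M.r_neg zero)
      finally show "\<exists>w\<in>p ` carrier V. v \<oplus>\<^bsub>Q\<^esub> w = \<zero>\<^bsub>Q\<^esub>" using x by blast
    qed
  qed (use V.field_axioms in auto)
qed

subsection \<open>Quotients\<close>

locale quotient_space =
  fixes V :: "('a::field, 'v) module" and W :: "'v set"
  assumes vectorspace: "vectorspace field_ring V" and submodule: "submodule field_ring W V"
begin

sublocale V: vectorspace field_ring V by (rule vectorspace)
sublocale W: submodule field_ring W V by (rule submodule)

lemma abelian_subgroup: "abelian_subgroup W V"
proof (rule abelian_subgroupI3)
  show "abelian_group V" by (rule V.M.abelian_group_axioms)
  have "inv\<^bsub>add_monoid V\<^esub> a \<in> W" if "a \<in> W" for a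
  proof -
    have "\<ominus>\<^bsub>V\<^esub> a = (\<ominus>\<^bsub>field_ring\<^esub> \<one>\<^bsub>field_ring\<^esub>) \<odot>\<^bsub>V\<^esub> a"
      using that W.subset V.smult_minus_1[of a] by auto
    then have "\<ominus>\<^bsub>V\<^esub> a \<in> W" using W.smult_closed that by simp
    then show ?thesis by (simp add: a_inv_def)
  qed
  then show "additive_subgroup W V"
    using W.subset by (intro additive_subgroup.intro) (auto simp: subgroup_def)
qed

sublocale abelian_subgroup W V by (rule abelian_subgroup)

abbreviation cl where "cl x \<equiv> W +>\<^bsub>V\<^esub> x"

lemma carrier_quot: "carrier (quot V W) = cl ` carrier V"
  by (auto simp: quot_def A_RCOSETS_def RCOSETS_def a_r_coset_def)

lemma quot_ops [simp]: "zero (quot V W) = W" "add (quot V W) = set_add V"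
  by (simp_all add: quot_def)

lemma mem_cl_iff:
  assumes "x \<in> carrier V" "y \<in> carrier V"
  shows "y \<in> cl x \<longleftrightarrow> y \<ominus>\<^bsub>V\<^esub> x \<in> W"
  using assms a_rcos_module[of x y] by (simp add: a_minus_def)

lemma cl_eq_iff:
  assumes "x \<in> carrier V" "y \<in> carrier V"
  shows "cl x = cl y \<longleftrightarrow> x \<ominus>\<^bsub>V\<^esub> y \<in> W"
proof
  assume "cl x = cl y"
  then show "x \<ominus>\<^bsub>V\<^esub> y \<in> W" using assms a_rcos_self[of x] mem_cl_iff[of y x] by simp
next
  assume "x \<ominus>\<^bsub>V\<^esub> y \<in> W"
  then have "x \<in> cl y" using assms by (simp add: mem_cl_iff)
  then show "cl x = cl y" using V.M.a_repr_independence[OF _ assms(2) a_subgroup] by simp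
qed

lemma mem_cl_carrier: "x \<in> carrier V \<Longrightarrow> y \<in> cl x \<Longrightarrow> y \<in> carrier V"
  by (meson V.M.a_r_coset_subset_G W.subset subsetD)

lemma cl_add: "x \<in> carrier V \<Longrightarrow> y \<in> carrier V \<Longrightarrow> cl (x \<oplus>\<^bsub>V\<^esub> y) = cl x \<oplus>\<^bsub>quot V W\<^esub> cl y"
  by (simp add: a_rcos_sum)

lemma cl_smult:
  assumes "x \<in> carrier V"
  shows "cl (c \<odot>\<^bsub>V\<^esub> x) = c \<odot>\<^bsub>quot V W\<^esub> cl x"
proof -
  have "cl (c \<odot>\<^bsub>V\<^esub> y) = cl (c \<odot>\<^bsub>V\<^esub> x)" if "y \<in> cl x" for y
  proof -
    have y: "y \<in> carrier V" using mem_cl_carrier assms that by blast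
    have "c \<odot>\<^bsub>V\<^esub> (y \<ominus>\<^bsub>V\<^esub> x) \<in> W"
      using that assms y mem_cl_iff by simp
    moreover have "c \<odot>\<^bsub>V\<^esub> (y \<ominus>\<^bsub>V\<^esub> x) = c \<odot>\<^bsub>V\<^esub> y \<ominus>\<^bsub>V\<^esub> c \<odot>\<^bsub>V\<^esub> x"
      using assms y by (simp add: a_minus_def V.smult_r_distr V.smult_r_minus)
    ultimately show ?thesis using assms y by (simp add: cl_eq_iff)
  qed
  then have "(\<Union>y\<in>cl x. cl (c \<odot>\<^bsub>V\<^esub> y)) = (\<Union>y\<in>cl x. cl (c \<odot>\<^bsub>V\<^esub> x))"
    by (rule SUP_cong[OF refl])
  also have "\<dots> = cl (c \<odot>\<^bsub>V\<^esub> x)"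
    using a_rcos_self[OF assms] by (metis UN_constant empty_iff)
  finally show ?thesis by (simp add: quot_def)
qed

lemma cl_zero: "cl \<zero>\<^bsub>V\<^esub> = W"
  using W.subset by simp

lemma vectorspace_quot: "vectorspace field_ring (quot V W)"
proof (rule vectorspace_image[OF vectorspace, of cl])
  show "cl \<zero>\<^bsub>V\<^esub> = \<zero>\<^bsub>quot V W\<^esub>" by (simp only: quot_ops cl_zero)
qed (simp_all only: carrier_quot cl_add cl_smult)

lemma linear_cl: "linear_map field_ring V (quot V W) cl"
  by (rule linear_mapI[OF vectorspace vectorspace_quot])
    (simp_all only: carrier_quot cl_add cl_smult imageI)

lemma cl_eq_W_iff: "x \<in> carrier V \<Longrightarrow> cl x = W \<longleftrightarrow> x \<in> W"
proof -
  have "\<zero>\<^bsub>V\<^esub> \<in> cl x \<longleftrightarrow> x \<in> cl \<zero>\<^bsub>V\<^esub>" if "x \<in> carrier V"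
    using that mem_cl_iff cl_eq_iff a_rcos_self V.M.zero_closed by metis
  then show "x \<in> carrier V \<Longrightarrow> cl x = W \<longleftrightarrow> x \<in> W"
    using cl_eq_iff[of x "\<zero>\<^bsub>V\<^esub>"] mem_cl_iff[of "\<zero>\<^bsub>V\<^esub>" x] by (simp add: cl_zero)
qed

end


lemma quotient_spaceI:
  assumes "vector_space sc" "is_subspace sc V" "is_subspace sc W" "W \<subseteq> V"
  shows "quotient_space (vs_of sc V) W"
  by (simp add: quotient_space_def vectorspace_vs_of subspace_vs_of assms)

lemma linear_map_factor:
  assumes p: "linear_map K D B p" and onto: "p ` carrier D = carrier B" and q: "linear_map K D C q"
    and F: "\<And>t. t \<in> carrier D \<Longrightarrow> F (p t) = q t"
  shows "linear_map K B C F"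
proof -
  interpret D: vectorspace K D using p by (simp add: linear_map_def)
  interpret p: linear_map K D B p by fact
  interpret q: linear_map K D C q by fact
  show ?thesis
  proof (rule linear_mapI[OF p.W.vectorspace_axioms q.W.vectorspace_axioms])
    fix y assume "y \<in> carrier B"
    then obtain t where t: "t \<in> carrier D" "y = p t" using onto by blast
    show "F y \<in> carrier C" using t by (simp add: F)
    { fix z assume "z \<in> carrier B"
      then obtain u where u: "u \<in> carrier D" "z = p u" using onto by blast
      have "y \<oplus>\<^bsub>B\<^esub> z = p (t \<oplus>\<^bsub>D\<^esub> u)" using t u by simp
      then show "F (y \<oplus>\<^bsub>B\<^esub> z) = F y \<oplus>\<^bsub>C\<^esub> F z" using t u by (simp only: F D.M.a_closed q.f_add) }
    { fix c assume c: "c \<in> carrier K"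
      have "c \<odot>\<^bsub>B\<^esub> y = p (c \<odot>\<^bsub>D\<^esub> t)" using t c by simp
      then show "F (c \<odot>\<^bsub>B\<^esub> y) = c \<odot>\<^bsub>C\<^esub> F y" using t c by (simp only: F D.smult_closed q.f_smult) }
  qed
qed

lemma linear_map_compose:
  assumes f: "linear_map K A B f" and g: "linear_map K B C g"
  shows "linear_map K A C (\<lambda>x. g (f x))"
proof -
  interpret f: linear_map K A B f by fact
  interpret g: linear_map K B C g by fact
  show ?thesis by (rule linear_mapI[OF f.V.vectorspace_axioms g.W.vectorspace_axioms]) simp_all
qed

text \<open>If two linear surjections out of \<open>D\<close> pull \<open>W\<close> and \<open>W'\<close> back to the same subspace, both quotients
  are the quotient of \<open>D\<close> by that subspace.  Read as a relation, the resulting isomorphism lifts a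
  class to \<open>D\<close> in all possible ways and maps it on; connecting maps have this shape.\<close>
lemma linear_iso_quot:
  fixes D :: "('a::field, 'd) module" and B :: "('a, 'b) module" and C :: "('a, 'c) module"
  assumes p: "linear_map field_ring D B p" and ponto: "p ` carrier D = carrier B"
    and q: "linear_map field_ring D C q" and qonto: "q ` carrier D = carrier C"
    and W: "submodule field_ring W B" and W': "submodule field_ring W' C"
    and eq: "\<And>t. t \<in> carrier D \<Longrightarrow> p t \<in> W \<longleftrightarrow> q t \<in> W'"
  shows "linear_iso (quot B W) (quot C W') (\<lambda>Y. q ` {t \<in> carrier D. p t \<in> Y})"
proof -
  interpret D: vectorspace field_ring D using p by (simp add: linear_map_def)
  interpret p: linear_map field_ring D B p by fact
  interpret q: linear_map field_ring D C q by fact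
  interpret B: quotient_space B W
    by (rule quotient_space.intro[OF _ W]) (rule p.W.vectorspace_axioms)
  interpret C: quotient_space C W'
    by (rule quotient_space.intro[OF _ W']) (rule q.W.vectorspace_axioms)
  let ?F = "\<lambda>Y. q ` {t \<in> carrier D. p t \<in> Y}"
  have pc: "p t \<in> carrier B" and qc: "q t \<in> carrier C" if "t \<in> carrier D" for t
    using that by simp_all
  have rel: "p s \<ominus>\<^bsub>B\<^esub> p t \<in> W \<longleftrightarrow> q s \<ominus>\<^bsub>C\<^esub> q t \<in> W'" if "s \<in> carrier D" "t \<in> carrier D" for s t
    using eq[of "s \<ominus>\<^bsub>D\<^esub> t"] that by simp
  have F: "?F (B.cl (p t)) = C.cl (q t)" if t: "t \<in> carrier D" for t
  proof -
    have "{s \<in> carrier D. p s \<in> B.cl (p t)} = {s \<in> carrier D. q s \<in> C.cl (q t)}"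
      using t by (auto simp: B.mem_cl_iff C.mem_cl_iff rel pc qc)
    also have "q ` \<dots> = C.cl (q t)"
      using C.mem_cl_carrier[OF qc[OF t]] qonto by (auto simp: image_iff)
    finally show ?thesis .
  qed
  have carB: "carrier (quot B W) = (\<lambda>t. B.cl (p t)) ` carrier D"
    unfolding B.carrier_quot ponto[symmetric] image_image ..
  have lin: "linear_map field_ring (quot B W) (quot C W') ?F"
    by (rule linear_map_factor[OF linear_map_compose[OF p B.linear_cl] carB[symmetric]
          linear_map_compose[OF q C.linear_cl] F])
  have inj: "inj_on ?F (carrier (quot B W))"
  proof -
    have "\<forall>Y\<in>carrier (quot B W). \<forall>Y'\<in>carrier (quot B W). ?F Y = ?F Y' \<longrightarrow> Y = Y'"
      unfolding carB ball_simps by (intro ballI impI) (simp only: F B.cl_eq_iff C.cl_eq_iff pc qc rel)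
    then show ?thesis unfolding inj_on_def by blast
  qed
  have onto: "?F ` carrier (quot B W) = carrier (quot C W')"
  proof -
    have "?F ` carrier (quot B W) = (\<lambda>t. ?F (B.cl (p t))) ` carrier D"
      unfolding carB image_image ..
    also have "\<dots> = (\<lambda>t. C.cl (q t)) ` carrier D"
      by (rule image_cong[OF refl]) (rule F)
    also have "\<dots> = carrier (quot C W')"
      unfolding C.carrier_quot qonto[symmetric] image_image ..
    finally show ?thesis .
  qed
  show ?thesis
    using lin inj onto by (simp add: linear_iso_def bij_betw_def)
qed

subsection \<open>Dimensions\<close>

text \<open>The constant \<open>dim\<close> is only meaningful for spaces with a finite generating set, so both facts are
  kept together.\<close>
definition has_dim :: "('a::field, 'v) module \<Rightarrow> nat \<Rightarrow> bool" where
  "has_dim M n \<longleftrightarrow> vectorspace field_ring M \<and> vectorspace.fin_dim field_ring M \<and> dimension M = n"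

lemma has_dim_dimension: "has_dim M n \<Longrightarrow> dimension M = n"
  by (simp add: has_dim_def)

lemma linear_map_vs_ofD:
  assumes "linear_map field_ring (vs_of sc V) B f"
  shows "x \<in> V \<Longrightarrow> f x \<in> carrier B" "x \<in> V \<Longrightarrow> y \<in> V \<Longrightarrow> f (x + y) = f x \<oplus>\<^bsub>B\<^esub> f y"
    "x \<in> V \<Longrightarrow> f (sc c x) = c \<odot>\<^bsub>B\<^esub> f x" "f 0 = \<zero>\<^bsub>B\<^esub>"
proof -
  interpret f: linear_map field_ring "vs_of sc V" B f by fact
  show "x \<in> V \<Longrightarrow> f x \<in> carrier B" using f.f_im[of x] by simp
  show "x \<in> V \<Longrightarrow> y \<in> V \<Longrightarrow> f (x + y) = f x \<oplus>\<^bsub>B\<^esub> f y" using f.f_add[of x y] by simp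
  show "x \<in> V \<Longrightarrow> f (sc c x) = c \<odot>\<^bsub>B\<^esub> f x" using f.f_smult[of c x] by simp
  show "f 0 = \<zero>\<^bsub>B\<^esub>" using f.f0_is_0 by simp
qed

lemma has_dim_surj:
  assumes f: "linear_map field_ring V B f" and onto: "f ` carrier V = carrier B" and V: "has_dim V v"
  shows "\<exists>b. has_dim B b"
proof -
  interpret f: linear_map field_ring V B f by fact
  have "f.W.fin_dim" using f.surj_fin_dim[OF _ onto] V by (simp add: has_dim_def)
  then show ?thesis using f.W.vectorspace_axioms by (auto simp: has_dim_def)
qed

lemma has_dim_iso:
  assumes f: "linear_map field_ring V B f" and bij: "bij_betw f (carrier V) (carrier B)"
    and V: "has_dim V v"
  shows "has_dim B v"
proof -
  interpret f: linear_map field_ring V B f by fact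
  obtain b where b: "has_dim B b" using has_dim_surj[OF f _ V] bij by (auto simp: bij_betw_def)
  moreover have "f.V.dim = f.W.dim"
    using f.dim_eq V bij by (simp add: has_dim_def bij_betw_def)
  ultimately show ?thesis using V by (simp add: has_dim_def)
qed

text \<open>A linearly independent subset of the subspace of maximal size is a basis.\<close>
lemma has_dim_subspace:
  assumes sc: "vector_space sc" and V: "is_subspace sc V" and W: "is_subspace sc W" "W \<subseteq> V"
    and dim: "has_dim (vs_of sc V) n"
  shows "\<exists>m. has_dim (vs_of sc W) m"
proof -
  interpret V: vectorspace field_ring "vs_of sc V" by (rule vectorspace_vs_of[OF sc V])
  interpret W: vectorspace field_ring "vs_of sc W" by (rule vectorspace_vs_of[OF sc W(1)])
  have sub: "submodule field_ring W (vs_of sc V)" by (rule subspace_vs_of[OF sc V W])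
  have li: "V.lin_indpt S" if "S \<subseteq> W" "W.lin_indpt S" for S
    using V.span_li_not_depend(2)[OF that(1) sub] that(2) by simp
  have "finite S \<and> card S \<le> V.dim" if "S \<subseteq> W \<and> W.lin_indpt S" for S
    using V.li_le_dim[of S] li[of S] that W(2) dim by (auto simp: has_dim_def)
  moreover have "{} \<subseteq> W \<and> W.lin_indpt {}" by (auto simp: W.lin_dep_def)
  ultimately obtain A where A: "finite A" "maximal A (\<lambda>S. S \<subseteq> W \<and> W.lin_indpt S)"
    using maximal_exists[of "\<lambda>S. S \<subseteq> W \<and> W.lin_indpt S" V.dim "{}"] by blast
  then have "W.basis A" using W.max_li_is_basis[of A] by simp
  then have "W.fin_dim" using A(1) unfolding W.fin_dim_def W.basis_def by auto
  then show ?thesis using W.vectorspace_axioms by (auto simp: has_dim_def)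
qed

lemma rank_nullity_surj:
  assumes f: "linear_map field_ring (vs_of sc V) B f" and onto: "f ` V = carrier B"
    and V: "has_dim (vs_of sc V) v" and B: "has_dim B b"
    and W: "has_dim (vs_of sc W) w" "W = {x \<in> V. f x = \<zero>\<^bsub>B\<^esub>}"
  shows "v = b + w"
proof -
  interpret f: linear_map field_ring "vs_of sc V" B f by fact
  have "f.imT = carrier B" "f.kerT = W" using onto W(2) by (auto simp: f.im_def f.ker_def)
  then show ?thesis using f.rank_nullity V B W(1) by (simp add: has_dim_def)
qed

text \<open>Lifts of a basis of the image together with a basis of the kernel generate the source.\<close>
lemma fin_dim_extension:
  assumes sc: "vector_space sc" and V: "is_subspace sc V" and f: "linear_map field_ring (vs_of sc V) B f"
    and onto: "f ` V = carrier B" and B: "has_dim B b"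
    and W: "has_dim (vs_of sc W) w" "W = {x \<in> V. f x = \<zero>\<^bsub>B\<^esub>}"
  shows "has_dim (vs_of sc V) (b + w)"
proof -
  interpret B: vectorspace field_ring B using B by (simp add: has_dim_def)
  interpret V: vectorspace field_ring "vs_of sc V" by (rule vectorspace_vs_of[OF sc V])
  interpret f: linear_map field_ring "vs_of sc V" B f by fact
  interpret W: vectorspace field_ring "vs_of sc W" using W(1) by (simp add: has_dim_def)
  have W': "W \<subseteq> V" using W(2) by auto
  obtain S where S: "finite S" "S \<subseteq> W" "W.span S = W"
    using W(1) by (auto simp: has_dim_def W.fin_dim_def)
  obtain T where T: "finite T" "T \<subseteq> carrier B" "B.span T = carrier B"
    using B by (auto simp: has_dim_def B.fin_dim_def)
  obtain T' where T': "finite T'" "T' \<subseteq> V" "f ` T' = T"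
    using T(1,2) onto by (metis finite_subset_image)
  have ST: "S \<union> T' \<subseteq> carrier (vs_of sc V)" using S(2) T'(2) W' by auto
  define U where "U = V.span (S \<union> T')"
  have Us: "submodule field_ring U (vs_of sc V)" unfolding U_def by (rule V.span_is_submodule[OF ST])
  interpret U: submodule field_ring U "vs_of sc V" by (rule Us)
  have U: "is_subspace sc U"
    using U.zero_closed U.m_closed U.smult_closed by (auto simp: is_subspace_def)
  have STU: "S \<union> T' \<subseteq> U" unfolding U_def by (rule V.in_own_span[OF ST])
  have UV: "U \<subseteq> V" using U.subset by simp
  note fD = linear_map_vs_ofD[OF f]
  have Wsub: "is_subspace sc W"
    by (rule is_subspaceI) (use fD is_subspaceD[OF V] in \<open>simp_all add: W(2)\<close>)
  have "W \<subseteq> U"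
  proof -
    have "submodule field_ring (U \<inter> W) (vs_of sc W)"
      by (rule subspace_vs_of[OF sc Wsub is_subspace_Int[OF U Wsub]]) auto
    then have "W.span S \<subseteq> U \<inter> W"
      by (rule W.span_is_subset[rotated]) (use S STU in auto)
    then show ?thesis using S(3) by auto
  qed
  have fU: "f ` U = carrier B"
  proof -
    have "submodule field_ring (f ` U) B"
    proof unfold_locales
      show "f ` U \<subseteq> carrier B" using UV fD(1) by auto
      show "\<zero>\<^bsub>B\<^esub> \<in> f ` U" using is_subspaceD(1)[OF U] fD(4) by (metis imageI)
      show "v \<oplus>\<^bsub>B\<^esub> w \<in> f ` U" if vw: "v \<in> f ` U" "w \<in> f ` U" for v w
      proof -
        obtain a b where ab: "a \<in> U" "b \<in> U" "v = f a" "w = f b" using vw by blast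
        have "a \<in> V" "b \<in> V" using ab(1,2) UV by blast+
        then have "v \<oplus>\<^bsub>B\<^esub> w = f (a + b)" by (simp only: ab fD)
        then show ?thesis using is_subspaceD(2)[OF U ab(1,2)] by blast
      qed
      show "c \<odot>\<^bsub>B\<^esub> v \<in> f ` U" if v: "v \<in> f ` U" for c v
      proof -
        obtain a where a: "a \<in> U" "v = f a" using v by blast
        have "a \<in> V" using a(1) UV by blast
        then have "c \<odot>\<^bsub>B\<^esub> v = f (sc c a)" by (simp only: a fD)
        then show ?thesis using is_subspaceD(3)[OF U a(1)] by blast
      qed
    qed
    then have "B.span T \<subseteq> f ` U"
      by (rule B.span_is_subset[rotated]) (use T' STU in auto)
    moreover have "f ` U \<subseteq> carrier B" using UV fD(1) by auto
    ultimately show ?thesis using T(3) by auto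
  qed
  have "V \<subseteq> U"
  proof
    fix x assume x: "x \<in> V"
    then have "f x \<in> f ` U" using fU fD(1) by simp
    then obtain u where u: "u \<in> U" "f x = f u" by auto
    have "x - u \<in> V" using is_subspace_diff[OF sc V x] u UV by auto
    moreover have "f (x - u) = \<zero>\<^bsub>B\<^esub>"
    proof -
      have u': "u \<in> V" using u(1) UV by blast
      have c: "f (x - u) \<in> carrier B" "f u \<in> carrier B" using fD(1) u' \<open>x - u \<in> V\<close> by blast+
      have "f x = f (x - u) \<oplus>\<^bsub>B\<^esub> f u"
        using fD(2)[OF \<open>x - u \<in> V\<close> u'] by simp
      then have "f (x - u) \<oplus>\<^bsub>B\<^esub> f u = \<zero>\<^bsub>B\<^esub> \<oplus>\<^bsub>B\<^esub> f u" using c u(2) by simp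
      then show ?thesis using c B.M.add.right_cancel[of "f u" "f (x - u)" "\<zero>\<^bsub>B\<^esub>"] by simp
    qed
    ultimately have "x - u \<in> U" using W(2) \<open>W \<subseteq> U\<close> by auto
    then show "x \<in> U" using is_subspaceD(2)[OF U \<open>x - u \<in> U\<close> u(1)] by simp
  qed
  then have "V.span (S \<union> T') = V" using UV by (auto simp: U_def)
  then have "V.fin_dim" unfolding V.fin_dim_def using S(1) T'(1) ST by auto
  then have "has_dim (vs_of sc V) (dimension (vs_of sc V))"
    using V.vectorspace_axioms by (simp add: has_dim_def)
  then show ?thesis
    using rank_nullity_surj[OF f onto _ B W] by (metis has_dim_dimension)
qed

lemma has_dim_0:
  assumes "vector_space sc" shows "has_dim (vs_of sc {0}) 0"
proof -
  interpret sc: vector_space sc by fact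
  interpret vectorspace field_ring "vs_of sc {0}"
    by (rule vectorspace_vs_of[OF assms]) (simp add: is_subspace_def)
  have g: "span {0} = {0}" using span_is_subset2[of "{0}"] in_own_span[of "{0}"] by auto
  then have "dim = 0" using dim0I by simp
  moreover have "fin_dim" unfolding fin_dim_def using g by auto
  ultimately show ?thesis using vectorspace_axioms by (simp add: has_dim_def)
qed

lemma has_dim_0_iff:
  assumes "has_dim M 0" shows "carrier M = {\<zero>\<^bsub>M\<^esub>}"
proof -
  interpret vectorspace field_ring M using assms by (simp add: has_dim_def)
  obtain A where A: "finite A" "basis A" using finite_basis_exists assms by (auto simp: has_dim_def)
  then have "card A = 0" using dim_basis assms by (simp add: has_dim_def)
  then have "A = {}" using A(1) by simp
  then show ?thesis using A(2) by (simp add: basis_def span_empty)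
qed


section \<open>Laurent polynomials\<close>

lemma lookup_lscale [simp]: "lookup (lscale c f) e = c * lookup f e"
  by (simp add: lscale_def Poly_Mapping.map.rep_eq when_def)

lemma vector_space_lscale: "vector_space (lscale :: 'a::field \<Rightarrow> ('b \<Rightarrow>\<^sub>0 'a) \<Rightarrow> 'b \<Rightarrow>\<^sub>0 'a)"
  by unfold_locales (auto intro!: poly_mapping_eqI simp: lookup_add algebra_simps)

lemma vscale_nth [simp]: "vscale sc c v $ i = sc c (v $ i)"
  by (simp add: vscale_def)

lemma vector_space_vscale:
  assumes "vector_space sc" shows "vector_space (vscale sc)"
proof -
  interpret vector_space sc by fact
  show ?thesis by unfold_locales (simp_all add: vec_eq_iff scale_right_distrib scale_left_distrib)
qed

lemma vector_space_fscale: "vector_space (fscale :: 'a::field \<Rightarrow> _)"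
  by (rule vector_space_vscale[OF vector_space_lscale])

lemma lscale_conv_mult: "lscale c f = single 0 c * f"
  for f :: "'b::cancel_comm_monoid_add \<Rightarrow>\<^sub>0 'a::field"
  unfolding lscale_def by (rule mult_map_scale_conv_mult)

lemma lscale_times_left: "lscale c f * g = lscale c (f * g)"
  and lscale_times_right: "f * lscale c g = lscale c (f * g)"
  for f :: "'b::cancel_comm_monoid_add \<Rightarrow>\<^sub>0 'a::field"
  by (simp_all add: lscale_conv_mult algebra_simps)

lemma keys_lscale: "keys (lscale c f) \<subseteq> keys f"
  by (auto simp: in_keys_iff)

subsection \<open>Dimensions of coordinate spaces\<close>

lemma vector_space_times: "vector_space ((*) :: 'a::field \<Rightarrow> 'a \<Rightarrow> 'a)"
  by unfold_locales (simp_all add: algebra_simps)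

lemma has_dim_scalars: "has_dim (vs_of ((*) :: 'a::field \<Rightarrow> 'a \<Rightarrow> 'a) UNIV) 1"
proof -
  interpret vectorspace field_ring "vs_of ((*) :: 'a \<Rightarrow> 'a \<Rightarrow> 'a) UNIV"
    by (rule vectorspace_vs_of[OF vector_space_times]) (simp add: is_subspace_def)
  have sub: "is_subspace ((*) :: 'a \<Rightarrow> 'a \<Rightarrow> 'a) (lin_span (*) {1})"
    by (rule is_subspace_lin_span[OF vector_space_times])
  have "1 \<in> lin_span ((*) :: 'a \<Rightarrow> 'a \<Rightarrow> 'a) {1}"
    using lin_span_superset[OF vector_space_times] by blast
  then have "c \<in> span {1}" for c using is_subspaceD(3)[OF sub, of 1 c] by simp
  then have g: "span {1} = UNIV" by auto
  then have "dim = 1" by (intro dim1I) auto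
  moreover have "fin_dim" unfolding fin_dim_def using g by (intro exI[of _ "{1}"]) auto
  ultimately show ?thesis using vectorspace_axioms by (simp add: has_dim_def)
qed

lemma is_subspace_keys: "is_subspace lscale {f :: 'b \<Rightarrow>\<^sub>0 'a::field. keys f \<subseteq> B}"
proof -
  have *: "keys f \<subseteq> B \<longleftrightarrow> (\<forall>e. e \<notin> B \<longrightarrow> lookup f e = 0)" for f :: "'b \<Rightarrow>\<^sub>0 'a"
    by (auto simp: in_keys_iff)
  show ?thesis by (rule is_subspaceI) (simp_all add: * lookup_add)
qed

text \<open>Split off one coordinate at a time.\<close>
lemma has_dim_keys:
  assumes "finite B"
  shows "has_dim (vs_of lscale {f :: 'b \<Rightarrow>\<^sub>0 'a::field. keys f \<subseteq> B}) (card B)"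
  using assms
proof (induction B)
  case empty
  then show ?case using has_dim_0[OF vector_space_lscale] by simp
next
  case (insert b B)
  let ?V = "\<lambda>B. {f :: 'b \<Rightarrow>\<^sub>0 'a. keys f \<subseteq> B}"
  have "linear_map field_ring (vs_of lscale (?V (insert b B))) (vs_of (*) UNIV)
      (\<lambda>f. lookup f b)"
    by (rule linear_mapI[OF vectorspace_vs_of[OF vector_space_lscale is_subspace_keys]
          vectorspace_vs_of[OF vector_space_times]]) (auto simp: is_subspace_def lookup_add)
  moreover have "(\<lambda>f. lookup f b) ` ?V (insert b B) = UNIV"
  proof -
    have "c \<in> (\<lambda>f. lookup f b) ` ?V (insert b B)" for c
      by (rule image_eqI[of _ _ "single b c"]) auto
    then show ?thesis by auto
  qed
  moreover have "?V B = {f \<in> ?V (insert b B). lookup f b = 0}"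
    using insert.hyps(2) by (auto simp: in_keys_iff)
  ultimately have "has_dim (vs_of lscale (?V (insert b B))) (1 + card B)"
    by (intro fin_dim_extension[OF vector_space_lscale is_subspace_keys _ _ has_dim_scalars insert.IH])
      auto
  then show ?case using insert.hyps by simp
qed

text \<open>The power \<open>V^J\<close> inside the triples, so that \<open>V\<close>, \<open>V^2\<close> and \<open>V^3\<close> can be treated by induction on \<open>J\<close>.\<close>
definition power_space :: "3 set \<Rightarrow> 'v::zero set \<Rightarrow> ('v ^ 3) set" where
  "power_space J V = {w. (\<forall>j\<in>J. w $ j \<in> V) \<and> (\<forall>j. j \<notin> J \<longrightarrow> w $ j = 0)}"

lemma is_subspace_power_space:
  assumes "vector_space sc" "is_subspace sc V"
  shows "is_subspace (vscale sc) (power_space J V)"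
proof -
  interpret vector_space sc by fact
  show ?thesis by (rule is_subspaceI) (auto simp: power_space_def is_subspaceD[OF assms(2)])
qed

lemma has_dim_power_space:
  assumes sc: "vector_space sc" and V: "is_subspace sc V" and dim: "has_dim (vs_of sc V) n"
  shows "has_dim (vs_of (vscale sc) (power_space J V)) (card J * n)"
proof -
  have "finite J" by simp
  then show ?thesis
  proof (induction J)
    case empty
    have "power_space {} V = {0}" by (auto simp: power_space_def vec_eq_iff)
    then show ?case using has_dim_0[OF vector_space_vscale[OF sc]] by simp
  next
    case (insert j J)
    note vs = vector_space_vscale[OF sc] is_subspace_power_space[OF sc V]
    have lin: "linear_map field_ring (vs_of (vscale sc) (power_space (insert j J) V)) (vs_of sc V)
        (\<lambda>w. w $ j)"
      by (rule linear_mapI[OF vectorspace_vs_of[OF vs] vectorspace_vs_of[OF sc V]])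
        (auto simp: power_space_def)
    have onto: "(\<lambda>w. w $ j) ` power_space (insert j J) V = carrier (vs_of sc V)"
    proof -
      have "x \<in> (\<lambda>w. w $ j) ` power_space (insert j J) V" if "x \<in> V" for x
        by (rule image_eqI[of _ _ "axis j x"])
          (use that in \<open>auto simp: power_space_def axis_def is_subspaceD[OF V]\<close>)
      then show ?thesis by (auto simp: power_space_def)
    qed
    have "power_space J V = {w \<in> power_space (insert j J) V. w $ j = 0}"
      using insert.hyps(2) by (auto simp: power_space_def) (metis is_subspaceD(1)[OF V])+
    then have "has_dim (vs_of (vscale sc) (power_space (insert j J) V)) (n + card J * n)"
      by (intro fin_dim_extension[OF vs lin onto dim insert.IH]) auto
    then show ?case using insert.hyps by simp
  qed
qed

subsection \<open>Monomials\<close>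

definition lmon :: "int ^ 3 \<Rightarrow> 'a::field laurent" where
  "lmon e = single e 1"

lemma lmon_0 [simp]: "lmon 0 = 1"
  by (simp add: lmon_def)

lemma lmon_add: "lmon (a + b) = lmon a * lmon b"
  by (simp add: lmon_def mult_single)

lemma lmon_power: "lmon a ^ n = lmon (of_nat n * a)"
  by (induction n) (simp_all add: lmon_add distrib_right)

lemma X_lmon: "X j = lmon (axis j 1)"
  by (simp add: X_def lmon_def)

lemma lmon_inverse [simp]: "lmon a * lmon (- a) = 1" "lmon (- a) * lmon a = 1"
  by (simp_all flip: lmon_add)

lemma lmon_inverse_assoc [simp]: "lmon a * (lmon (- a) * f) = f" "lmon (- a) * (lmon a * f) = f"
  by (simp_all flip: mult.assoc)

lemma lookup_lmon_times [simp]: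
  fixes f :: "'a::field laurent"
  shows "lookup (lmon a * f) e = lookup f (e - a)"
proof -
  have "lookup (lmon a * f) e =
      (\<Sum>l. lookup (lmon a) l * (\<Sum>q. lookup f q when e = l + q))"
    by (rule lookup_mult)
  also have "\<dots> = (\<Sum>l. (\<Sum>q. lookup f q when e = a + q) when l = a)"
    by (rule Sum_any.cong) (auto simp: lmon_def lookup_single when_def)
  also have "\<dots> = (\<Sum>q. lookup f q when e = a + q)" by simp
  also have "\<dots> = (\<Sum>q. lookup f q when q = e - a)"
    by (rule Sum_any.cong) (auto simp: when_def algebra_simps)
  also have "\<dots> = lookup f (e - a)" by simp
  finally show ?thesis .
qed

lemma keys_lmon_times: "keys (lmon a * f) = (\<lambda>e. e + a) ` keys f"
proof (intro Set.set_eqI iffI)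
  fix e assume "e \<in> keys (lmon a * f)"
  then show "e \<in> (\<lambda>e. e + a) ` keys f"
    by (intro image_eqI[of _ _ "e - a"]) (auto simp: in_keys_iff)
qed (auto simp: in_keys_iff)

text \<open>The exponent of \<open>(\<Prod>j\<in>S. x_j)^N\<close>.\<close>
definition supp_exp :: "nat \<Rightarrow> 3 set \<Rightarrow> int ^ 3" where
  "supp_exp N S = (\<chi> j. if j \<in> S then int N else 0)"

lemma prod_X_power: "(\<Prod>j\<in>S. X j :: 'a::field laurent) ^ N = lmon (supp_exp N S)"
proof -
  have "finite S" by simp
  then have "(\<Prod>j\<in>S. X j :: 'a laurent) = lmon (supp_exp 1 S)"
  proof (induction S)
    case empty
    have "supp_exp 1 {} = 0" by (simp add: supp_exp_def vec_eq_iff)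
    then show ?case by simp
  next
    case (insert j S)
    have "supp_exp 1 (insert j S) = axis j 1 + supp_exp 1 S"
      using insert.hyps by (auto simp: supp_exp_def vec_eq_iff axis_def)
    then show ?case using insert by (simp add: lmon_add X_lmon)
  qed
  moreover have "of_nat N * supp_exp 1 S = supp_exp N S"
    by (simp add: supp_exp_def vec_eq_iff of_nat_index)
  ultimately show ?thesis by (simp only: lmon_power)
qed

lemma laurent_sum: "f = (\<Sum>e\<in>keys f. lscale (lookup f e) (lmon e))"
proof (rule poly_mapping_eqI)
  fix k
  have "lookup (\<Sum>e\<in>keys f. lscale (lookup f e) (lmon e)) k
    = (\<Sum>e\<in>keys f. if e = k then lookup f e else 0)"
    unfolding lookup_sum by (rule sum.cong) (auto simp: lmon_def lookup_single when_def)
  also have "\<dots> = lookup f k" by (simp add: in_keys_iff)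
  finally show "lookup f k =
    lookup (\<Sum>e\<in>keys f. lscale (lookup f e) (lmon e)) k" by simp
qed

subsection \<open>Degrees, polynomials and ideals\<close>

definition deg :: "int ^ 3 \<Rightarrow> int" where "deg e = (\<Sum>j\<in>UNIV. e $ j)"

lemma deg_add: "deg (a + b) = deg a + deg b" by (simp add: deg_def sum.distrib)
lemma deg_0 [simp]: "deg 0 = 0" by (simp add: deg_def)
lemma deg_uminus: "deg (- a) = - deg a" by (simp add: deg_def sum_negf)
lemma deg_diff: "deg (a - b) = deg a - deg b" by (simp add: deg_def sum_subtractf)
lemma axis_nth_if: "axis j c $ i = (if i = j then c else 0)" by (simp add: axis_def)

lemma deg_axis [simp]: "deg (axis j c) = c" by (simp add: deg_def axis_def)
lemma deg_supp_exp: "deg (supp_exp N S) = int N * int (card S)"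
  by (simp add: deg_def supp_exp_def flip: sum.inter_filter)

lemma homog_iff: "f \<in> homog d \<longleftrightarrow> (\<forall>e\<in>keys f. deg e = d)"
  by (simp add: homog_def deg_def)

lemma lmon_homog: "lmon e \<in> homog (deg e)"
  by (simp add: homog_iff lmon_def)

lemma homog_mult: "f \<in> homog a \<Longrightarrow> g \<in> homog b \<Longrightarrow> f * g \<in> homog (a + b)"
  unfolding homog_iff using keys_mult[of f g] by (fastforce simp: deg_add)

lemma is_subspace_homog: "is_subspace lscale (homog d :: 'a::field laurent set)"
proof -
  have "homog d = {f :: 'a laurent. keys f \<subseteq> {e. deg e = d}}"
    by (rule Set.set_eqI) (simp only: homog_iff mem_Collect_eq subset_iff Ball_def)
  then show ?thesis using is_subspace_keys[of "{e. deg e = d}"] by (simp only:)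
qed

lemma polys_add: "f \<in> polys \<Longrightarrow> g \<in> polys \<Longrightarrow> f + g \<in> polys"
  unfolding polys_def using keys_add[of f g] by blast

lemma polys_mult: "f \<in> polys \<Longrightarrow> g \<in> polys \<Longrightarrow> f * g \<in> polys"
  unfolding polys_def using keys_mult[of f g] by fastforce

lemma polys_lscale: "f \<in> polys \<Longrightarrow> lscale c f \<in> polys"
  unfolding polys_def using keys_lscale[of c f] by blast

lemma lmon_polys: "(\<And>j. 0 \<le> e $ j) \<Longrightarrow> lmon e \<in> polys"
  by (simp add: polys_def lmon_def)

lemma polys_0 [simp]: "0 \<in> polys" and polys_1 [simp]: "1 \<in> polys"
  by (simp_all add: polys_def)

lemma polys_X [simp]: "X j \<in> polys"
  by (simp add: X_lmon lmon_polys axis_def)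

lemma polys_power: "f \<in> polys \<Longrightarrow> f ^ n \<in> polys"
  by (induction n) (simp_all add: polys_mult)

lemma polys_uminus: "f \<in> polys \<Longrightarrow> - f \<in> polys"
  by (simp add: polys_def)

definition poly_ideal :: "'a::field laurent set \<Rightarrow> bool" where
  "poly_ideal I \<longleftrightarrow> I \<subseteq> polys \<and> 0 \<in> I \<and> (\<forall>f\<in>I. \<forall>g\<in>I. f + g \<in> I) \<and> (\<forall>f\<in>polys. \<forall>g\<in>I. f * g \<in> I)"

lemma poly_idealD:
  assumes "poly_ideal I"
  shows "f \<in> I \<Longrightarrow> f \<in> polys" "0 \<in> I" "f \<in> I \<Longrightarrow> g \<in> I \<Longrightarrow> f + g \<in> I" "h \<in> polys \<Longrightarrow> f \<in> I \<Longrightarrow> h * f \<in> I"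
  using assms by (auto simp: poly_ideal_def)

lemma poly_ideal_polys: "poly_ideal polys"
  by (simp add: poly_ideal_def polys_add polys_mult)

lemma poly_ideal_lscale:
  assumes "poly_ideal I" "f \<in> I" shows "lscale c f \<in> I"
  unfolding lscale_conv_mult using assms by (intro poly_idealD(4)) (simp_all add: polys_def)

subsection \<open>Sections of the sheaf of an ideal\<close>

lemma shf_iff: "f \<in> shf I d S \<longleftrightarrow> f \<in> homog d \<and> (\<exists>N. lmon (supp_exp N S) * f \<in> I)"
  by (simp add: shf_def prod_X_power)

lemma supp_exp_nonneg: "0 \<le> supp_exp N S $ j"
  by (simp add: supp_exp_def)

text \<open>Denominators may be enlarged, both in the exponent and in the set of variables.\<close>
lemma shf_denominator:
  assumes I: "poly_ideal I" and f: "lmon (supp_exp N S) * f \<in> I" and "N \<le> M" "S \<subseteq> T"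
  shows "lmon (supp_exp M T) * f \<in> I"
proof -
  have "lmon (supp_exp M T - supp_exp N S) * (lmon (supp_exp N S) * f) \<in> I"
    using assms(3,4) by (intro poly_idealD(4)[OF I _ f] lmon_polys) (auto simp: supp_exp_def)
  then show ?thesis by (simp flip: mult.assoc lmon_add)
qed

lemma shf_mono: "poly_ideal I \<Longrightarrow> S \<subseteq> T \<Longrightarrow> shf I d S \<subseteq> shf I d T"
  using shf_denominator[OF _ _ order_refl] unfolding shf_iff subset_iff by metis

lemma shf_subset_polys: "poly_ideal I \<Longrightarrow> shf I d S \<subseteq> shf polys d S"
  unfolding shf_iff subset_iff using poly_idealD(1) by blast

lemma is_subspace_shf:
  assumes I: "poly_ideal I" shows "is_subspace lscale (shf I d S)"
proof (rule is_subspaceI)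
  note H = is_subspaceD[OF is_subspace_homog]
  show "0 \<in> shf I d S" using H poly_idealD(2)[OF I] by (simp add: shf_iff)
  show "lscale c f \<in> shf I d S" if "f \<in> shf I d S" for c f
    using that H poly_ideal_lscale[OF I] unfolding shf_iff lscale_times_right by blast
  show "f + g \<in> shf I d S" if fg: "f \<in> shf I d S" "g \<in> shf I d S" for f g
  proof -
    obtain M N where "lmon (supp_exp M S) * f \<in> I" "lmon (supp_exp N S) * g \<in> I"
      using fg by (auto simp: shf_iff)
    then have "lmon (supp_exp (max M N) S) * f + lmon (supp_exp (max M N) S) * g \<in> I"
      by (intro poly_idealD(3)[OF I]) (auto intro: shf_denominator[OF I])
    then show ?thesis using fg H by (auto simp: shf_iff distrib_left)
  qed
qed

lemma shf_mult:
  assumes I: "poly_ideal I" and f: "f \<in> shf polys a S" and g: "g \<in> shf I b S"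
  shows "f * g \<in> shf I (a + b) S"
proof -
  obtain M N where "lmon (supp_exp M S) * f \<in> polys" "lmon (supp_exp N S) * g \<in> I"
    using f g by (auto simp: shf_iff)
  then have "(lmon (supp_exp M S) * f) * (lmon (supp_exp N S) * g) \<in> I"
    by (rule poly_idealD(4)[OF I])
  moreover have "supp_exp (M + N) S = supp_exp M S + supp_exp N S"
    by (simp add: supp_exp_def vec_eq_iff)
  ultimately have "lmon (supp_exp (M + N) S) * (f * g) \<in> I"
    by (simp add: lmon_add mult_ac)
  then show ?thesis using f g homog_mult by (auto simp: shf_iff)
qed

text \<open>Only finitely many exponents occur, so nonnegativity outside \<open>S\<close> bounds the denominator.\<close>
lemma shf_polys_iff:
  "f \<in> shf polys d S \<longleftrightarrow> f \<in> homog d \<and> (\<forall>e\<in>keys f. \<forall>j. j \<notin> S \<longrightarrow> 0 \<le> e $ j)"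
proof
  assume f: "f \<in> shf polys d S"
  then obtain N where N: "lmon (supp_exp N S) * f \<in> polys" by (auto simp: shf_iff)
  have "0 \<le> e $ j" if "e \<in> keys f" "j \<notin> S" for e j
  proof -
    have "e + supp_exp N S \<in> keys (lmon (supp_exp N S) * f)"
      using that by (simp add: keys_lmon_times)
    then have "0 \<le> (e + supp_exp N S) $ j" using N by (auto simp: polys_def)
    then show ?thesis using that by (simp add: supp_exp_def)
  qed
  then show "f \<in> homog d \<and> (\<forall>e\<in>keys f. \<forall>j. j \<notin> S \<longrightarrow> 0 \<le> e $ j)"
    using f by (auto simp: shf_iff)
next
  assume f: "f \<in> homog d \<and> (\<forall>e\<in>keys f. \<forall>j. j \<notin> S \<longrightarrow> 0 \<le> e $ j)"
  define N where "N = (\<Sum>e\<in>keys f. \<Sum>j\<in>UNIV. nat \<bar>e $ j\<bar>)"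
  have N: "\<bar>e $ j\<bar> \<le> int N" if "e \<in> keys f" for e j
  proof -
    have "nat \<bar>e $ j\<bar> \<le> (\<Sum>j\<in>UNIV. nat \<bar>e $ j\<bar>)" by (rule member_le_sum) auto
    also have "\<dots> \<le> N" unfolding N_def
      by (rule member_le_sum[where f = "\<lambda>e. \<Sum>j\<in>UNIV. nat \<bar>e $ j\<bar>"]) (use that in auto)
    finally show ?thesis by linarith
  qed
  have "lmon (supp_exp N S) * f \<in> polys"
    unfolding polys_def
  proof (intro CollectI ballI allI)
    fix e' j assume "e' \<in> keys (lmon (supp_exp N S) * f)"
    then obtain e where e: "e \<in> keys f" "e' = e + supp_exp N S"
      by (auto simp: keys_lmon_times)
    show "0 \<le> e' $ j"
      using N[OF e(1), of j] f e by (cases "j \<in> S") (auto simp: supp_exp_def)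
  qed
  then show "f \<in> shf polys d S" using f by (auto simp: shf_iff)
qed

lemma lmon_shf: "(\<And>j. j \<notin> S \<Longrightarrow> 0 \<le> e $ j) \<Longrightarrow> d = deg e \<Longrightarrow> lmon e \<in> shf polys d S"
  using lmon_homog[of e] by (auto simp: shf_polys_iff lmon_def)

lemma X_times_shf: "poly_ideal I \<Longrightarrow> f \<in> shf I d S \<Longrightarrow> X j * f \<in> shf I (d + 1) S"
  using shf_mult[OF _ lmon_shf[of S "axis j 1" 1], of I f d]
  by (simp add: X_lmon axis_nth_if add.commute)

lemma X_divide_shf:
  "poly_ideal I \<Longrightarrow> f \<in> shf I d S \<Longrightarrow> j \<in> S \<Longrightarrow> lmon (- axis j 1) * f \<in> shf I (d - 1) S"
proof -
  assume I: "poly_ideal I" and f: "f \<in> shf I d S" and j: "j \<in> S"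
  have "lmon (- axis j 1) \<in> shf polys (-1) S"
    by (rule lmon_shf) (use j in \<open>auto simp: axis_nth_if deg_uminus\<close>)
  from shf_mult[OF I this f] show ?thesis by simp
qed

lemma X_times_shf_iff:
  assumes "poly_ideal I" "j \<in> S"
  shows "X j * f \<in> shf I (d + 1) S \<longleftrightarrow> f \<in> shf I d S"
  using X_times_shf[OF assms(1), of f d S j] X_divide_shf[OF assms(1) _ assms(2), of "X j * f" "d + 1"]
  by (auto simp: X_lmon)

subsection \<open>Forms\<close>

lemma glob_shf_polys: "glob (shf polys d :: _ \<Rightarrow> 'a::field laurent set) = polys \<inter> homog d"
proof -
  have "f \<in> polys" if f: "\<forall>i. f \<in> shf polys d {i}" for f :: "'a laurent"
    unfolding polys_def
  proof (intro CollectI ballI allI)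
    fix e and j :: 3 assume "e \<in> keys f"
    moreover have "j \<notin> {j + 1}" by simp
    ultimately show "0 \<le> e $ j" using f shf_polys_iff by blast
  qed
  moreover have "f \<in> shf polys d {i}" if "f \<in> polys" "f \<in> homog d" for f :: "'a laurent" and i
    using that unfolding shf_polys_iff by (simp add: polys_def)
  moreover have "f \<in> homog d" if "\<forall>i. f \<in> shf polys d {i}" for f :: "'a laurent"
    using that unfolding shf_polys_iff by simp
  ultimately show ?thesis unfolding glob_def by (intro Set.set_eqI) (simp, metis)
qed

lemma is_subspace_glob: "(\<And>i. is_subspace sc (F {i})) \<Longrightarrow> is_subspace sc (glob F)"
  unfolding glob_def by (rule is_subspace_INT)

lemma card_triangle: "card {(a, b). a + b < (M::nat)} = (M + 1) choose 2"
proof -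
  have "{(a, b). a + b < M} = (SIGMA a:{..<M}. {..<M - a})" by auto
  then have "card {(a, b). a + b < M} = (\<Sum>a<M. M - a)" by simp
  also have "\<dots> = (\<Sum>a<M. Suc a)" by (rule sum.reindex_bij_witness[of _ "\<lambda>a. M - Suc a" "\<lambda>a. M - Suc a"]) auto
  also have "\<dots> = (M + 1) choose 2"
    by (induction M) (simp_all add: numeral_2_eq_2)
  finally show ?thesis .
qed

lemma deg_3: "deg e = e $ 1 + e $ 2 + e $ 3"
  by (simp add: deg_def sum_3)

text \<open>The monomials of degree \<open>d\<close> that vanish at \<open>(1 : 0 : 0)\<close> to order less than \<open>M\<close>; for \<open>M = d + 1\<close> all
  of them.  The three indices are written \<open>1, 2, 3\<close>, where \<open>3 = 0\<close>.\<close>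
definition low_exps :: "nat \<Rightarrow> nat \<Rightarrow> (int ^ 3) set" where
  "low_exps d M = {e. (\<forall>j. 0 \<le> e $ j) \<and> deg e = int d \<and> e $ 2 + e $ 3 < int M}"

lemma bij_low_exps:
  assumes "M \<le> d + 1"
  shows "bij_betw (\<lambda>e. (nat (e $ 2), nat (e $ 3))) (low_exps d M) {(a, b). a + b < M}"
proof (rule bij_betw_byWitness[where f' = "\<lambda>(a, b). vector [int d - int a - int b, int a, int b]"])
  show "\<forall>e\<in>low_exps d M. (\<lambda>(a, b). vector [int d - int a - int b, int a, int b])
      (nat (e $ 2), nat (e $ 3)) = e"
    by (auto simp: low_exps_def vec_eq_iff forall_3 deg_3)
  show "(\<lambda>(a, b). vector [int d - int a - int b, int a, int b]) ` {(a, b). a + b < M} \<subseteq> low_exps d M"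
    using assms by (auto simp: low_exps_def forall_3 deg_3)
qed (auto simp: low_exps_def forall_3)

lemma finite_low_exps: "M \<le> d + 1 \<Longrightarrow> finite (low_exps d M)"
proof -
  assume M: "M \<le> d + 1"
  have "finite {(a, b). a + b < M}"
    by (rule finite_subset[of _ "{..<M} \<times> {..<M}"]) auto
  then show ?thesis using bij_betw_finite[OF bij_low_exps[OF M]] by simp
qed

lemma card_low_exps: "M \<le> d + 1 \<Longrightarrow> card (low_exps d M) = (M + 1) choose 2"
  using bij_betw_same_card[OF bij_low_exps] card_triangle by metis

lemma has_dim_forms:
  "has_dim (vs_of lscale (polys \<inter> homog (int d) :: 'a::field laurent set)) ((d + 2) choose 2)"
proof -
  have "polys \<inter> homog (int d) = {f :: 'a laurent. keys f \<subseteq> low_exps d (d + 1)}"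
  proof -
    have "deg e = int d \<Longrightarrow> (\<forall>j. 0 \<le> e $ j) \<Longrightarrow> e $ 2 + e $ 3 < int (d + 1)" for e
      by (auto simp: deg_3 forall_3)
    then show ?thesis by (auto simp: polys_def homog_iff low_exps_def subset_iff)
  qed
  then show ?thesis using has_dim_keys[OF finite_low_exps[of "d + 1" d]] card_low_exps[of "d + 1" d] by simp
qed


lemma linear_iso_cong:
  assumes f: "linear_iso A B f" and eq: "\<And>x. x \<in> carrier A \<Longrightarrow> f x = g x"
  shows "linear_iso A B g"
proof -
  interpret f: linear_map field_ring A B f using f by (simp add: linear_iso_def)
  interpret A: vectorspace field_ring A by (rule f.V.vectorspace_axioms)
  have "linear_map field_ring A B g"
    by (rule linear_mapI[OF f.V.vectorspace_axioms f.W.vectorspace_axioms])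
      (simp_all flip: eq)
  then show ?thesis using f bij_betw_cong[of "carrier A" f g "carrier B"] eq by (simp add: linear_iso_def)
qed

section \<open>Cech cohomology of a subsheaf\<close>

definition const_vec :: "'v \<Rightarrow> 'v ^ 3" where "const_vec s = (\<chi> i. s)"

lemma const_vec_nth [simp]: "const_vec s $ i = s" by (simp add: const_vec_def)

lemma coboundary_nth [simp]: "coboundary t $ i $ j = t $ j - t $ i" by (simp add: coboundary_def)

lemma coboundary_add: "coboundary (s + t) = coboundary s + coboundary t"
  and coboundary_diff: "coboundary (s - t) = coboundary s - coboundary t"
  by (simp_all add: vec_eq_iff)

lemma coboundary_const [simp]: "coboundary (const_vec s) = 0"
  by (simp add: vec_eq_iff)

lemma coboundary_eq_iff: "coboundary s = coboundary t \<longleftrightarrow> (\<exists>x. s = t + const_vec x)"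
proof
  assume "coboundary s = coboundary t"
  then have "s $ i - s $ 1 = t $ i - t $ 1" for i by (metis coboundary_nth)
  then have "s = t + const_vec (s $ 1 - t $ 1)" by (simp add: vec_eq_iff algebra_simps)
  then show "\<exists>x. s = t + const_vec x" ..
qed (auto simp: coboundary_add)

text \<open>A sheaf \<open>F\<close> and a subsheaf \<open>G\<close>, given by their sections over the \<open>U_S\<close> inside one vector space.\<close>
locale cech_pair =
  fixes sc :: "'a::field \<Rightarrow> 'v::ab_group_add \<Rightarrow> 'v" and F G :: "3 set \<Rightarrow> 'v set"
  assumes sc: "vector_space sc"
    and F: "is_subspace sc (F S)" and G: "is_subspace sc (G S)" and GF: "G S \<subseteq> F S"
    and F_mono: "S \<subseteq> T \<Longrightarrow> F S \<subseteq> F T" and G_mono: "S \<subseteq> T \<Longrightarrow> G S \<subseteq> G T"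
begin

text \<open>The global sections of \<open>F/G\<close>, before sections of \<open>G\<close> are divided out.\<close>
definition lifts :: "('v ^ 3) set" where
  "lifts = {t \<in> C0 F. \<forall>i j. t $ j - t $ i \<in> G {i, j}}"

lemma vsc: "vector_space (vscale sc)" and vvsc: "vector_space (vscale (vscale sc))"
  by (intro vector_space_vscale sc)+

lemma sc_diff: "sc c (x - y) = sc c x - sc c y" and sc_add: "sc c (x + y) = sc c x + sc c y"
proof -
  interpret vector_space sc by (rule sc)
  show "sc c (x - y) = sc c x - sc c y" by (rule scale_right_diff_distrib)
  show "sc c (x + y) = sc c x + sc c y" by (rule scale_right_distrib)
qed

lemma sub_C0_F: "is_subspace (vscale sc) (C0 F)" and sub_C0_G: "is_subspace (vscale sc) (C0 G)"
  using F G by (auto simp: C0_def is_subspace_def)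

lemma sub_lifts: "is_subspace (vscale sc) lifts"
proof (rule is_subspaceI)
  note C = is_subspaceD[OF sub_C0_F]
  show "0 \<in> lifts" using C is_subspaceD[OF G] by (simp add: lifts_def)
  show "s + t \<in> lifts" if "s \<in> lifts" "t \<in> lifts" for s t
  proof -
    have "(s + t) $ j - (s + t) $ i = (s $ j - s $ i) + (t $ j - t $ i)" for i j
      by (simp add: algebra_simps)
    then show ?thesis using C that is_subspaceD(2)[OF G] by (simp add: lifts_def del: vector_add_component)
  qed
  show "vscale sc c t \<in> lifts" if "t \<in> lifts" for c t
    using C that is_subspaceD(3)[OF G] by (simp add: lifts_def flip: sc_diff)
qed

lemma C0_G_lifts: "C0 G \<subseteq> lifts"
proof
  fix t assume t: "t \<in> C0 G"
  have "t $ i \<in> G {i, j}" "t $ j \<in> G {i, j}" for i j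
    using t G_mono[of "{i}" "{i, j}"] G_mono[of "{j}" "{i, j}"] by (auto simp: C0_def)
  then have "t $ j - t $ i \<in> G {i, j}" for i j by (intro is_subspace_diff[OF sc G])
  then show "t \<in> lifts" using t GF unfolding lifts_def C0_def by blast
qed

lemma const_lifts: "s \<in> glob F \<Longrightarrow> const_vec s \<in> lifts"
  using is_subspaceD(1)[OF G] by (auto simp: lifts_def C0_def glob_def)

lemma const_C0_iff: "const_vec s \<in> C0 H \<longleftrightarrow> s \<in> glob H"
  by (auto simp: C0_def glob_def)

lemma sub_Z1: "is_subspace (vscale (vscale sc)) (Z1 G)"
proof (rule is_subspaceI)
  note G' = is_subspaceD[OF G]
  show "0 \<in> Z1 G" using G' by (simp add: Z1_def)
  show "c + d \<in> Z1 G" if "c \<in> Z1 G" "d \<in> Z1 G" for c d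
  proof -
    have "(c + d) $ i $ l = (c + d) $ i $ j + (c + d) $ j $ l" for i j l
    proof -
      have "c $ i $ l = c $ i $ j + c $ j $ l" "d $ i $ l = d $ i $ j + d $ j $ l"
        using that by (simp_all add: Z1_def)
      then show ?thesis by (simp add: algebra_simps)
    qed
    then show ?thesis using that G'(2) by (simp add: Z1_def)
  qed
  show "vscale (vscale sc) a c \<in> Z1 G" if "c \<in> Z1 G" for a c
  proof -
    have "sc a (c $ i $ l) = sc a (c $ i $ j) + sc a (c $ j $ l)" for i j l
    proof -
      have "c $ i $ l = c $ i $ j + c $ j $ l" using that by (simp add: Z1_def)
      then show ?thesis by (simp only: sc_add)
    qed
    then show ?thesis using that G'(3) by (simp add: Z1_def)
  qed
qed

lemma coboundary_lifts: "t \<in> lifts \<Longrightarrow> coboundary t \<in> Z1 G"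
  by (auto simp: lifts_def Z1_def)

lemma linear_coboundary:
  "linear_map field_ring (vs_of (vscale sc) lifts) (vs_of (vscale (vscale sc)) (Z1 G)) coboundary"
  by (rule linear_mapI[OF vectorspace_vs_of[OF vsc sub_lifts] vectorspace_vs_of[OF vvsc sub_Z1]])
    (simp_all add: coboundary_lifts coboundary_add, simp add: vec_eq_iff sc_diff)

lemma sub_B1: "is_subspace (vscale (vscale sc)) (coboundary ` C0 G)"
proof (rule is_subspaceI)
  note C = is_subspaceD[OF sub_C0_G]
  show "0 \<in> coboundary ` C0 G" using C(1) by (intro image_eqI[of _ _ 0]) (simp_all add: vec_eq_iff)
  show "c + d \<in> coboundary ` C0 G" if "c \<in> coboundary ` C0 G" "d \<in> coboundary ` C0 G" for c d
    using that C(2) by (auto simp flip: coboundary_add)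
  show "vscale (vscale sc) a c \<in> coboundary ` C0 G" if c: "c \<in> coboundary ` C0 G" for a c
  proof -
    obtain t where "t \<in> C0 G" "c = coboundary t" using c by blast
    then show ?thesis
      using C(3) by (intro image_eqI[of _ _ "vscale sc a t"]) (simp_all add: vec_eq_iff sc_diff)
  qed
qed

lemma B1_Z1: "coboundary ` C0 G \<subseteq> Z1 G"
  using C0_G_lifts coboundary_lifts by auto

lemma onto_Z1:
  assumes "Z1 F \<subseteq> coboundary ` C0 F" shows "coboundary ` lifts = Z1 G"
proof
  show "Z1 G \<subseteq> coboundary ` lifts"
  proof
    fix c assume c: "c \<in> Z1 G"
    then have "c \<in> Z1 F" using GF by (auto simp: Z1_def)
    then obtain t where t: "t \<in> C0 F" "c = coboundary t" using assms by auto
    have "t $ j - t $ i \<in> G {i, j}" for i j using c t(2) by (auto simp: Z1_def)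
    then show "c \<in> coboundary ` lifts" using t by (auto simp: lifts_def)
  qed
qed (use coboundary_lifts in auto)

lemma quotient_H1: "quotient_space (vs_of (vscale (vscale sc)) (Z1 G)) (coboundary ` C0 G)"
  by (rule quotient_spaceI[OF vvsc sub_Z1 sub_B1 B1_Z1])

subsection \<open>The connecting map\<close>

context
  \<comment> \<open>\<open>B\<close> stands for \<open>H^0(F/G)\<close> through the class map \<open>p\<close>, and \<open>f\<close> for the map from \<open>H^0(F)\<close>; only its
    image matters.\<close>
  fixes A :: "('a, 'x) module" and B :: "('a, 'y) module" and f :: "'x \<Rightarrow> 'y" and p :: "'v ^ 3 \<Rightarrow> 'y"
  assumes f: "linear_map field_ring A B f"
    and p: "linear_map field_ring (vs_of (vscale sc) lifts) B p"
    and p_onto: "p ` lifts = carrier B"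
    and p_ker: "\<And>t. t \<in> lifts \<Longrightarrow> p t = \<zero>\<^bsub>B\<^esub> \<longleftrightarrow> t \<in> C0 G"
    and f_image: "f ` carrier A = p ` const_vec ` glob F"
begin

text \<open>A class of \<open>B\<close> comes from a global section of \<open>F\<close> if and only if its local lifts
  can be corrected by sections of \<open>G\<close> so as to agree.\<close>
lemma image_iff_coboundary:
  assumes t: "t \<in> lifts"
  shows "p t \<in> f ` carrier A \<longleftrightarrow> coboundary t \<in> coboundary ` C0 G"
proof -
  interpret B: vectorspace field_ring B using p by (simp add: linear_map_def)
  note pD = linear_map_vs_ofD[OF p]
  have eq: "p t = p u \<longleftrightarrow> t - u \<in> C0 G" if u: "u \<in> lifts" for u
  proof -
    have tu: "t - u \<in> lifts" using is_subspace_diff[OF vsc sub_lifts t u] .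
    have "p t = p (t - u) \<oplus>\<^bsub>B\<^esub> p u" using pD(2)[OF tu u] by simp
    moreover have "p u = \<zero>\<^bsub>B\<^esub> \<oplus>\<^bsub>B\<^esub> p u" using pD(1)[OF u] by simp
    ultimately show ?thesis
      using p_ker[OF tu] B.M.add.right_cancel[of "p u" "p (t - u)" "\<zero>\<^bsub>B\<^esub>"] pD(1)[OF u] pD(1)[OF tu]
      by auto
  qed
  have "p t \<in> f ` carrier A \<longleftrightarrow> (\<exists>s\<in>glob F. t - const_vec s \<in> C0 G)"
    unfolding f_image using eq const_lifts by (auto simp: image_iff)
  also have "\<dots> \<longleftrightarrow> coboundary t \<in> coboundary ` C0 G"
  proof
    assume "\<exists>s\<in>glob F. t - const_vec s \<in> C0 G"
    then obtain s where "t - const_vec s \<in> C0 G" by auto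
    then show "coboundary t \<in> coboundary ` C0 G"
      by (rule image_eqI[rotated]) (simp add: coboundary_diff)
  next
    assume "coboundary t \<in> coboundary ` C0 G"
    then obtain u s where u: "u \<in> C0 G" "t = u + const_vec s" by (auto simp: coboundary_eq_iff)
    then have "const_vec s = t - u" by simp
    moreover have "t \<in> C0 F" "u \<in> C0 F" using t u(1) C0_G_lifts by (auto simp: lifts_def)
    then have "t - u \<in> C0 F" by (rule is_subspace_diff[OF vsc sub_C0_F])
    ultimately have "s \<in> glob F" using const_C0_iff by metis
    then show "\<exists>s\<in>glob F. t - const_vec s \<in> C0 G" using u by (intro bexI[of _ s]) simp_all
  qed
  finally show ?thesis .
qed

lemma image_submodule: "submodule field_ring (f ` carrier A) B"
proof -
  interpret f: linear_map field_ring A B f by (rule f)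
  show ?thesis using f.im_is_submodule by (simp add: f.im_def)
qed

lemma surjective_iff_lifts: "f ` carrier A = carrier B \<longleftrightarrow> coboundary ` lifts \<subseteq> coboundary ` C0 G"
proof -
  have "f ` carrier A \<subseteq> carrier B" using submodule.subset[OF image_submodule] .
  moreover have "carrier B \<subseteq> f ` carrier A \<longleftrightarrow> coboundary ` lifts \<subseteq> coboundary ` C0 G"
    unfolding p_onto[symmetric] image_subset_iff using image_iff_coboundary by blast
  ultimately show ?thesis by auto
qed

text \<open>If \<open>H^1(F) = 0\<close>, every cocycle of \<open>G\<close> is the coboundary of a family of local lifts, so the
  isomorphism theorem for the two surjections out of \<open>lifts\<close> applies.\<close>
lemma connecting_iso:
  assumes "Z1 F \<subseteq> coboundary ` C0 F"
  shows "linear_iso (cok A B f) (H1 sc G) (\<lambda>Y. coboundary ` {t \<in> lifts. p t \<in> Y})"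
  unfolding cok_def H1_def
  using linear_iso_quot[OF p _ linear_coboundary _ image_submodule
      subspace_vs_of[OF vvsc sub_Z1 sub_B1 B1_Z1]] p_onto onto_Z1[OF assms] image_iff_coboundary
  by simp

end

subsection \<open>Sections of the quotient sheaf\<close>

lemma quotient_H0: "quotient_space (vs_of (vscale sc) lifts) (C0 G)"
  by (rule quotient_spaceI[OF vsc sub_lifts sub_C0_G C0_G_lifts])

lemma H0_quot_eq: "H0_quot sc F G = quot (vs_of (vscale sc) lifts) (C0 G)"
  by (simp add: H0_quot_def lifts_def)

abbreviation qcl where "qcl t \<equiv> C0 G +>\<^bsub>vs_of (vscale sc) lifts\<^esub> t"

lemma to_quot_eq: "to_quot sc G s = qcl (const_vec s)"
  by (simp add: to_quot_def a_r_coset_def r_coset_def const_vec_def vs_of_def)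

lemma linear_qcl: "linear_map field_ring (vs_of (vscale sc) lifts) (H0_quot sc F G) qcl"
  unfolding H0_quot_eq by (rule quotient_space.linear_cl[OF quotient_H0])

lemma qcl_onto: "qcl ` lifts = carrier (H0_quot sc F G)"
  unfolding H0_quot_eq using quotient_space.carrier_quot[OF quotient_H0] by simp

lemma H0_quot_zero: "\<zero>\<^bsub>H0_quot sc F G\<^esub> = C0 G"
  unfolding H0_quot_eq by (rule quotient_space.quot_ops[OF quotient_H0])

lemma qcl_ker: "t \<in> lifts \<Longrightarrow> qcl t = \<zero>\<^bsub>H0_quot sc F G\<^esub> \<longleftrightarrow> t \<in> C0 G"
  unfolding H0_quot_zero using quotient_space.cl_eq_W_iff[OF quotient_H0] by simp

lemma qcl_eq_iff: "s \<in> lifts \<Longrightarrow> t \<in> lifts \<Longrightarrow> qcl s = qcl t \<longleftrightarrow> s - t \<in> C0 G"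
proof -
  assume st: "s \<in> lifts" "t \<in> lifts"
  interpret V: vectorspace field_ring "vs_of (vscale sc) lifts"
    by (rule vectorspace_vs_of[OF vsc sub_lifts])
  have st': "s - t \<in> lifts" by (rule is_subspace_diff[OF vsc sub_lifts st])
  have "s \<ominus>\<^bsub>vs_of (vscale sc) lifts\<^esub> t = s - t"
  proof -
    have m: "- t \<in> lifts" by (rule is_subspace_neg[OF vsc sub_lifts st(2)])
    then have "\<ominus>\<^bsub>vs_of (vscale sc) lifts\<^esub> t = - t"
      using V.M.minus_equality[of "- t" t] st by simp
    then show ?thesis by (simp add: a_minus_def)
  qed
  then show ?thesis using quotient_space.cl_eq_iff[OF quotient_H0, of s t] st by simp
qed

lemma mem_qcl_iff: "t \<in> lifts \<Longrightarrow> s \<in> qcl t \<longleftrightarrow> s \<in> lifts \<and> s - t \<in> C0 G"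
proof -
  assume t: "t \<in> lifts"
  have "qcl t = {u + t | u. u \<in> C0 G}" by (auto simp: a_r_coset_def r_coset_def)
  then have "s \<in> qcl t \<longleftrightarrow> s - t \<in> C0 G" by (auto simp: algebra_simps)
  moreover have "s \<in> lifts" if "s - t \<in> C0 G"
    using is_subspaceD(2)[OF sub_lifts _ t, of "s - t"] that C0_G_lifts by auto
  ultimately show ?thesis by auto
qed

lemma sub_glob_F: "is_subspace sc (glob F)" and sub_glob_G: "is_subspace sc (glob G)"
  by (rule is_subspace_glob, rule F G)+

lemma linear_to_quot: "linear_map field_ring (H0 sc F) (H0_quot sc F G) (to_quot sc G)"
proof (rule linear_mapI)
  note q = linear_map_vs_ofD[OF linear_qcl]
  show "vectorspace field_ring (H0 sc F)"
    unfolding H0_def by (rule vectorspace_vs_of[OF sc sub_glob_F])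
  show "vectorspace field_ring (H0_quot sc F G)"
    using linear_qcl by (simp add: linear_map_def)
  fix x assume "x \<in> carrier (H0 sc F)"
  then have x: "const_vec x \<in> lifts" by (simp add: H0_def const_lifts)
  show "to_quot sc G x \<in> carrier (H0_quot sc F G)" unfolding to_quot_eq by (rule q(1)[OF x])
  { fix y assume "y \<in> carrier (H0 sc F)"
    then have y: "const_vec y \<in> lifts" by (simp add: H0_def const_lifts)
    have "const_vec (x + y) = const_vec x + const_vec y" by (simp add: vec_eq_iff)
    then show "to_quot sc G (x \<oplus>\<^bsub>H0 sc F\<^esub> y) = to_quot sc G x \<oplus>\<^bsub>H0_quot sc F G\<^esub> to_quot sc G y"
      unfolding to_quot_eq using q(2)[OF x y] by (simp add: H0_def) }
  { fix c :: 'a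
    have "const_vec (sc c x) = vscale sc c (const_vec x)" by (simp add: vec_eq_iff)
    then show "to_quot sc G (c \<odot>\<^bsub>H0 sc F\<^esub> x) = c \<odot>\<^bsub>H0_quot sc F G\<^esub> to_quot sc G x"
      unfolding to_quot_eq using q(3)[OF x] by (simp add: H0_def) }
qed

lemma to_quot_image: "to_quot sc G ` carrier (H0 sc F) = qcl ` const_vec ` glob F"
  by (simp add: to_quot_eq H0_def image_image)

lemmas quot_sequence = linear_to_quot linear_qcl qcl_onto qcl_ker to_quot_image

lemma injective_to_quot: "injective_map (H0 sc F) (to_quot sc G) \<longleftrightarrow> glob G = {0}"
proof
  have 0: "0 \<in> glob G" "0 \<in> glob F" using is_subspaceD(1)[OF sub_glob_G] is_subspaceD(1)[OF sub_glob_F] .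
  have eq: "to_quot sc G x = to_quot sc G y \<longleftrightarrow> x - y \<in> glob G" if "x \<in> glob F" "y \<in> glob F" for x y
  proof -
    have "const_vec x - const_vec y = const_vec (x - y)" by (simp add: vec_eq_iff)
    then show ?thesis unfolding to_quot_eq
      using qcl_eq_iff[OF const_lifts[OF that(1)] const_lifts[OF that(2)]] const_C0_iff by metis
  qed
  { assume inj: "injective_map (H0 sc F) (to_quot sc G)"
    show "glob G = {0}"
    proof -
      have "x = 0" if "x \<in> glob G" for x
      proof -
        have "x \<in> glob F" using that GF by (auto simp: glob_def)
        then show ?thesis
          using inj eq[of x 0] that 0 by (auto simp: injective_map_def H0_def inj_on_def)
      qed
      then show ?thesis using 0 by auto
    qed }
  { assume "glob G = {0}"
    then show "injective_map (H0 sc F) (to_quot sc G)"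
      using eq by (auto simp: injective_map_def H0_def inj_on_def) }
qed

lemma connecting_iso_quot:
  assumes "Z1 F \<subseteq> coboundary ` C0 F"
  shows "linear_iso (cok (H0 sc F) (H0_quot sc F G) (to_quot sc G)) (H1 sc G) (\<lambda>Y. coboundary ` \<Union>Y)"
proof -
  let ?cok = "cok (H0 sc F) (H0_quot sc F G) (to_quot sc G)"
  have iso: "linear_iso ?cok (H1 sc G) (\<lambda>Y. coboundary ` {t \<in> lifts. qcl t \<in> Y})"
    by (rule connecting_iso[OF quot_sequence assms])
  have eq: "coboundary ` {t \<in> lifts. qcl t \<in> Y} = coboundary ` \<Union>Y" if Y: "Y \<in> carrier ?cok" for Y
  proof -
    have "quotient_space (H0_quot sc F G) (to_quot sc G ` carrier (H0 sc F))"
      using image_submodule[OF quot_sequence] linear_qcl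
      by (simp add: quotient_space_def linear_map_def)
    then have Y': "Y \<subseteq> carrier (H0_quot sc F G)"
      using Y quotient_space.carrier_quot quotient_space.mem_cl_carrier unfolding cok_def by fastforce
    have "{t \<in> lifts. qcl t \<in> Y} = \<Union>Y"
    proof (intro Set.set_eqI iffI)
      fix t assume "t \<in> {t \<in> lifts. qcl t \<in> Y}"
      moreover have "t \<in> qcl t" if "t \<in> lifts"
        using mem_qcl_iff[OF that] that is_subspaceD(1)[OF sub_C0_G] by simp
      ultimately show "t \<in> \<Union>Y" by auto
    next
      fix t assume "t \<in> \<Union>Y"
      then obtain y where y: "y \<in> Y" "t \<in> y" by auto
      then have "y \<in> qcl ` lifts" unfolding qcl_onto using Y' by blast
      then obtain u where u: "u \<in> lifts" "y = qcl u" by blast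
      then have "t \<in> lifts" "t - u \<in> C0 G" using mem_qcl_iff[OF u(1)] y(2) by auto
      then have "qcl t = y" using qcl_eq_iff u by simp
      then show "t \<in> {t \<in> lifts. qcl t \<in> Y}" using \<open>t \<in> lifts\<close> y by simp
    qed
    then show ?thesis by simp
  qed
  show ?thesis
    by (rule linear_iso_cong[OF iso]) (rule eq)
qed

end

text \<open>The quotient \<open>F/G\<close> is supported in the intersection of the charts: on each chart its sections
  are the same as on the intersection.\<close>
locale cech_supported = cech_pair +
  assumes G_eq: "S \<noteq> {} \<Longrightarrow> F S \<inter> G UNIV \<subseteq> G S"
    and approx: "x \<in> F UNIV \<Longrightarrow> \<exists>y\<in>F {i}. x - y \<in> G UNIV"
begin

definition local_lifts :: "'b \<Rightarrow> ('b ^ 3) set" where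
  "local_lifts x = {t \<in> C0 F. \<forall>i. t $ i - x \<in> G UNIV}"

lemma F_UNIV: "x \<in> F S \<Longrightarrow> x \<in> F UNIV" and G_UNIV: "x \<in> G S \<Longrightarrow> x \<in> G UNIV"
  using F_mono[of S UNIV] G_mono[of S UNIV] by auto

lemma local_lifts_subset: "local_lifts x \<subseteq> lifts"
proof
  fix t assume t: "t \<in> local_lifts x"
  have "t $ j - t $ i \<in> G {i, j}" for i j
  proof -
    have "t $ i \<in> F {i, j}" "t $ j \<in> F {i, j}"
      using t F_mono[of "{i}" "{i, j}"] F_mono[of "{j}" "{i, j}"] by (auto simp: local_lifts_def C0_def)
    then have 1: "t $ j - t $ i \<in> F {i, j}" by (intro is_subspace_diff[OF sc F])
    have "t $ j - x \<in> G UNIV" "t $ i - x \<in> G UNIV" using t by (auto simp: local_lifts_def)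
    from is_subspace_diff[OF sc G this] have "t $ j - t $ i \<in> G UNIV" by simp
    then show ?thesis using G_eq[of "{i, j}"] 1 by blast
  qed
  then show "t \<in> lifts" using t by (simp add: lifts_def local_lifts_def)
qed

lemma qcl_local_lifts:
  assumes t: "t \<in> local_lifts x" shows "qcl t = local_lifts x"
proof (rule Set.set_eqI)
  fix s
  have tl: "t \<in> lifts" using local_lifts_subset t by blast
  have t': "t $ i - x \<in> G UNIV" "t \<in> C0 F" for i using t by (auto simp: local_lifts_def)
  have "s \<in> qcl t \<longleftrightarrow> s \<in> lifts \<and> s - t \<in> C0 G" by (rule mem_qcl_iff[OF tl])
  also have "\<dots> \<longleftrightarrow> s \<in> local_lifts x"
  proof
    assume s: "s \<in> lifts \<and> s - t \<in> C0 G"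
    have "s $ i - x \<in> G UNIV" for i
    proof -
      have "s $ i - t $ i \<in> G UNIV" using s by (auto simp: C0_def intro: G_UNIV)
      from is_subspaceD(2)[OF G this t'(1)[of i]] show ?thesis by simp
    qed
    then show "s \<in> local_lifts x" using s by (simp add: local_lifts_def lifts_def)
  next
    assume s: "s \<in> local_lifts x"
    have "s $ i - t $ i \<in> G {i}" for i
    proof -
      have "s $ i - x \<in> G UNIV" using s by (simp add: local_lifts_def)
      from is_subspace_diff[OF sc G this t'(1)[of i]] have "s $ i - t $ i \<in> G UNIV" by simp
      moreover have "s $ i - t $ i \<in> F {i}"
        using s t' by (intro is_subspace_diff[OF sc F]) (auto simp: local_lifts_def C0_def)
      ultimately show ?thesis using G_eq[of "{i}"] by blast
    qed
    then show "s \<in> lifts \<and> s - t \<in> C0 G" using s local_lifts_subset by (auto simp: C0_def)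
  qed
  finally show "s \<in> qcl t \<longleftrightarrow> s \<in> local_lifts x" .
qed

lemma local_lifts_ex: assumes "x \<in> F UNIV" obtains t where "t \<in> local_lifts x"
proof -
  have "\<forall>i. \<exists>y. y \<in> F {i} \<and> x - y \<in> G UNIV" using approx[OF assms] by blast
  then obtain y where y: "\<And>i. y i \<in> F {i} \<and> x - y i \<in> G UNIV" by metis
  have "y i - x \<in> G UNIV" for i using is_subspace_neg[OF sc G, of "x - y i"] y by simp
  then have "(\<chi> i. y i) \<in> local_lifts x" using y by (simp add: local_lifts_def C0_def)
  then show thesis by (rule that)
qed

lemma linear_local_lifts: "linear_map field_ring (vs_of sc (F UNIV)) (H0_quot sc F G) local_lifts"
proof (rule linear_mapI[OF vectorspace_vs_of[OF sc F]])
  note q = linear_map_vs_ofD[OF linear_qcl]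
  note L = subsetD[OF local_lifts_subset]
  show "vectorspace field_ring (H0_quot sc F G)" using linear_qcl by (simp add: linear_map_def)
  fix x assume "x \<in> carrier (vs_of sc (F UNIV))"
  then obtain t where t: "t \<in> local_lifts x" using local_lifts_ex by auto
  show "local_lifts x \<in> carrier (H0_quot sc F G)"
    using q(1)[OF L[OF t]] by (simp add: qcl_local_lifts[OF t])
  { fix y assume "y \<in> carrier (vs_of sc (F UNIV))"
    then obtain s where s: "s \<in> local_lifts y" using local_lifts_ex by auto
    have "(t $ i - x) + (s $ i - y) \<in> G UNIV" for i
      using s t by (intro is_subspaceD(2)[OF G]) (auto simp: local_lifts_def)
    then have "t + s \<in> local_lifts (x + y)"
      using s t is_subspaceD(2)[OF sub_C0_F] by (simp add: local_lifts_def algebra_simps)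
    then show "local_lifts (x \<oplus>\<^bsub>vs_of sc (F UNIV)\<^esub> y) = local_lifts x \<oplus>\<^bsub>H0_quot sc F G\<^esub> local_lifts y"
      using q(2)[OF L[OF t] L[OF s]] by (simp add: qcl_local_lifts[OF t] qcl_local_lifts[OF s] qcl_local_lifts) }
  { fix c :: 'a
    have "sc c (t $ i - x) \<in> G UNIV" for i
      using t by (intro is_subspaceD(3)[OF G]) (auto simp: local_lifts_def)
    then have "vscale sc c t \<in> local_lifts (sc c x)"
      using t is_subspaceD(3)[OF sub_C0_F] by (simp add: local_lifts_def sc_diff)
    then show "local_lifts (c \<odot>\<^bsub>vs_of sc (F UNIV)\<^esub> x) = c \<odot>\<^bsub>H0_quot sc F G\<^esub> local_lifts x"
      using q(3)[OF L[OF t], of c] by (simp add: qcl_local_lifts[OF t] qcl_local_lifts) }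
qed

lemma local_lifts_onto: "local_lifts ` F UNIV = carrier (H0_quot sc F G)"
proof
  show "local_lifts ` F UNIV \<subseteq> carrier (H0_quot sc F G)"
    using linear_map_vs_ofD(1)[OF linear_local_lifts] by auto
  show "carrier (H0_quot sc F G) \<subseteq> local_lifts ` F UNIV"
    unfolding qcl_onto[symmetric]
  proof (rule image_subsetI)
    fix t assume t: "t \<in> lifts"
    have "t \<in> local_lifts (t $ 1)"
      using t by (auto simp: local_lifts_def lifts_def intro: G_UNIV)
    moreover have "t $ 1 \<in> F UNIV" using t by (auto simp: lifts_def C0_def intro: F_UNIV)
    ultimately show "qcl t \<in> local_lifts ` F UNIV" using qcl_local_lifts by blast
  qed
qed

lemma local_lifts_ker:
  assumes "x \<in> F UNIV" shows "local_lifts x = \<zero>\<^bsub>H0_quot sc F G\<^esub> \<longleftrightarrow> x \<in> G UNIV"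
proof -
  obtain t where t: "t \<in> local_lifts x" using local_lifts_ex[OF assms] .
  have tl: "t \<in> lifts" using t local_lifts_subset by blast
  have "local_lifts x = \<zero>\<^bsub>H0_quot sc F G\<^esub> \<longleftrightarrow> t \<in> C0 G"
    using qcl_ker[OF tl] qcl_local_lifts[OF t] by simp
  also have "\<dots> \<longleftrightarrow> x \<in> G UNIV"
  proof
    assume "t \<in> C0 G"
    then have "t $ 1 \<in> G UNIV" by (auto simp: C0_def intro: G_UNIV)
    moreover have "t $ 1 - x \<in> G UNIV" using t by (simp add: local_lifts_def)
    ultimately have "t $ 1 - (t $ 1 - x) \<in> G UNIV" by (rule is_subspace_diff[OF sc G])
    then show "x \<in> G UNIV" by simp
  next
    assume x: "x \<in> G UNIV"
    have "t $ i \<in> G {i}" for i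
    proof -
      have "t $ i - x \<in> G UNIV" "t $ i \<in> F {i}" using t by (auto simp: local_lifts_def C0_def)
      then show ?thesis using is_subspaceD(2)[OF G _ x, of "t $ i - x"] G_eq[of "{i}"] by auto
    qed
    then show "t \<in> C0 G" by (simp add: C0_def)
  qed
  finally show ?thesis .
qed

lemma to_quot_local_lifts: assumes "s \<in> glob F" shows "to_quot sc G s = local_lifts s"
proof -
  have "const_vec s \<in> local_lifts s"
    using const_lifts[OF assms] is_subspaceD(1)[OF G] by (simp add: local_lifts_def lifts_def)
  then show ?thesis unfolding to_quot_eq by (rule qcl_local_lifts)
qed

lemma surjective_to_quot_iff:
  "surjective_map (H0 sc F) (H0_quot sc F G) (to_quot sc G) \<longleftrightarrow>
   (\<forall>x\<in>F UNIV. \<exists>s\<in>glob F. x - s \<in> G UNIV)"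
proof -
  have FU: "glob F \<subseteq> F UNIV" by (auto simp: glob_def intro: F_UNIV)
  interpret B: vectorspace field_ring "H0_quot sc F G" using linear_qcl by (simp add: linear_map_def)
  note l = linear_map_vs_ofD[OF linear_local_lifts]
  have eq: "local_lifts x = local_lifts s \<longleftrightarrow> x - s \<in> G UNIV" if "x \<in> F UNIV" "s \<in> F UNIV" for x s
  proof -
    have xs: "x - s \<in> F UNIV" by (rule is_subspace_diff[OF sc F that])
    have "local_lifts x = local_lifts (x - s) \<oplus>\<^bsub>H0_quot sc F G\<^esub> local_lifts s"
      using l(2)[OF xs that(2)] by simp
    moreover have "local_lifts s = \<zero>\<^bsub>H0_quot sc F G\<^esub> \<oplus>\<^bsub>H0_quot sc F G\<^esub> local_lifts s"
      using l(1)[OF that(2)] by simp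
    ultimately show ?thesis
      using local_lifts_ker[OF xs] l(1)[OF xs] l(1)[OF that(2)]
        B.M.add.right_cancel[of "local_lifts s" "local_lifts (x - s)" "\<zero>\<^bsub>H0_quot sc F G\<^esub>"] by auto
  qed
  have "to_quot sc G ` glob F = local_lifts ` glob F"
    by (rule image_cong[OF refl]) (rule to_quot_local_lifts)
  then have "surjective_map (H0 sc F) (H0_quot sc F G) (to_quot sc G) \<longleftrightarrow>
      local_lifts ` glob F = local_lifts ` F UNIV"
    by (simp add: surjective_map_def H0_def local_lifts_onto)
  also have "\<dots> \<longleftrightarrow> local_lifts ` F UNIV \<subseteq> local_lifts ` glob F" using FU by auto
  also have "\<dots> \<longleftrightarrow> (\<forall>x\<in>F UNIV. \<exists>s\<in>glob F. local_lifts x = local_lifts s)"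
    unfolding image_subset_iff by blast
  also have "\<dots> \<longleftrightarrow> (\<forall>x\<in>F UNIV. \<exists>s\<in>glob F. x - s \<in> G UNIV)"
    using eq FU by (meson subsetD)
  finally show ?thesis .
qed

end


section \<open>Cohomology of line bundles\<close>

definition part :: "(int ^ 3 \<Rightarrow> bool) \<Rightarrow> 'a::field laurent \<Rightarrow> 'a laurent" where
  "part Q f = Poly_Mapping.mapp (\<lambda>e v. if Q e then v else 0) f"

lemma lookup_part [simp]:
  "lookup (part Q f) e = (if Q e then lookup f e else 0)"
  by (simp add: part_def lookup_mapp when_def in_keys_iff)

lemma sum_part: "(\<Sum>j\<in>UNIV. part (\<lambda>e. p e = j) f) = f" for p :: "int ^ 3 \<Rightarrow> 3"
  by (rule poly_mapping_eqI) (simp add: lookup_sum)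

text \<open>A cocycle is split one monomial at a time.  If some coordinate \<open>p\<close> of the exponent \<open>e\<close> is
  nonnegative, the \<open>e\<close>-coefficient of the section over \<open>U_i\<close> is that of \<open>c $ p $ i\<close>: it can
  only be nonzero if every coordinate other than \<open>p\<close> and \<open>i\<close>, hence every coordinate other
  than \<open>i\<close>, is nonnegative.  If all coordinates of \<open>e\<close> are negative, no \<open>c $ i $ j\<close> contains \<open>e\<close>.\<close>
lemma line_bundle_H1: "Z1 (shf polys d :: _ \<Rightarrow> 'a::field laurent set) \<subseteq> coboundary ` C0 (shf polys d)"
proof
  fix c :: "'a laurent ^ 3 ^ 3" assume c: "c \<in> Z1 (shf polys d)"
  define p :: "int ^ 3 \<Rightarrow> 3" where "p e = (SOME l. 0 \<le> e $ l)" for e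
  define t :: "'a laurent ^ 3" where "t = (\<chi> i. \<Sum>l\<in>UNIV. part (\<lambda>e. p e = l) (c $ l $ i))"
  have t: "lookup (t $ i) e = lookup (c $ p e $ i) e" for i e
    by (simp add: t_def lookup_sum)
  have "coboundary t = c"
  proof -
    have "t $ j - t $ i = c $ i $ j" for i j
    proof (rule poly_mapping_eqI)
      fix e
      have "c $ p e $ j = c $ p e $ i + c $ i $ j" using c by (simp add: Z1_def)
      then show "lookup (t $ j - t $ i) e = lookup (c $ i $ j) e"
        by (simp add: lookup_minus t lookup_add)
    qed
    then show ?thesis by (simp add: vec_eq_iff)
  qed
  moreover have "t $ i \<in> shf polys d {i}" for i
    unfolding shf_polys_iff homog_iff
  proof (intro conjI ballI allI impI)
    fix e assume "e \<in> keys (t $ i)"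
    then have e: "e \<in> keys (c $ p e $ i)" by (simp add: in_keys_iff t)
    have ce: "c $ p e $ i \<in> shf polys d {p e, i}" using c by (simp add: Z1_def)
    then show "deg e = d" using e by (auto simp: shf_polys_iff homog_iff)
    have out: "0 \<le> e $ j" if "j \<notin> {p e, i}" for j
      using ce e that unfolding shf_polys_iff by blast
    have "\<exists>j. j \<notin> {p e, i}"
    proof (rule ccontr)
      assume "\<not> ?thesis"
      then have "(UNIV :: 3 set) \<subseteq> {p e, i}" by blast
      then have "card (UNIV :: 3 set) \<le> card {p e, i}" by (rule card_mono[rotated]) simp
      also have "\<dots> \<le> 2" by (simp add: card_insert_if)
      finally show False by simp
    qed
    then have "\<exists>j. 0 \<le> e $ j" using out by blast
    then have pe: "0 \<le> e $ p e" unfolding p_def by (rule someI_ex)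
    fix j assume "j \<notin> {i}"
    then show "0 \<le> e $ j" using out[of j] pe by (cases "j = p e") auto
  qed
  ultimately show "c \<in> coboundary ` C0 (shf polys d)" by (auto simp: C0_def)
qed

definition triples :: "(3 set \<Rightarrow> 'v set) \<Rightarrow> 3 set \<Rightarrow> ('v ^ 3) set" where
  "triples F S = {w. \<forall>j. w $ j \<in> F S}"

lemma triples_H1:
  assumes "Z1 F \<subseteq> coboundary ` C0 F" shows "Z1 (triples F) \<subseteq> coboundary ` C0 (triples F)"
proof
  fix c assume c: "c \<in> Z1 (triples F)"
  have "\<exists>t. t \<in> C0 F \<and> coboundary t = (\<chi> i j. c $ i $ j $ l)" for l
  proof -
    have "(\<chi> i j. c $ i $ j $ l) \<in> Z1 F"
      using c by (auto simp: Z1_def triples_def vec_eq_iff)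
    then have "(\<chi> i j. c $ i $ j $ l) \<in> coboundary ` C0 F" by (rule subsetD[OF assms])
    then obtain t where "(\<chi> i j. c $ i $ j $ l) = coboundary t" "t \<in> C0 F" by (rule imageE)
    then show ?thesis by (intro exI[of _ t]) simp_all
  qed
  then obtain t where t: "\<And>l. t l \<in> C0 F" "\<And>l. coboundary (t l) = (\<chi> i j. c $ i $ j $ l)" by metis
  have "t l $ j - t l $ i = c $ i $ j $ l" for l i j
    using arg_cong[OF t(2)[of l], of "\<lambda>x. x $ i $ j"] by simp
  then have "coboundary (\<chi> i l. t l $ i) = c" by (simp add: vec_eq_iff)
  moreover have "(\<chi> i l. t l $ i) \<in> C0 (triples F)" using t(1) by (simp add: C0_def triples_def)
  ultimately show "c \<in> coboundary ` C0 (triples F)" by blast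
qed

lemma glob_triples: "glob (triples F) = {w. \<forall>j. w $ j \<in> glob F}"
  by (auto simp: glob_def triples_def)

lemma is_subspace_triples: "is_subspace sc (F S) \<Longrightarrow> is_subspace (vscale sc) (triples F S)"
  by (auto simp: triples_def is_subspace_def)

section \<open>The cotangent bundle\<close>

text \<open>The second map of the Euler sequence.\<close>
definition euler_sum :: "'a::field laurent ^ 3 \<Rightarrow> 'a laurent" where
  "euler_sum w = (\<Sum>j\<in>UNIV. X j * w $ j)"

lemma euler_sum_add: "euler_sum (v + w) = euler_sum v + euler_sum w"
  and euler_sum_diff: "euler_sum (v - w) = euler_sum v - euler_sum w"
  and euler_sum_scale: "euler_sum (fscale c w) = lscale c (euler_sum w)"
  and euler_sum_0 [simp]: "euler_sum 0 = 0"
proof -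
  show "euler_sum (fscale c w) = lscale c (euler_sum w)"
    by (rule poly_mapping_eqI) (simp add: euler_sum_def lookup_sum lscale_times_right sum_distrib_left)
qed (simp_all add: euler_sum_def algebra_simps sum.distrib sum_subtractf)

lemma euler_sum_shf:
  assumes "poly_ideal I" "\<And>j. w $ j \<in> shf I d S" shows "euler_sum w \<in> shf I (d + 1) S"
  unfolding euler_sum_def
  by (rule is_subspace_sum[OF is_subspace_shf[OF assms(1)]]) (intro X_times_shf assms)

lemma lookup_differential:
  "lookup (differential g $ j) e =
   of_int (e $ j + 1) * lookup g (e + axis j 1)"
proof -
  have "lookup (differential g $ j) e =
    (\<Sum>e'\<in>keys g. if e' = e + axis j 1 then of_int (e' $ j) * lookup g e' else 0)"
    unfolding differential_def vec_lambda_beta lookup_sum lookup_single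
    by (rule sum.cong) (auto simp: when_def)
  also have "\<dots> = of_int (e $ j + 1) * lookup g (e + axis j 1)"
    by (subst sum.delta) (simp_all add: in_keys_iff)
  finally show ?thesis .
qed

lemma differential_shf:
  assumes "g \<in> shf polys d S" shows "differential g $ j \<in> shf polys (d - 1) S"
  unfolding shf_polys_iff homog_iff
proof (intro conjI ballI allI impI)
  fix e assume "e \<in> keys (differential g $ j)"
  then have e: "e + axis j 1 \<in> keys g" "e $ j + 1 \<noteq> 0"
    by (auto simp: in_keys_iff lookup_differential simp del: of_int_add)
  then show "deg e = d - 1" using assms by (auto simp: shf_polys_iff homog_iff deg_add)
  fix l assume "l \<notin> S"
  then have "0 \<le> (e + axis j 1) $ l" using assms e(1) unfolding shf_polys_iff by blast
  then show "0 \<le> e $ l" using e(2) by (cases "l = j") (auto simp: axis_nth_if)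
qed

text \<open>Euler's formula; in degree \<open>0\<close> both sides vanish.\<close>
lemma euler_sum_differential:
  assumes "g \<in> homog d" shows "euler_sum (differential g) = lscale (of_int d) g"
proof (rule poly_mapping_eqI)
  fix e
  have "lookup (euler_sum (differential g)) e
      = (\<Sum>j\<in>UNIV. of_int (e $ j) * lookup g e)"
    by (simp add: euler_sum_def lookup_sum X_lmon lookup_differential axis_nth_if)
  also have "\<dots> = of_int (deg e) * lookup g e"
    by (simp add: deg_def sum_distrib_right)
  also have "\<dots> = of_int d * lookup g e"
    using assms by (cases "e \<in> keys g") (auto simp: homog_iff in_keys_iff)
  finally show "lookup (euler_sum (differential g)) e =
    lookup (lscale (of_int d) g) e" by simp
qed

lemma is_subspace_Omega: "is_subspace fscale (Omega I d S)"
  unfolding Omega_def by (rule is_subspace_lin_span[OF vector_space_fscale])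

lemma Omega_mono:
  assumes "shf I d S \<subseteq> shf J d T" "S \<subseteq> T" shows "Omega I d S \<subseteq> Omega J d T"
  unfolding Omega_def
  by (rule lin_span_least[OF vector_space_fscale is_subspace_lin_span[OF vector_space_fscale]],
      rule order_trans[OF _ lin_span_superset[OF vector_space_fscale]])
    (use assms(1) shf_mono[OF poly_ideal_polys assms(2)] in blast)

lemma is_subspace_euler_kernel:
  assumes "poly_ideal I"
  shows "is_subspace fscale {w \<in> triples (shf I d) S. euler_sum w = 0}"
proof -
  interpret vector_space lscale by (rule vector_space_lscale)
  have "is_subspace fscale (triples (shf I d) S)"
    by (rule is_subspace_triples) (rule is_subspace_shf[OF assms])
  then show ?thesis
    by (auto simp: is_subspace_def euler_sum_add euler_sum_scale)
qed

lemma Omega_subset: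
  fixes I :: "'a::field laurent set"
  assumes I: "poly_ideal I"
  shows "Omega I (d + 1) S \<subseteq> {w \<in> triples (shf I d) S. euler_sum w = 0}"
  unfolding Omega_def
proof (rule lin_span_least[OF vector_space_fscale is_subspace_euler_kernel[OF I]], clarsimp)
  fix f g :: "'a laurent" assume f: "f \<in> shf I (d + 1) S" and g: "g \<in> shf polys 0 S"
  have "(f *s differential g) $ j \<in> shf I d S" for j
    using shf_mult[OF I differential_shf[OF g] f, of j] by (simp add: mult.commute)
  moreover have "euler_sum (f *s differential g) = f * euler_sum (differential g)"
    by (simp add: euler_sum_def sum_distrib_left mult_ac)
  moreover have "euler_sum (differential g) = 0"
    using euler_sum_differential[of g 0] g by (simp add: shf_iff poly_mapping_eq_iff fun_eq_iff)
  ultimately show "f *s differential g \<in> triples (shf I d) S \<and> euler_sum (f *s differential g) = 0"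
    by (simp add: triples_def)
qed

lemma lookup_lmon: "lookup (lmon a) e = (if e = a then 1 else 0)"
  by (simp add: lmon_def lookup_single when_def)

lemma differential_lmon: "differential (lmon a) $ l = lscale (of_int (a $ l)) (lmon (a - axis l 1))"
  by (rule poly_mapping_eqI) (auto simp: lookup_differential lookup_lmon axis_nth_if algebra_simps)

text \<open>The Euler sequence: where \<open>x_i\<close> is invertible, the kernel of \<open>(w_j) \<mapsto> \<Sum> x_j w_j\<close> is generated
  by the \<open>d(x_j/x_i)\<close>, because a vector \<open>w\<close> of the kernel is \<open>\<Sum> x_i w_j d(x_j/x_i)\<close>.\<close>
lemma Omega_eq:
  fixes I :: "'a::field laurent set"
  assumes I: "poly_ideal I" and "S \<noteq> {}"
  shows "Omega I (d + 1) S = {w \<in> triples (shf I d) S. euler_sum w = 0}"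
proof
  show "{w \<in> triples (shf I d) S. euler_sum w = 0} \<subseteq> Omega I (d + 1) S"
  proof clarify
    fix w assume w: "w \<in> triples (shf I d) S" and 0: "euler_sum w = 0"
    obtain i where i: "i \<in> S" using assms(2) by auto
    define g where "g j = (lmon (axis j 1 - axis i 1) :: 'a laurent)" for j
    have "(\<Sum>j\<in>UNIV. (X i * w $ j) *s differential (g j)) $ l = w $ l" for l
    proof -
      have summand: "((X i * w $ j) *s differential (g j)) $ l =
          (if j = l then w $ l else 0) - (if l = i then lmon (- axis i 1) * (X j * w $ j) else 0)" for j
      proof -
        have "((X i * w $ j) *s differential (g j)) $ l =
          lscale (of_int ((axis j 1 - axis i 1) $ l)) (lmon (axis j 1 - axis l 1) * w $ j)"
        proof -
          have "X i * lmon (axis j 1 - axis i 1 - axis l 1) = (lmon (axis j 1 - axis l 1) :: 'a laurent)"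
            by (simp add: X_lmon algebra_simps flip: lmon_add)
          moreover have "(X i * w $ j) * lmon (axis j 1 - axis i 1 - axis l 1) =
              (X i * lmon (axis j 1 - axis i 1 - axis l 1)) * w $ j"
            by (simp only: mult_ac)
          ultimately have "(X i * w $ j) * lmon (axis j 1 - axis i 1 - axis l 1) =
              lmon (axis j 1 - axis l 1) * w $ j" by (simp only:)
          then show ?thesis
            unfolding g_def vector_smult_component differential_lmon lscale_times_right by (simp only:)
        qed
        moreover have "lmon (axis j 1 - axis i 1) * w $ j = lmon (- axis i 1) * (X j * w $ j)"
          by (simp add: X_lmon flip: mult.assoc lmon_add)
        moreover have "lscale 1 f = f" "lscale 0 f = 0" "lscale (-1) f = - f" for f :: "'a laurent"
          by (simp_all add: poly_mapping_eq_iff fun_eq_iff)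
        ultimately show ?thesis by (auto simp: axis_nth_if)
      qed
      have "(\<Sum>j\<in>UNIV. (X i * w $ j) *s differential (g j)) $ l =
         w $ l - (if l = i then lmon (- axis i 1) * euler_sum w else 0)"
        unfolding sum_component summand sum_subtractf
        by (simp add: euler_sum_def sum_distrib_left)
      then show ?thesis using 0 by simp
    qed
    then have "w = (\<Sum>j\<in>UNIV. (X i * w $ j) *s differential (g j))" by (simp add: vec_eq_iff)
    also have "\<dots> \<in> Omega I (d + 1) S"
    proof (rule is_subspace_sum[OF is_subspace_Omega])
      fix j
      have "X i * w $ j \<in> shf I (d + 1) S" using w by (intro X_times_shf[OF I]) (simp add: triples_def)
      moreover have "g j \<in> shf polys 0 S"
        unfolding g_def by (rule lmon_shf) (use i in \<open>auto simp: axis_nth_if deg_diff\<close>)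
      ultimately show "(X i * w $ j) *s differential (g j) \<in> Omega I (d + 1) S"
        unfolding Omega_def by (intro subsetD[OF lin_span_superset[OF vector_space_fscale]]) blast
    qed
    finally show "w \<in> Omega I (d + 1) S" .
  qed
qed (rule Omega_subset[OF I])

lemma glob_Omega:
  "poly_ideal I \<Longrightarrow> glob (Omega I (d + 1)) = {w. (\<forall>j. w $ j \<in> glob (shf I d)) \<and> euler_sum w = 0}"
  by (auto simp: glob_def Omega_eq triples_def)

text \<open>Divide each monomial by a coordinate \<open>x_q\<close> that occurs in it.\<close>
lemma euler_sum_forms:
  assumes "1 \<le> d" and s: "s \<in> polys \<inter> homog d"
  shows "\<exists>w. (\<forall>j. w $ j \<in> polys \<inter> homog (d - 1)) \<and> euler_sum w = s"
proof -
  define q :: "int ^ 3 \<Rightarrow> 3" where "q e = (SOME j. 0 < e $ j)" for e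
  have q: "0 < e $ q e" if "e \<in> keys s" for e
  proof -
    have "deg e = d" using s that by (auto simp: homog_iff)
    then have "0 < e $ 1 \<or> 0 < e $ 2 \<or> 0 < e $ 3" using assms(1) by (auto simp: deg_3)
    then have "\<exists>j. 0 < e $ j" by blast
    then show ?thesis unfolding q_def by (rule someI_ex)
  qed
  define w where "w = (\<chi> j. lmon (- axis j 1) * part (\<lambda>e. q e = j) s)"
  have "deg e = d - 1 \<and> 0 \<le> e $ l" if "e \<in> keys (w $ j)" for e j l
  proof
    have e: "e + axis j 1 \<in> keys s" "q (e + axis j 1) = j"
      using that by (auto simp: w_def in_keys_iff split: if_splits)
    then show "deg e = d - 1" using s by (auto simp: homog_iff deg_add)
    have "0 \<le> (e + axis j 1) $ l" using s e(1) by (auto simp: polys_def)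
    then show "0 \<le> e $ l" using q[OF e(1)] e(2) by (cases "l = j") (auto simp: axis_nth_if)
  qed
  then have "w $ j \<in> polys \<inter> homog (d - 1)" for j by (auto simp: polys_def homog_iff)
  moreover have "euler_sum w = s"
    by (simp add: euler_sum_def w_def X_lmon sum_part)
  ultimately show ?thesis by blast
qed

text \<open>By the Euler sequence, a cocycle of \<open>\<Omega>(d+1)\<close> splits in three copies of \<open>O(d)\<close>; the obstruction to
  a splitting in \<open>\<Omega>(d+1)\<close> is a form of degree \<open>d + 1\<close>, which is removed by a global triple.\<close>
lemma Omega_H1:
  assumes "0 \<le> d"
  shows "Z1 (Omega polys (d + 1) :: _ \<Rightarrow> ('a::field laurent ^ 3) set) \<subseteq> coboundary ` C0 (Omega polys (d + 1))"
proof
  let ?O = "Omega polys (d + 1) :: _ \<Rightarrow> ('a laurent ^ 3) set"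
  fix c assume c: "c \<in> Z1 ?O"
  then have "c \<in> Z1 (triples (shf polys d))"
    using Omega_subset[OF poly_ideal_polys, of d] by (fastforce simp: Z1_def)
  then obtain t where t: "t \<in> C0 (triples (shf polys d))" "c = coboundary t"
    using triples_H1[OF line_bundle_H1] by auto
  have "euler_sum (t $ j) = euler_sum (t $ i)" for i j
  proof -
    have "t $ j - t $ i \<in> ?O {i, j}" using c t(2) by (auto simp: Z1_def)
    then have "euler_sum (t $ j - t $ i) = 0" using Omega_subset[OF poly_ideal_polys] by blast
    then show ?thesis by (simp add: euler_sum_diff)
  qed
  then obtain s where s: "\<And>i. euler_sum (t $ i) = s" by blast
  have "s \<in> shf polys (d + 1) {i}" for i
    using euler_sum_shf[OF poly_ideal_polys, of "t $ i" d "{i}"] t(1) s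
    by (simp add: C0_def triples_def)
  then have "s \<in> polys \<inter> homog (d + 1)" by (auto simp: glob_def simp flip: glob_shf_polys)
  then obtain w where w: "\<And>j. w $ j \<in> polys \<inter> homog d" "euler_sum w = s"
    using euler_sum_forms[of "d + 1" s] assms by auto
  have w': "w $ j \<in> shf polys d {i}" for i j using w(1) by (auto simp: glob_def simp flip: glob_shf_polys)
  define u where "u = t - const_vec w"
  have "u $ i \<in> ?O {i}" for i
  proof -
    have "u $ i $ j \<in> shf polys d {i}" for j
    proof -
      have "t $ i $ j \<in> shf polys d {i}" using t(1) by (simp add: C0_def triples_def)
      from is_subspace_diff[OF vector_space_lscale is_subspace_shf[OF poly_ideal_polys] this w']
      show ?thesis by (simp add: u_def)
    qed
    moreover have "euler_sum (u $ i) = 0" by (simp add: u_def euler_sum_diff s w(2))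
    ultimately show ?thesis by (simp add: Omega_eq[OF poly_ideal_polys] triples_def)
  qed
  then have "u \<in> C0 ?O" by (simp add: C0_def)
  moreover have "coboundary u = c" using t(2) by (simp add: u_def coboundary_diff)
  ultimately show "c \<in> coboundary ` C0 ?O" by blast
qed

section \<open>Tensor products with linear forms\<close>

lemma lookup_tens [simp]:
  "lookup (tens f g) (a, b) = lookup f a * lookup g b"
proof -
  have "lookup (tens f g) (a, b) =
    (\<Sum>a'\<in>keys f. \<Sum>b'\<in>keys g.
      if a' = a then if b' = b then lookup f a' * lookup g b' else 0 else 0)"
    unfolding tens_def by (auto simp: lookup_sum lookup_single when_def intro!: sum.cong)
  also have "\<dots> = (\<Sum>a'\<in>keys f. if a' = a then
      (\<Sum>b'\<in>keys g. if b' = b then lookup f a' * lookup g b' else 0) else 0)"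
    by (intro sum.cong) auto
  also have "\<dots> = lookup f a * lookup g b"
    by (simp add: in_keys_iff)
  finally show ?thesis .
qed

lemma lookup_X: "lookup (X j) b = (if b = axis j 1 then 1 else 0)"
  by (simp add: X_lmon lookup_lmon)

lemma lookup_euler:
  "lookup (euler w) (a, b) = (\<Sum>j\<in>UNIV. if b = axis j 1 then lookup (w $ j) a else 0)"
  unfolding euler_def lookup_sum by (intro sum.cong) (auto simp: lookup_X)

lemma axis_one_eq_iff [simp]: "axis i (1::int) = axis j 1 \<longleftrightarrow> i = j"
  by (auto simp: axis_eq_axis)

lemma lookup_euler_axis: "lookup (euler w) (a, axis j 1) = lookup (w $ j) a"
  by (simp add: lookup_euler)

lemma lookup_euler': "lookup (euler w) k =
    (\<Sum>j\<in>UNIV. if snd k = axis j 1 then lookup (w $ j) (fst k) else 0)"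
  using lookup_euler[of w "fst k" "snd k"] by simp

lemma euler_inject: "euler v = euler w \<longleftrightarrow> v = w"
  by (metis lookup_euler_axis poly_mapping_eqI vec_eq_iff)

lemma euler_add: "euler (v + w) = euler v + euler w"
  and euler_diff: "euler (v - w) = euler v - euler w"
  and euler_scale: "euler (fscale c w) = lscale c (euler w)"
  by (rule poly_mapping_eqI, simp only: lookup_add lookup_minus lookup_euler' lookup_lscale
      sum_distrib_left sum.distrib[symmetric] sum_subtractf[symmetric],
      auto simp: lookup_add lookup_minus intro!: sum.cong)+

lemma euler_0: "euler 0 = 0"
  by (rule poly_mapping_eqI) (auto simp: lookup_euler' intro!: sum.neutral)

lemma linear_form_expand:
  assumes "g \<in> linear_forms"
  shows "lookup g b = (\<Sum>j\<in>UNIV. if b = axis j 1 then lookup g (axis j 1) else 0)"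
proof (cases "\<exists>j. b = axis j 1")
  case True then show ?thesis by auto
next
  case False
  have "b \<notin> keys g"
  proof
    assume "b \<in> keys g"
    then have b: "\<forall>j. 0 \<le> b $ j" "deg b = 1"
      using assms unfolding glob_shf_polys by (auto simp: polys_def homog_iff)
    then have "b = axis 1 1 \<or> b = axis 2 1 \<or> b = axis 3 1"
      by (auto simp: vec_eq_iff forall_3 axis_nth_if deg_3)
    then show False using False by blast
  qed
  then show ?thesis using False by (simp add: in_keys_iff)
qed

text \<open>As \<open>x_0, x_1, x_2\<close> is a basis of the linear forms, an element of \<open>V \<otimes> H^0(O(1))\<close> is a triple of
  elements of \<open>V\<close>.\<close>
lemma tensor_linear_forms:
  fixes V :: "'a::field laurent set"
  assumes V: "is_subspace lscale V"
  shows "tensor V linear_forms = euler ` {w. \<forall>j. w $ j \<in> V}"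
proof
  note V' = is_subspaceD[OF V]
  have "is_subspace lscale (euler ` {w. \<forall>j. w $ j \<in> V})"
  proof (rule is_subspaceI)
    show "0 \<in> euler ` {w. \<forall>j. w $ j \<in> V}" by (rule image_eqI[of _ _ 0]) (simp_all add: euler_0 V')
    show "x + y \<in> euler ` {w. \<forall>j. w $ j \<in> V}"
      if "x \<in> euler ` {w. \<forall>j. w $ j \<in> V}" "y \<in> euler ` {w. \<forall>j. w $ j \<in> V}" for x y
      using that V'(2) by (auto simp flip: euler_add)
    show "lscale c x \<in> euler ` {w. \<forall>j. w $ j \<in> V}" if "x \<in> euler ` {w. \<forall>j. w $ j \<in> V}" for c x
      using that V'(3) by (auto simp flip: euler_scale)
  qed
  moreover have "{tens f g |f g. f \<in> V \<and> g \<in> linear_forms} \<subseteq> euler ` {w. \<forall>j. w $ j \<in> V}"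
  proof clarify
    fix f g :: "'a laurent" assume f: "f \<in> V" and g: "g \<in> linear_forms"
    have "tens f g = euler (\<chi> j. lscale (lookup g (axis j 1)) f)"
    proof (rule poly_mapping_eqI, clarify)
      fix a b
      have "lookup (tens f g) (a, b) = lookup f a *
         (\<Sum>j\<in>UNIV. if b = axis j 1 then lookup g (axis j 1) else 0)"
        using linear_form_expand[OF g, of b] by simp
      then show "lookup (tens f g) (a, b) =
        lookup (euler (\<chi> j. lscale (lookup g (axis j 1)) f)) (a, b)"
        by (auto simp: lookup_euler sum_distrib_left intro!: sum.cong)
    qed
    then show "tens f g \<in> euler ` {w. \<forall>j. w $ j \<in> V}"
      by (rule image_eqI) (simp add: V'(3)[OF f])
  qed
  ultimately show "tensor V linear_forms \<subseteq> euler ` {w. \<forall>j. w $ j \<in> V}"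
    unfolding tensor_def by (rule lin_span_least[OF vector_space_lscale])
  show "euler ` {w. \<forall>j. w $ j \<in> V} \<subseteq> tensor V linear_forms"
  proof clarify
    fix w :: "'a laurent ^ 3" assume w: "\<forall>j. w $ j \<in> V"
    have X: "X j \<in> linear_forms" for j :: 3
      unfolding glob_shf_polys by (simp add: X_lmon lmon_polys axis_nth_if) (metis deg_axis lmon_homog)
    show "euler w \<in> tensor V linear_forms"
      unfolding euler_def tensor_def
    proof (rule is_subspace_sum[OF is_subspace_lin_span[OF vector_space_lscale]])
      fix j
      show "tens (w $ j) (X j) \<in> lin_span lscale {tens f g |f g. f \<in> V \<and> g \<in> linear_forms}"
        using w X by (intro subsetD[OF lin_span_superset[OF vector_space_lscale]]) blast
    qed
  qed
qed

lemma mult_map_superset: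
  assumes "finite A" "keys t \<subseteq> A"
  shows "mult_map t = (\<Sum>(a, b)\<in>A. single (a + b) (lookup t (a, b)))"
  unfolding mult_map_def using assms
  by (intro sum.mono_neutral_left) (auto simp: in_keys_iff)

lemma mult_map_add: "mult_map (s + t) = mult_map s + mult_map t"
proof -
  let ?A = "keys s \<union> keys t"
  have "mult_map (s + t) = (\<Sum>(a, b)\<in>?A. single (a + b) (lookup (s + t) (a, b)))"
    using keys_add[of s t] by (intro mult_map_superset) auto
  also have "\<dots> = (\<Sum>(a, b)\<in>?A. single (a + b) (lookup s (a, b))) +
     (\<Sum>(a, b)\<in>?A. single (a + b) (lookup t (a, b)))"
    by (simp add: lookup_add single_add split_def flip: sum.distrib)
  also have "\<dots> = mult_map s + mult_map t"
    using mult_map_superset[of ?A s] mult_map_superset[of ?A t] by simp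
  finally show ?thesis .
qed

lemma mult_map_sum: "mult_map (\<Sum>i\<in>I. t i) = (\<Sum>i\<in>I. mult_map (t i))"
proof -
  have "mult_map 0 = 0" by (simp add: mult_map_def)
  then show ?thesis by (induction I rule: infinite_finite_induct) (simp_all add: mult_map_add)
qed

lemma sum_single: "f = (\<Sum>e\<in>keys f. single e (lookup f e))"
  by (rule poly_mapping_eqI) (simp add: lookup_sum lookup_single when_def in_keys_iff)

lemma mult_map_tens: "mult_map (tens f g) = f * g"
proof -
  have "mult_map (tens f g) = (\<Sum>(a, b)\<in>keys f \<times> keys g.
      single (a + b) (lookup (tens f g) (a, b)))"
    by (rule mult_map_superset) (auto simp: in_keys_iff)
  also have "\<dots> = (\<Sum>a\<in>keys f. single a (lookup f a)) *
     (\<Sum>b\<in>keys g. single b (lookup g b))"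
    by (simp add: sum_product mult_single sum.cartesian_product)
  finally show ?thesis by (simp flip: sum_single)
qed

lemma mult_map_euler: "mult_map (euler w) = euler_sum w"
  by (simp add: euler_def euler_sum_def mult_map_sum mult_map_tens mult.commute)


lemma prod_3: "prod f (UNIV :: 3 set) = f 1 * (f 2 * f 3)"
  unfolding UNIV_3 by simp

section \<open>Substitution into polynomials\<close>

text \<open>Linear extension of a multiplicative function on exponents.  It need only be multiplicative on the
  exponents that occur, such as the nonnegative ones.\<close>
locale monoid_evaluation =
  fixes s :: "'a::field \<Rightarrow> 'b::comm_ring_1" and \<phi> :: "'k::cancel_comm_monoid_add \<Rightarrow> 'b" and E :: "'k set"
  assumes s_add: "s (x + y) = s x + s y" and s_mult: "s (x * y) = s x * s y" and s_one: "s 1 = 1"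
    and \<phi>_zero: "\<phi> 0 = 1" and \<phi>_add: "a \<in> E \<Longrightarrow> b \<in> E \<Longrightarrow> \<phi> (a + b) = \<phi> a * \<phi> b"
begin

lemma s_zero: "s 0 = 0"
  using s_add[of 0 0] by simp

definition evaluate :: "('k \<Rightarrow>\<^sub>0 'a) \<Rightarrow> 'b" where
  "evaluate f = (\<Sum>e\<in>keys f. s (lookup f e) * \<phi> e)"

lemma evaluate_superset:
  "finite A \<Longrightarrow> keys f \<subseteq> A \<Longrightarrow> evaluate f = (\<Sum>e\<in>A. s (lookup f e) * \<phi> e)"
  unfolding evaluate_def by (intro sum.mono_neutral_left) (auto simp: in_keys_iff s_zero)

lemma evaluate_add: "evaluate (f + g) = evaluate f + evaluate g"
proof -
  let ?A = "keys f \<union> keys g"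
  have "evaluate (f + g) = (\<Sum>e\<in>?A. s (lookup (f + g) e) * \<phi> e)"
    using keys_add[of f g] by (intro evaluate_superset) auto
  also have "\<dots> = evaluate f + evaluate g"
    using evaluate_superset[of ?A f] evaluate_superset[of ?A g]
    by (simp add: lookup_add s_add distrib_right sum.distrib)
  finally show ?thesis .
qed

lemma evaluate_single: "evaluate (single e c) = s c * \<phi> e"
  by (simp add: evaluate_def s_zero)

lemma evaluate_sum: "evaluate (\<Sum>i\<in>I. f i) = (\<Sum>i\<in>I. evaluate (f i))"
  by (induction I rule: infinite_finite_induct) (simp_all add: evaluate_add, simp_all add: evaluate_def)

lemma evaluate_mult:
  assumes "keys f \<subseteq> E" "keys g \<subseteq> E" shows "evaluate (f * g) = evaluate f * evaluate g"
proof -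
  let ?s = "\<lambda>f e. single e (lookup f e)"
  have "f * g = (\<Sum>a\<in>keys f. \<Sum>b\<in>keys g. ?s f a * ?s g b)"
    unfolding sum_product[symmetric] sum_single[symmetric] ..
  then have "evaluate (f * g) = (\<Sum>a\<in>keys f. \<Sum>b\<in>keys g. evaluate (?s f a * ?s g b))"
    by (simp only: evaluate_sum)
  also have "\<dots> = (\<Sum>a\<in>keys f. \<Sum>b\<in>keys g. (s (lookup f a) * \<phi> a) * (s (lookup g b) * \<phi> b))"
  proof (intro sum.cong refl)
    fix a b assume "a \<in> keys f" "b \<in> keys g"
    then have "\<phi> (a + b) = \<phi> a * \<phi> b" using assms by (intro \<phi>_add) auto
    then show "evaluate (?s f a * ?s g b) = (s (lookup f a) * \<phi> a) * (s (lookup g b) * \<phi> b)"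
      by (simp add: mult_single evaluate_single s_mult mult_ac)
  qed
  also have "\<dots> = evaluate f * evaluate g" by (simp add: evaluate_def sum_product)
  finally show ?thesis .
qed

lemma evaluate_one: "evaluate 1 = 1"
  unfolding single_one[symmetric] evaluate_single by (simp add: s_one \<phi>_zero)

lemma evaluate_lscale: "evaluate (lscale c f) = s c * evaluate f"
proof -
  have "evaluate (lscale c f) = (\<Sum>e\<in>keys f. s (c * lookup f e) * \<phi> e)"
    using evaluate_superset[OF finite_keys keys_lscale] by simp
  then show ?thesis by (simp add: evaluate_def s_mult sum_distrib_left mult_ac)
qed

end

text \<open>Values of polynomials at a point (\<open>s\<close> the identity) and linear substitutions (\<open>s\<close> the inclusion of the
  constants).\<close>
locale coefficient_hom =
  fixes s :: "'a::field \<Rightarrow> 'b::comm_ring_1"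
  assumes s_add: "s (x + y) = s x + s y" and s_mult: "s (x * y) = s x * s y" and s_one: "s 1 = 1"
begin

definition power_prod :: "(3 \<Rightarrow> 'b) \<Rightarrow> int ^ 3 \<Rightarrow> 'b" where
  "power_prod q e = (\<Prod>j\<in>UNIV. q j ^ nat (e $ j))"

definition peval :: "(3 \<Rightarrow> 'b) \<Rightarrow> 'a laurent \<Rightarrow> 'b" where
  "peval q f = (\<Sum>e\<in>keys f. s (lookup f e) * power_prod q e)"

lemma monoid_evaluation: "monoid_evaluation s (power_prod q) {e. \<forall>j. 0 \<le> e $ j}"
  by unfold_locales (auto simp: s_add s_mult s_one power_prod_def nat_add_distrib power_add prod.distrib)

lemma peval_eq: "peval q f = monoid_evaluation.evaluate s (power_prod q) f"
  by (simp add: peval_def monoid_evaluation.evaluate_def[OF monoid_evaluation])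

lemma peval_add: "peval q (f + g) = peval q f + peval q g"
  and peval_sum: "peval q (\<Sum>i\<in>I. h i) = (\<Sum>i\<in>I. peval q (h i))"
  and peval_one: "peval q 1 = 1"
  and peval_lscale: "peval q (lscale c f) = s c * peval q f"
  unfolding peval_eq using monoid_evaluation
  by (rule monoid_evaluation.evaluate_add monoid_evaluation.evaluate_sum
      monoid_evaluation.evaluate_one monoid_evaluation.evaluate_lscale)+

lemma peval_mult: "f \<in> polys \<Longrightarrow> g \<in> polys \<Longrightarrow> peval q (f * g) = peval q f * peval q g"
  unfolding peval_eq by (rule monoid_evaluation.evaluate_mult[OF monoid_evaluation]) (auto simp: polys_def)

lemma peval_0: "peval q 0 = 0"
  by (simp add: peval_def)

lemma peval_X: "peval q (X j) = q j"
proof -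
  have "power_prod q (axis j 1) = (\<Prod>i\<in>UNIV. if i = j then q j else 1)"
    unfolding power_prod_def by (rule prod.cong) (auto simp: axis_nth_if)
  then show ?thesis by (simp add: X_def s_one peval_def)
qed

lemma peval_power: "f \<in> polys \<Longrightarrow> peval q (f ^ n) = peval q f ^ n"
  by (induction n) (simp_all add: peval_one peval_mult polys_power)

lemma peval_prod: "(\<And>i. i \<in> I \<Longrightarrow> f i \<in> polys) \<Longrightarrow> peval q (\<Prod>i\<in>I. f i) = (\<Prod>i\<in>I. peval q (f i))"
  and polys_prod: "(\<And>i. i \<in> I \<Longrightarrow> f i \<in> polys) \<Longrightarrow> (\<Prod>i\<in>I. f i) \<in> polys"
proof (induction I rule: infinite_finite_induct)
  case (insert x F)
  { case 1 then show ?case using insert by (simp add: peval_mult) }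
  { case 2 then show ?case using insert by (simp add: polys_mult) }
qed (simp_all add: peval_one)

end

interpretation subst: coefficient_hom "single 0 :: 'a::field \<Rightarrow> 'a laurent"
  by unfold_locales (simp_all add: single_add mult_single)

interpretation value_at: coefficient_hom "\<lambda>x::'a::field. x"
  by unfold_locales simp_all

lemma eval_at_peval: "eval_at P f = value_at.peval (($) P) f"
  by (simp add: eval_at_def value_at.peval_def value_at.power_prod_def)

lemma (in coefficient_hom) peval_subst:
  assumes "f \<in> polys" "\<And>j. q j \<in> polys"
  shows "peval r (subst.peval q f) = peval (\<lambda>j. peval r (q j)) f"
proof -
  have "peval r (subst.power_prod q e) = power_prod (\<lambda>j. peval r (q j)) e" for e
    unfolding subst.power_prod_def power_prod_def using assms(2)
    by (subst peval_prod) (simp_all add: polys_power peval_power)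
  then show ?thesis
    unfolding subst.peval_def
    by (simp add: peval_sum peval_lscale flip: lscale_conv_mult) (simp add: peval_def)
qed

lemma subst_polys:
  assumes "\<And>j. q j \<in> polys" shows "subst.peval q f \<in> polys"
proof -
  have "subst.peval q f = (\<Sum>e\<in>keys f. lscale (lookup f e) (subst.power_prod q e))"
    by (simp add: subst.peval_def lscale_conv_mult)
  moreover have "is_subspace lscale (polys :: 'a laurent set)"
    by (simp add: is_subspace_def polys_add polys_lscale)
  ultimately show ?thesis
    using assms by (auto intro!: is_subspace_sum polys_lscale subst.polys_prod polys_power simp: subst.power_prod_def)
qed

lemma lmon_prod_X:
  assumes "\<And>j. 0 \<le> e $ j" shows "subst.power_prod X e = lmon e"
proof -
  have "of_nat (nat c) * axis j 1 = (axis j c :: int ^ 3)" if "0 \<le> c" for c j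
  proof -
    have "(of_nat (nat c) * axis j 1 :: int ^ 3) $ i = axis j c $ i" for i
      using that by (simp only: vector_mult_component of_nat_index axis_nth_if) simp
    then show ?thesis unfolding vec_eq_iff by blast
  qed
  then have "subst.power_prod X e = lmon (axis 1 (e $ 1)) * lmon (axis 2 (e $ 2)) * (lmon (axis 3 (e $ 3)) :: 'a laurent)"
    using assms by (simp add: subst.power_prod_def X_lmon lmon_power prod_3 mult.assoc)
  also have "\<dots> = lmon e"
    by (simp flip: lmon_add) (rule arg_cong[of _ _ lmon], simp add: vec_eq_iff forall_3 axis_nth_if)
  finally show ?thesis .
qed

lemma subst_X:
  assumes "f \<in> polys" shows "subst.peval X f = f"
proof -
  have "subst.peval X f = (\<Sum>e\<in>keys f. lscale (lookup f e) (lmon e))"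
    using assms by (auto simp: subst.peval_def lscale_conv_mult lmon_prod_X polys_def intro!: sum.cong)
  then show ?thesis by (simp flip: laurent_sum)
qed

subsection \<open>Moving a point to a coordinate vertex\<close>

text \<open>The linear change of coordinates fixing \<open>x_1\<close> and mapping \<open>x_j\<close> to \<open>x_j + a_j x_1\<close>; it carries
  polynomials vanishing at \<open>(1 : a_2 : a_3)\<close> to polynomials vanishing at \<open>(1 : 0 : 0)\<close>.\<close>
definition shift :: "'a::field ^ 3 \<Rightarrow> 'a laurent \<Rightarrow> 'a laurent" where
  "shift a = subst.peval (\<lambda>j. X j + lscale (a $ j) (X 1))"

lemma shift_arg_polys: "X j + lscale c (X 1) \<in> polys"
  by (intro polys_add polys_lscale polys_X)

lemma shift_polys: "shift a f \<in> polys"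
  unfolding shift_def by (intro subst_polys shift_arg_polys)

lemma shift_add: "shift a (f + g) = shift a f + shift a g"
  and shift_mult: "f \<in> polys \<Longrightarrow> g \<in> polys \<Longrightarrow> shift a (f * g) = shift a f * shift a g"
  and shift_lscale: "shift a (lscale c f) = lscale c (shift a f)"
  and shift_power: "f \<in> polys \<Longrightarrow> shift a (f ^ n) = shift a f ^ n"
  and shift_X: "shift a (X j) = X j + lscale (a $ j) (X 1)"
  and shift_0 [simp]: "shift a 0 = 0"
  by (simp_all add: shift_def subst.peval_add subst.peval_mult subst.peval_lscale subst.peval_power
      subst.peval_X subst.peval_0 flip: lscale_conv_mult)

lemma shift_prod: "(\<And>i. i \<in> I \<Longrightarrow> f i \<in> polys) \<Longrightarrow> shift a (\<Prod>i\<in>I. f i) = (\<Prod>i\<in>I. shift a (f i))"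
  unfolding shift_def by (rule subst.peval_prod)

lemma homog_power: "f \<in> homog d \<Longrightarrow> f ^ n \<in> homog (int n * d)"
proof (induction n)
  case 0 then show ?case by (simp add: homog_iff)
next
  case (Suc n)
  then have "f * f ^ n \<in> homog (d + int n * d)" by (intro homog_mult) auto
  then show ?case by (simp add: algebra_simps)
qed

lemma homog_prod: "(\<And>i. i \<in> I \<Longrightarrow> f i \<in> homog (d i)) \<Longrightarrow> (\<Prod>i\<in>I. f i) \<in> homog (\<Sum>i\<in>I. d i)"
proof (induction I rule: infinite_finite_induct)
  case (insert i I)
  then have "f i * prod f I \<in> homog (d i + sum d I)" by (intro homog_mult) auto
  then show ?case using insert.hyps by simp
qed (simp_all add: homog_iff)

lemma homog_X: "X j \<in> homog 1" by (metis X_lmon deg_axis lmon_homog)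

lemma linear_homog: "X j + lscale c (X 1) \<in> homog 1"
  using is_subspaceD[OF is_subspace_homog] homog_X by blast

lemma shift_homog:
  assumes "f \<in> polys" "f \<in> homog d" shows "shift a f \<in> homog d"
proof -
  have "shift a f = (\<Sum>e\<in>keys f. lscale (lookup f e)
      (subst.power_prod (\<lambda>j. X j + lscale (a $ j) (X 1)) e))"
    by (simp add: shift_def subst.peval_def lscale_conv_mult)
  also have "\<dots> \<in> homog d"
  proof (rule is_subspace_sum[OF is_subspace_homog], rule is_subspaceD(3)[OF is_subspace_homog])
    fix e assume e: "e \<in> keys f"
    then have "(\<Sum>j\<in>UNIV. int (nat (e $ j)) * 1) = d"
      using assms by (simp add: polys_def homog_iff deg_def)
    then show "subst.power_prod (\<lambda>j. X j + lscale (a $ j) (X 1)) e \<in> homog d"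
      unfolding subst.power_prod_def
      using homog_prod[of UNIV "\<lambda>j. (X j + lscale (a $ j) (X 1)) ^ nat (e $ j)" "\<lambda>j. int (nat (e $ j)) * 1"]
      by (simp only: homog_power linear_homog)
  qed
  finally show ?thesis .
qed

lemma lscale_simps: "lscale 1 f = f" "lscale 0 f = 0" "lscale c (lscale d f) = lscale (c * d) f"
  "lscale (- c) f = - lscale c f" "lscale c 0 = 0"
  unfolding poly_mapping_eq_iff fun_eq_iff by simp_all

lemma shift_inverse:
  assumes "a $ 1 = 0" "f \<in> polys" shows "shift (- a) (shift a f) = f"
proof -
  have "shift (- a) (X j + lscale (a $ j) (X 1)) = X j" for j
  proof -
    have "shift (- a) (X 1) = X 1" using assms(1) by (simp add: shift_X lscale_simps)
    then show ?thesis unfolding shift_add shift_lscale shift_X by (simp add: lscale_simps)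
  qed
  then have "shift (- a) (shift a f) = subst.peval X f"
    unfolding shift_def using subst.peval_subst[OF assms(2), of "\<lambda>j. X j + lscale (a $ j) (X 1)"]
    by (simp add: shift_arg_polys)
  then show ?thesis using subst_X[OF assms(2)] by simp
qed

subsection \<open>Order of vanishing\<close>

text \<open>The \<open>m\<close>-th power of the ideal of \<open>(1 : 0 : 0)\<close>.\<close>
definition order_ge :: "nat \<Rightarrow> 'a::field laurent set" where
  "order_ge m = {f \<in> polys. \<forall>e\<in>keys f. int m \<le> e $ 2 + e $ 3}"

lemma order_ge_0: "order_ge 0 = polys" by (auto simp: order_ge_def polys_def)

lemma order_ge_mono: "m \<le> r \<Longrightarrow> order_ge r \<subseteq> order_ge m" by (fastforce simp: order_ge_def)

lemma is_subspace_order_ge: "is_subspace lscale (order_ge m :: 'a::field laurent set)"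
proof (rule is_subspaceI)
  fix f g :: "'a laurent" assume "f \<in> order_ge m" "g \<in> order_ge m"
  then show "f + g \<in> order_ge m" using keys_add[of f g] by (auto simp: order_ge_def polys_add)
next
  fix c and f :: "'a laurent" assume "f \<in> order_ge m"
  then show "lscale c f \<in> order_ge m" using keys_lscale[of c f] by (auto simp: order_ge_def polys_lscale)
qed (simp add: order_ge_def)

lemma order_ge_mult:
  assumes "f \<in> order_ge m" "g \<in> order_ge r" shows "f * g \<in> order_ge (m + r)"
  using assms keys_mult[of f g] by (fastforce simp: order_ge_def polys_mult)

lemma order_ge_power: "f \<in> order_ge m \<Longrightarrow> f ^ n \<in> order_ge (n * m)"
proof (induction n)
  case 0 then show ?case by (simp add: order_ge_0)
next
  case (Suc n) then show ?case using order_ge_mult[of f m "f ^ n" "n * m"] by simp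
qed

lemma keys_lmon [simp]: "keys (lmon a :: 'a::field laurent) = {a}"
  by (simp add: lmon_def)

lemma X_order_ge: "j \<noteq> 1 \<Longrightarrow> X j \<in> order_ge 1"
  using exhaust_3[of j] by (auto simp: order_ge_def X_lmon keys_lmon lmon_polys axis_nth_if)

lemma order_ge_X1_iff: "f \<in> polys \<Longrightarrow> X 1 * f \<in> order_ge m \<longleftrightarrow> f \<in> order_ge m"
  by (auto simp: order_ge_def X_lmon keys_lmon_times axis_nth_if polys_mult lmon_polys)

text \<open>A linear form that does not vanish at \<open>(1 : 0 : 0)\<close> does not change the order of vanishing: its term in
  \<open>x_1\<close> preserves the order, the other term raises it.\<close>
lemma order_ge_cancel:
  assumes f: "f \<in> polys" and c: "c \<noteq> 0" and j: "j \<noteq> 1" and prod: "(X j + lscale c (X 1)) * f \<in> order_ge m"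
  shows "f \<in> order_ge m"
proof -
  note sub = is_subspaceD[OF is_subspace_order_ge]
  have "r \<le> m \<Longrightarrow> f \<in> order_ge r" for r
  proof (induction r)
    case 0 then show ?case using f by (simp add: order_ge_0)
  next
    case (Suc r)
    have "X j * f \<in> order_ge (Suc r)"
      using order_ge_mult[OF X_order_ge[OF j], of f r] Suc by simp
    moreover have "(X j + lscale c (X 1)) * f \<in> order_ge (Suc r)"
      using prod order_ge_mono[OF Suc.prems] by blast
    ultimately have "(X j + lscale c (X 1)) * f - X j * f \<in> order_ge (Suc r)"
      by (intro is_subspace_diff[OF vector_space_lscale is_subspace_order_ge])
    then have "lscale c (X 1 * f) \<in> order_ge (Suc r)"
      by (simp add: distrib_right lscale_times_left)
    then have "lscale (inverse c) (lscale c (X 1 * f)) \<in> order_ge (Suc r)" by (rule sub(3))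
    then show ?case using c f by (simp add: lscale_simps order_ge_X1_iff)
  qed
  then show ?thesis by simp
qed

section \<open>Ideals of fat points\<close>

lemma poly_ideal_shift_order_ge:
  fixes a :: "'a::field ^ 3"
  shows "poly_ideal {f \<in> polys. shift a f \<in> order_ge m}"
  unfolding poly_ideal_def
proof (intro conjI ballI)
  fix f g :: "'a laurent" assume "f \<in> polys" "g \<in> {f \<in> polys. shift a f \<in> order_ge m}"
  then show "f * g \<in> {f \<in> polys. shift a f \<in> order_ge m}"
    using order_ge_mult[of "shift a f" 0 "shift a g" m]
    by (simp add: shift_mult polys_mult order_ge_0 shift_polys)
qed (use is_subspaceD[OF is_subspace_order_ge] in \<open>auto simp: shift_add polys_add\<close>)

lemma cring_poly_ring: "cring (poly_ring :: 'a::field laurent ring)"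
proof (rule cringI)
  show "abelian_group (poly_ring :: 'a laurent ring)"
  proof (rule abelian_groupI)
    fix f :: "'a laurent" assume "f \<in> carrier poly_ring"
    then show "\<exists>g\<in>carrier poly_ring. g \<oplus>\<^bsub>poly_ring\<^esub> f = \<zero>\<^bsub>poly_ring\<^esub>"
      by (intro bexI[of _ "- f"]) (simp_all add: poly_ring_def polys_uminus)
  qed (auto simp: poly_ring_def polys_add add_ac)
  show "comm_monoid (poly_ring :: 'a laurent ring)"
    by (rule comm_monoidI) (auto simp: poly_ring_def polys_mult mult_ac)
qed (auto simp: poly_ring_def distrib_right)

lemma ideal_iff: "ideal I poly_ring \<longleftrightarrow> poly_ideal I"
proof
  interpret R: cring "poly_ring :: 'a::field laurent ring" by (rule cring_poly_ring)
  { assume "ideal I (poly_ring :: 'a laurent ring)"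
    then interpret I: ideal I "poly_ring :: 'a laurent ring" .
    show "poly_ideal I"
      using I.a_subset I.zero_closed I.a_closed I.I_l_closed by (auto simp: poly_ideal_def poly_ring_def) }
  { assume I: "poly_ideal (I :: 'a laurent set)"
    have neg: "- f \<in> I" if "f \<in> I" for f using poly_ideal_lscale[OF I that, of "-1"] by (simp add: lscale_simps)
    have inv: "inv\<^bsub>add_monoid poly_ring\<^esub> f = - f" if "f \<in> polys" for f :: "'a laurent"
      using R.minus_equality[of "- f" f] that by (simp add: poly_ring_def polys_uminus a_inv_def)
    show "ideal I poly_ring"
    proof (rule idealI)
      show "ring (poly_ring :: 'a laurent ring)" by (rule R.ring_axioms)
      show "subgroup I (add_monoid poly_ring)"
        using poly_idealD[OF I] neg inv by (auto simp: subgroup_def) (auto simp: poly_ring_def)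
      show "x \<otimes>\<^bsub>poly_ring\<^esub> f \<in> I" "f \<otimes>\<^bsub>poly_ring\<^esub> x \<in> I" if "f \<in> I" "x \<in> carrier poly_ring" for f x
        using poly_idealD(4)[OF I, of x f] that by (simp_all add: poly_ring_def mult.commute)
    qed }
qed

lemma poly_ideal_pt: "poly_ideal (pt_ideal P)"
  and pt_ideal_superset: "f \<in> polys \<Longrightarrow> f \<in> homog d \<Longrightarrow> eval_at P f = 0 \<Longrightarrow> f \<in> pt_ideal P"
  and pt_ideal_least: "poly_ideal I \<Longrightarrow>
    (\<And>f d. f \<in> polys \<Longrightarrow> f \<in> homog d \<Longrightarrow> eval_at P f = 0 \<Longrightarrow> f \<in> I) \<Longrightarrow> pt_ideal P \<subseteq> I"
proof -
  interpret R: cring "poly_ring :: 'a laurent ring" by (rule cring_poly_ring)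
  let ?S = "{f \<in> polys. (\<exists>d. f \<in> homog d) \<and> eval_at P f = 0}"
  have S: "?S \<subseteq> carrier poly_ring" by (auto simp: poly_ring_def)
  show "poly_ideal (pt_ideal P)"
    unfolding pt_ideal_def ideal_iff[symmetric] by (rule R.genideal_ideal[OF S])
  show "f \<in> polys \<Longrightarrow> f \<in> homog d \<Longrightarrow> eval_at P f = 0 \<Longrightarrow> f \<in> pt_ideal P"
    unfolding pt_ideal_def using R.genideal_self[OF S] by blast
  show "pt_ideal P \<subseteq> I" if "poly_ideal I"
    "\<And>f d. f \<in> polys \<Longrightarrow> f \<in> homog d \<Longrightarrow> eval_at P f = 0 \<Longrightarrow> f \<in> I"
    unfolding pt_ideal_def using that by (intro R.genideal_minimal) (auto simp: ideal_iff)
qed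

lemma poly_ideal_pow: "poly_ideal I \<Longrightarrow> poly_ideal (ideal_pow I m)"
proof (induction m)
  case (Suc m)
  interpret R: cring "poly_ring :: 'a laurent ring" by (rule cring_poly_ring)
  show ?case using Suc R.ideal_prod_is_ideal by (simp flip: ideal_iff)
qed (simp add: poly_ideal_polys)

lemma ideal_pow_Suc_mult: "f \<in> I \<Longrightarrow> g \<in> ideal_pow I m \<Longrightarrow> f * g \<in> ideal_pow I (Suc m)"
  using ideal_prod.prod[of f I g "ideal_pow I m" poly_ring] by (simp add: poly_ring_def)

lemma ideal_pow_mono:
  fixes I :: "'a::field laurent set"
  assumes I: "poly_ideal I" and "m \<le> r" shows "ideal_pow I r \<subseteq> ideal_pow I m"
  using assms(2)
proof (induction r rule: dec_induct)
  case (step r)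
  interpret R: cring "poly_ring :: 'a laurent ring" by (rule cring_poly_ring)
  have "ideal_pow I (Suc r) \<subseteq> ideal_pow I r"
    using R.ideal_prod_inter[of I "ideal_pow I r"] I poly_ideal_pow[of I r] by (simp add: ideal_iff)
  then show ?case using step by blast
qed simp

lemma ideal_pow_monomial:
  assumes "poly_ideal I" "f \<in> I" "g \<in> I"
  shows "f ^ i * g ^ k \<in> ideal_pow I (i + k)"
proof (induction i)
  case 0
  show ?case
  proof (induction k)
    case (Suc k)
    then show ?case using ideal_pow_Suc_mult[OF assms(3), of "g ^ k" k] by simp
  qed simp
next
  case (Suc i)
  then show ?case using ideal_pow_Suc_mult[OF assms(2)] by (simp add: mult.assoc)
qed

text \<open>Affine coordinates \<open>x_2/x_1\<close>, \<open>x_3/x_1\<close>.\<close>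
definition aff :: "'a::field ^ 3 \<Rightarrow> 'a ^ 3" where
  "aff P = (\<chi> j. if j = 1 then 0 else P $ j / P $ 1)"

lemma eval_at_vertex:
  fixes g :: "'a::field laurent"
  assumes g: "g \<in> polys" "g \<in> homog d" and e: "e = axis 1 d"
  shows "eval_at (axis 1 1) g = lookup g e"
proof -
  have "(\<Prod>j\<in>UNIV. (axis 1 1 :: 'a ^ 3) $ j ^ nat (e' $ j)) = (if e' = e then 1 else 0)"
    if "e' \<in> keys g" for e'
  proof -
    have e': "0 \<le> e' $ 2" "0 \<le> e' $ 3" "deg e' = d" using that g by (auto simp: polys_def homog_iff)
    then have "e' = e \<longleftrightarrow> e' $ 2 = 0 \<and> e' $ 3 = 0"
      unfolding e vec_eq_iff forall_3 axis_nth_if deg_3 by auto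
    moreover have "(\<Prod>j\<in>UNIV. (axis 1 1 :: 'a ^ 3) $ j ^ nat (e' $ j)) = 0 ^ nat (e' $ 2) * 0 ^ nat (e' $ 3)"
      unfolding prod_3 axis_nth_if by simp
    ultimately show ?thesis using e'(1,2) by (simp add: power_0_left)
  qed
  then have "eval_at (axis 1 1) g =
     (\<Sum>e'\<in>keys g. if e' = e then lookup g e' else 0)"
    unfolding eval_at_def by (intro sum.cong) auto
  then show ?thesis by (simp add: in_keys_iff)
qed

lemma eval_at_scale:
  assumes "f \<in> polys" "f \<in> homog d" shows "eval_at (c *s P) f = c ^ nat d * eval_at P f"
proof -
  have "(\<Prod>j\<in>UNIV. (c *s P) $ j ^ nat (e $ j)) = c ^ nat d * (\<Prod>j\<in>UNIV. P $ j ^ nat (e $ j))"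
    if "e \<in> keys f" for e
  proof -
    have "\<forall>j. 0 \<le> e $ j" "deg e = d" using that assms by (auto simp: polys_def homog_iff)
    then have "(\<Sum>j\<in>UNIV. nat (e $ j)) = nat d"
      by (auto simp: deg_3 sum_3 forall_3 nat_add_distrib)
    moreover have "(\<Prod>j\<in>UNIV. (c *s P) $ j ^ nat (e $ j)) =
        (\<Prod>j\<in>UNIV. c ^ nat (e $ j)) * (\<Prod>j\<in>UNIV. P $ j ^ nat (e $ j))"
      by (simp add: power_mult_distrib prod.distrib)
    ultimately show ?thesis by (simp flip: power_sum)
  qed
  then show ?thesis unfolding eval_at_def sum_distrib_left by (intro sum.cong) auto
qed

lemma shift_eval: "f \<in> polys \<Longrightarrow> P $ 1 \<noteq> 0 \<Longrightarrow>
  eval_at (axis 1 1) (shift (aff P) f) = eval_at (inverse (P $ 1) *s P) f"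
proof -
  assume f: "f \<in> polys" and P: "P $ 1 \<noteq> 0"
  have "eval_at (axis 1 1) (X j + lscale (aff P $ j) (X 1)) = (inverse (P $ 1) *s P) $ j" for j
    using P by (simp add: eval_at_peval value_at.peval_add value_at.peval_lscale value_at.peval_X
        axis_nth_if aff_def divide_inverse mult.commute)
  then have "(\<lambda>j. value_at.peval (($) (axis 1 1)) (X j + lscale (aff P $ j) (X 1))) = ($) (inverse (P $ 1) *s P)"
    unfolding eval_at_peval by (rule ext)
  then show ?thesis
    unfolding shift_def eval_at_peval
    by (subst value_at.peval_subst[OF f shift_arg_polys]) (simp only:)
qed

text \<open>After a linear change of coordinates the point is \<open>(1 : 0 : 0)\<close>, and a form of degree \<open>d\<close> vanishes
  there if and only if the coefficient of \<open>x_1^d\<close> is zero; this gives one inclusion for the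
  generators and hence for products.  For the other, expand in the new coordinates: every term contains at
  least \<open>m\<close> linear factors that vanish at the point.\<close>
lemma ideal_pow_pt:
  fixes P :: "'a::field ^ 3"
  assumes P: "P $ 1 \<noteq> 0"
  shows "ideal_pow (pt_ideal P) m = {f \<in> polys. shift (aff P) f \<in> order_ge m}"
proof
  let ?T = "\<lambda>m. {f \<in> polys. shift (aff P) f \<in> order_ge m}"
  note T = poly_ideal_shift_order_ge[of "aff P"]
  have pt: "pt_ideal P \<subseteq> ?T 1"
  proof (rule pt_ideal_least[OF T])
    fix f d assume f: "f \<in> polys" "f \<in> homog d" "eval_at P f = 0"
    have g: "shift (aff P) f \<in> polys" "shift (aff P) f \<in> homog d"
      using f by (simp_all add: shift_polys shift_homog)
    have 0: "lookup (shift (aff P) f) (axis 1 d) = 0"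
      using eval_at_vertex[OF g refl] shift_eval[OF f(1) P] eval_at_scale[OF f(1,2)] f(3) by simp
    have "1 \<le> e $ 2 + e $ 3" if e: "e \<in> keys (shift (aff P) f)" for e
    proof (rule ccontr)
      assume *: "\<not> ?thesis"
      have "\<forall>j. 0 \<le> e $ j" "deg e = d" using g e by (auto simp: polys_def homog_iff)
      then have "e = axis 1 d" using * by (auto simp: vec_eq_iff forall_3 axis_nth_if deg_3)
      then show False using 0 e by (simp add: in_keys_iff)
    qed
    then show "f \<in> ?T 1" using f g by (simp add: order_ge_def)
  qed
  show "ideal_pow (pt_ideal P) m \<subseteq> ?T m"
  proof (induction m)
    case (Suc m)
    show ?case
    proof
      fix f assume "f \<in> ideal_pow (pt_ideal P) (Suc m)"
      then have "f \<in> ideal_prod poly_ring (pt_ideal P) (ideal_pow (pt_ideal P) m)" by simp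
      then show "f \<in> ?T (Suc m)"
      proof (induction rule: ideal_prod.induct)
        case (prod g h)
        then have "g \<in> ?T 1" "h \<in> ?T m" using pt Suc by blast+
        then show ?case
          using order_ge_mult[of "shift (aff P) g" 1 "shift (aff P) h" m]
          by (simp add: poly_ring_def shift_mult polys_mult)
      next
        case (sum g h)
        have "g + h \<in> ?T (Suc m)" by (rule poly_idealD(3)[OF T sum.IH])
        then show ?case by (simp add: poly_ring_def)
      qed
    qed
  qed (simp add: order_ge_0 shift_polys)
  show "?T m \<subseteq> ideal_pow (pt_ideal P) m"
  proof clarify
    fix f assume f: "f \<in> polys" and m: "shift (aff P) f \<in> order_ge m"
    let ?I = "ideal_pow (pt_ideal P) m" and ?u = "\<lambda>j. X j + lscale ((- aff P) $ j) (X 1)"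
    have I: "poly_ideal ?I" by (rule poly_ideal_pow[OF poly_ideal_pt])
    then have sub: "is_subspace lscale ?I"
      using poly_idealD poly_ideal_lscale by (auto simp: is_subspace_def)
    have u: "?u j \<in> pt_ideal P" if "j \<noteq> 1" for j
    proof (rule pt_ideal_superset[OF shift_arg_polys linear_homog])
      show "eval_at P (?u j) = 0"
        using that P by (simp add: eval_at_peval value_at.peval_add value_at.peval_lscale value_at.peval_X aff_def)
    qed
    have "f = shift (- aff P) (shift (aff P) f)"
      using shift_inverse[OF _ f, of "aff P"] by (simp add: aff_def)
    also have "\<dots> = (\<Sum>e\<in>keys (shift (aff P) f).
       lscale (lookup (shift (aff P) f) e) (subst.power_prod ?u e))"
      unfolding shift_def[of "- aff P"] by (simp add: subst.peval_def lscale_conv_mult)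
    also have "\<dots> \<in> ?I"
    proof (rule is_subspace_sum[OF sub], rule is_subspaceD(3)[OF sub])
      fix e assume e: "e \<in> keys (shift (aff P) f)"
      then have "int m \<le> e $ 2 + e $ 3" "0 \<le> e $ 2" "0 \<le> e $ 3"
        using m by (auto simp: order_ge_def polys_def)
      then have "m \<le> nat (e $ 2) + nat (e $ 3)" by (simp add: le_nat_iff flip: nat_add_distrib)
      then have "?u 2 ^ nat (e $ 2) * ?u 3 ^ nat (e $ 3) \<in> ?I"
        using ideal_pow_monomial[OF poly_ideal_pt u[of 2] u[of 3], of "nat (e $ 2)" "nat (e $ 3)"]
          ideal_pow_mono[OF poly_ideal_pt, of m "nat (e $ 2) + nat (e $ 3)" P] by auto
      then have "?u 1 ^ nat (e $ 1) * (?u 2 ^ nat (e $ 2) * ?u 3 ^ nat (e $ 3)) \<in> ?I"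
        by (rule poly_idealD(4)[OF I polys_power[OF shift_arg_polys]])
      then show "subst.power_prod ?u e \<in> ?I" by (simp add: subst.power_prod_def prod_3 mult.assoc)
    qed
    finally show "f \<in> ?I" .
  qed
qed


section \<open>The Hilbert function of fat points\<close>

text \<open>What is used of the ideal of a zero-dimensional scheme: none of its points lies on a coordinate
  line, and its length is \<open>l\<close>, read off in all sufficiently large degrees.\<close>
locale point_scheme =
  fixes Z :: "'a::field laurent set" and l :: nat
  assumes ideal: "poly_ideal Z"
    and X_cancel: "f \<in> polys \<Longrightarrow> X j * f \<in> Z \<Longrightarrow> f \<in> Z"
    and codim: "\<exists>d0. \<forall>d\<ge>d0. \<exists>w. has_dim (vs_of lscale (Z \<inter> homog (int d))) w \<and> (d + 2) choose 2 = l + w"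

text \<open>The genericity that the proof uses: the charts may be replaced by their intersection, and the lines
  through \<open>(0 : 0 : 1)\<close> separate the points.\<close>
definition good_points :: "nat \<Rightarrow> (nat \<Rightarrow> 'a::field ^ 3) \<Rightarrow> bool" where
  "good_points n P \<longleftrightarrow> (\<forall>i\<in>{1..n}. \<forall>j. P i $ j \<noteq> 0) \<and>
     (\<forall>i\<in>{1..n}. \<forall>k\<in>{1..n}. i \<noteq> k \<longrightarrow> P i $ 2 * P k $ 1 \<noteq> P k $ 2 * P i $ 1)"

context
  fixes n :: nat and m :: "nat \<Rightarrow> nat" and P :: "nat \<Rightarrow> 'a::field ^ 3" and a :: "nat \<Rightarrow> 'a ^ 3"
  assumes good: "good_points n P"
  defines "a \<equiv> \<lambda>i. aff (P i)"
begin

lemma a_nonzero: "i \<in> {1..n} \<Longrightarrow> j \<noteq> 1 \<Longrightarrow> a i $ j \<noteq> 0"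
  using good by (simp add: a_def aff_def good_points_def)

lemma a_1: "a i $ 1 = 0"
  by (simp add: a_def aff_def)

lemma a_distinct: "i \<in> {1..n} \<Longrightarrow> k \<in> {1..n} \<Longrightarrow> i \<noteq> k \<Longrightarrow> a i $ 2 \<noteq> a k $ 2"
  using good by (auto simp: a_def aff_def good_points_def frac_eq_eq)

lemma fat_ideal_eq: "fat_ideal n m P = {f \<in> polys. \<forall>i\<in>{1..n}. shift (a i) f \<in> order_ge (m i)}"
proof -
  have "ideal_pow (pt_ideal (P i)) (m i) = {f \<in> polys. shift (a i) f \<in> order_ge (m i)}" if "i \<in> {1..n}" for i
    unfolding a_def using good that by (intro ideal_pow_pt) (simp add: good_points_def)
  then show ?thesis by (auto simp: fat_ideal_def)
qed

lemma fat_ideal_poly_ideal: "poly_ideal (fat_ideal n m P)"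
  using poly_ideal_shift_order_ge[of "a _" "m _"]
  by (auto simp: fat_ideal_eq poly_ideal_def polys_add polys_mult)

lemma fat_ideal_X_cancel:
  assumes f: "f \<in> polys" and Xf: "X j * f \<in> fat_ideal n m P"
  shows "f \<in> fat_ideal n m P"
proof -
  have "shift (a i) f \<in> order_ge (m i)" if i: "i \<in> {1..n}" for i
  proof -
    have prod: "(X j + lscale (a i $ j) (X 1)) * shift (a i) f \<in> order_ge (m i)"
      using Xf i f unfolding fat_ideal_eq by (simp add: shift_mult shift_X)
    show ?thesis
    proof (cases "j = 1")
      case True
      then show ?thesis using prod by (simp add: a_1 lscale_simps order_ge_X1_iff shift_polys)
    next
      case False
      show ?thesis by (rule order_ge_cancel[OF shift_polys a_nonzero[OF i False] False prod])
    qed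
  qed
  then show ?thesis using f by (simp add: fat_ideal_eq)
qed

subsection \<open>Taylor expansions\<close>

text \<open>The coefficients of order less than \<open>m_i\<close> at \<open>P_i\<close>, in coordinates in which \<open>P_i\<close> is \<open>(1 : 0 : 0)\<close>.\<close>
definition taylor :: "'a laurent \<Rightarrow> (nat \<times> (int ^ 3)) \<Rightarrow>\<^sub>0 'a" where
  "taylor f = (\<Sum>i\<in>{1..n}. \<Sum>e\<in>keys (shift (a i) f).
     single (i, e) (if e $ 2 + e $ 3 < int (m i) then lookup (shift (a i) f) e else 0))"

lemma lookup_taylor: "lookup (taylor f) (i, e) =
    (if i \<in> {1..n} \<and> e $ 2 + e $ 3 < int (m i) then lookup (shift (a i) f) e else 0)"
proof -
  have inner: "(\<Sum>e'\<in>keys (shift (a i') f). lookup (single (i', e')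
      (if e' $ 2 + e' $ 3 < int (m i') then lookup (shift (a i') f) e' else 0)) (i, e)) =
    (if i' = i then if e $ 2 + e $ 3 < int (m i) then lookup (shift (a i) f) e else 0 else 0)" for i'
  proof (cases "i' = i")
    case True
    have "(\<Sum>e'\<in>keys (shift (a i) f). lookup (single (i, e')
      (if e' $ 2 + e' $ 3 < int (m i) then lookup (shift (a i) f) e' else 0)) (i, e)) =
      (\<Sum>e'\<in>keys (shift (a i) f). if e' = e then
        (if e' $ 2 + e' $ 3 < int (m i) then lookup (shift (a i) f) e' else 0) else 0)"
      by (rule sum.cong) (auto simp: lookup_single when_def)
    also have "\<dots> = (if e $ 2 + e $ 3 < int (m i) then lookup (shift (a i) f) e else 0)"
      by (subst sum.delta) (simp_all add: in_keys_iff)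
    finally show ?thesis unfolding True by (simp only: simp_thms if_True)
  next
    case False
    then show ?thesis by (auto simp: lookup_single when_def intro!: sum.neutral)
  qed
  show ?thesis unfolding taylor_def lookup_sum inner by (subst sum.delta) auto
qed

definition taylor_exps :: "nat \<Rightarrow> (nat \<times> (int ^ 3)) set" where
  "taylor_exps d = (SIGMA i:{1..n}. low_exps d (m i))"

lemma taylor_add: "taylor (f + g) = taylor f + taylor g"
  by (rule poly_mapping_eqI, clarify) (simp add: lookup_taylor lookup_add shift_add)

lemma taylor_lscale: "taylor (lscale c f) = lscale c (taylor f)"
  by (rule poly_mapping_eqI, clarify) (simp add: lookup_taylor shift_lscale)

lemma taylor_keys:
  assumes "f \<in> polys \<inter> homog (int d)" shows "keys (taylor f) \<subseteq> taylor_exps d"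
proof clarify
  fix i e assume "(i, e) \<in> keys (taylor f)"
  then have i: "i \<in> {1..n}" "e $ 2 + e $ 3 < int (m i)" "e \<in> keys (shift (a i) f)"
    by (auto simp: in_keys_iff lookup_taylor split: if_splits)
  moreover have "shift (a i) f \<in> polys" "shift (a i) f \<in> homog (int d)"
    using assms by (simp_all add: shift_polys shift_homog)
  ultimately show "(i, e) \<in> taylor_exps d"
    by (auto simp: taylor_exps_def low_exps_def polys_def homog_iff)
qed

lemma taylor_kernel:
  assumes "f \<in> polys" shows "taylor f = 0 \<longleftrightarrow> f \<in> fat_ideal n m P"
proof
  assume 0: "taylor f = 0"
  have "shift (a i) f \<in> order_ge (m i)" if "i \<in> {1..n}" for i
  proof -
    have "int (m i) \<le> e $ 2 + e $ 3" if "e \<in> keys (shift (a i) f)" for e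
      using lookup_taylor[of f i e] \<open>i \<in> {1..n}\<close> that by (auto simp: 0 in_keys_iff split: if_splits)
    then show ?thesis by (simp add: order_ge_def shift_polys)
  qed
  then show "f \<in> fat_ideal n m P" using assms by (simp add: fat_ideal_eq)
next
  assume f: "f \<in> fat_ideal n m P"
  have "lookup (taylor f) (i, e) = 0" for i e
    using f unfolding lookup_taylor fat_ideal_eq by (force simp: order_ge_def in_keys_iff)
  then show "taylor f = 0" by (intro poly_mapping_eqI) auto
qed

text \<open>A form with the single prescribed leading Taylor coefficient \<open>e\<close> at the \<open>i\<close>-th point: powers of
  the lines through the other points and the vertex \<open>(0 : 0 : 1)\<close> kill the expansions there,
  and do not vanish at the \<open>i\<close>-th point because the ratios \<open>x_2/x_1\<close> differ.\<close>
lemma taylor_witness: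
  assumes i: "i \<in> {1..n}" and e: "e \<in> low_exps d (m i)" and d: "(\<Sum>i\<in>{1..n}. m i) \<le> d"
  obtains h c where "h \<in> polys \<inter> homog (int d)" "c \<noteq> 0"
    "\<And>k. k \<in> {1..n} \<Longrightarrow> k \<noteq> i \<Longrightarrow> shift (a k) h \<in> order_ge (m k)"
    "shift (a i) h - lscale c (lmon e) \<in> order_ge (nat (e $ 2 + e $ 3) + 1)"
proof -
  define J where "J = {1..n} - {i}"
  define L where "L k = X 2 + lscale (- a k $ 2) (X 1)" for k
  define G where "G = (\<Prod>k\<in>J. L k ^ m k)"
  define D where "D = (\<Sum>k\<in>J. m k)"
  define c where "c = (\<Prod>k\<in>J. (a i $ 2 - a k $ 2) ^ m k)"
  define u where "u j = X j + lscale (- a i $ j) (X 1)" for j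
  have e': "\<forall>j. 0 \<le> e $ j" "deg e = int d" "e $ 2 + e $ 3 < int (m i)"
    using e by (auto simp: low_exps_def)
  have "m i + D = (\<Sum>i\<in>{1..n}. m i)"
    unfolding D_def J_def by (rule sum.remove[symmetric]) (use i in auto)
  then have D: "D + m i \<le> d" using d by simp
  \<comment> \<open>the power of \<open>x_1\<close> that brings the degree up to \<open>d\<close>\<close>
  define N where "N = d - D - nat (e $ 2) - nat (e $ 3)"
  have N: "int N + int D = e $ 1"
  proof -
    have e23: "int (nat (e $ 2)) = e $ 2" "int (nat (e $ 3)) = e $ 3" using e'(1) by simp_all
    then have "nat (e $ 2) + nat (e $ 3) + D \<le> d" using D e'(3) by linarith
    then have "int N = int d - int D - int (nat (e $ 2)) - int (nat (e $ 3))" by (simp add: N_def of_nat_diff)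
    then show ?thesis using e'(2) e23 by (simp add: deg_3)
  qed
  define h where "h = G * (X 1 ^ N * (u 2 ^ nat (e $ 2) * u 3 ^ nat (e $ 3)))"
  have L: "L k \<in> polys" "L k \<in> homog 1" for k unfolding L_def by (rule shift_arg_polys linear_homog)+
  have u: "u j \<in> polys" "u j \<in> homog 1" for j unfolding u_def by (rule shift_arg_polys linear_homog)+
  have Gp: "G \<in> polys" unfolding G_def by (intro subst.polys_prod polys_power L)
  have Rp: "X 1 ^ N * (u 2 ^ nat (e $ 2) * u 3 ^ nat (e $ 3)) \<in> polys"
    by (intro polys_mult polys_power u polys_X)
  have "h \<in> homog (int D + (int N * 1 + (int (nat (e $ 2)) * 1 + int (nat (e $ 3)) * 1)))"
  proof -
    have "G \<in> homog (\<Sum>k\<in>J. int (m k) * 1)" unfolding G_def by (intro homog_prod homog_power L)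
    then show ?thesis unfolding h_def by (intro homog_mult homog_power homog_X u) (simp add: D_def)
  qed
  moreover have "int D + (int N * 1 + (int (nat (e $ 2)) * 1 + int (nat (e $ 3)) * 1)) = int d"
    using N e' by (simp add: deg_3)
  ultimately have 1: "h \<in> polys \<inter> homog (int d)" using Gp Rp by (simp add: h_def polys_mult)
  have "a i $ 2 - a k $ 2 \<noteq> 0" if "k \<in> J" for k using a_distinct[of i k] that i by (auto simp: J_def)
  then have 2: "c \<noteq> 0" unfolding c_def by (simp add: J_def)
  have shL: "shift (a k) (L k') = X 2 + lscale (a k $ 2 - a k' $ 2) (X 1)" for k k'
  proof -
    show ?thesis unfolding L_def shift_add shift_lscale shift_X a_1
      by (simp add: lscale_simps poly_mapping_eq_iff fun_eq_iff lookup_add lookup_minus algebra_simps)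
  qed
  have shu: "shift (a i) (u j) = X j" for j
  proof -
    show ?thesis unfolding u_def shift_add shift_lscale shift_X a_1
      by (simp add: lscale_simps poly_mapping_eq_iff fun_eq_iff lookup_add algebra_simps)
  qed
  have 3: "shift (a k) h \<in> order_ge (m k)" if k: "k \<in> {1..n}" "k \<noteq> i" for k
  proof -
    have kJ: "k \<in> J" using k by (simp add: J_def)
    have "X 2 ^ m k \<in> order_ge (m k * 1)" by (rule order_ge_power[OF X_order_ge]) simp
    moreover have "shift (a k) (L k ^ m k) = X 2 ^ m k"
      by (simp add: shift_power L shL lscale_simps)
    moreover have "h = L k ^ m k * ((\<Prod>k\<in>J - {k}. L k ^ m k) * (X 1 ^ N * (u 2 ^ nat (e $ 2) * u 3 ^ nat (e $ 3))))"
      unfolding h_def G_def using prod.remove[OF _ kJ, of "\<lambda>k. L k ^ m k"] by (simp add: J_def mult.assoc)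
    ultimately show ?thesis
      using order_ge_mult[of "X 2 ^ m k" "m k" "shift (a k) ((\<Prod>k\<in>J - {k}. L k ^ m k) * (X 1 ^ N * (u 2 ^ nat (e $ 2) * u 3 ^ nat (e $ 3))))" 0]
      by (simp add: shift_mult polys_power L subst.polys_prod polys_mult Rp order_ge_0 shift_polys)
  qed
  have 4: "shift (a i) h - lscale c (lmon e) \<in> order_ge (nat (e $ 2 + e $ 3) + 1)"
  proof -
    note sub = is_subspaceD[OF is_subspace_order_ge]
    \<comment> \<open>modulo the ideal of \<open>(1 : 0 : 0)\<close> a form is a multiple of a power of \<open>x_1\<close>, compatibly with products\<close>
    have cong: "f * g - lscale (x * y) (X 1 ^ (p + q)) \<in> order_ge 1"
      if "f - lscale x (X 1 ^ p) \<in> order_ge 1" "g - lscale y (X 1 ^ q) \<in> order_ge 1" "g \<in> polys"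
      for f g :: "'a laurent" and x y p q
    proof -
      have "(f - lscale x (X 1 ^ p)) * g \<in> order_ge (1 + 0)"
        using that by (intro order_ge_mult) (simp_all add: order_ge_0)
      moreover have "lscale x (X 1 ^ p) * (g - lscale y (X 1 ^ q)) \<in> order_ge (0 + 1)"
        using that by (intro order_ge_mult) (simp_all add: order_ge_0 polys_lscale polys_power)
      ultimately have "(f - lscale x (X 1 ^ p)) * g + lscale x (X 1 ^ p) * (g - lscale y (X 1 ^ q)) \<in> order_ge 1"
        using sub(2) by simp
      moreover have "(f - lscale x (X 1 ^ p)) * g + lscale x (X 1 ^ p) * (g - lscale y (X 1 ^ q))
          = f * g - lscale (x * y) (X 1 ^ (p + q))"
        by (simp add: algebra_simps lscale_times_left lscale_times_right lscale_simps power_add)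
      ultimately show ?thesis by simp
    qed
    define F where "F x = X 2 + lscale x (X 1)" for x :: 'a
    have Fp: "F x \<in> polys" for x unfolding F_def by (rule shift_arg_polys)
    have F1: "F x ^ p - lscale (x ^ p) (X 1 ^ p) \<in> order_ge 1" for x p
    proof (induction p)
      case (Suc p)
      have "F x - lscale x (X 1 ^ 1) \<in> order_ge 1" using X_order_ge[of 2] by (simp add: F_def)
      from cong[OF this Suc polys_power[OF Fp]] show ?case by simp
    qed (simp add: lscale_simps sub)
    have G1: "shift (a i) G - lscale c (X 1 ^ D) \<in> order_ge 1"
    proof -
      have "(\<Prod>k\<in>K. F (a i $ 2 - a k $ 2) ^ m k) - lscale (\<Prod>k\<in>K. (a i $ 2 - a k $ 2) ^ m k) (X 1 ^ (\<Sum>k\<in>K. m k))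
          \<in> order_ge 1" if "finite K" for K
        using that
      proof (induction K)
        case (insert k K)
        from cong[OF F1 insert.IH subst.polys_prod[OF polys_power[OF Fp]]]
        show ?case using insert.hyps by simp
      qed (simp add: lscale_simps sub)
      moreover have "shift (a i) G = (\<Prod>k\<in>J. F (a i $ 2 - a k $ 2) ^ m k)"
        unfolding G_def by (simp add: shift_prod polys_power L shift_power shL F_def)
      ultimately show ?thesis by (simp add: c_def D_def J_def)
    qed
    define R where "R = (X 1 ^ N * (X 2 ^ nat (e $ 2) * X 3 ^ nat (e $ 3)) :: 'a laurent)"
    have R1: "shift (a i) (X 1 ^ N * (u 2 ^ nat (e $ 2) * u 3 ^ nat (e $ 3))) = R"
    proof -
      have "shift (a i) (X 1) = X 1" by (simp add: shift_X a_1 lscale_simps)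
      then show ?thesis
        unfolding R_def by (simp add: shift_mult shift_power polys_mult polys_power u shu)
    qed
    have "R \<in> order_ge (0 + (nat (e $ 2) * 1 + nat (e $ 3) * 1))"
      unfolding R_def
      by (intro order_ge_mult order_ge_power X_order_ge) (simp_all add: order_ge_0 polys_power)
    then have R2: "R \<in> order_ge (nat (e $ 2 + e $ 3))" using e'(1) by (simp add: nat_add_distrib)
    have R3: "X 1 ^ D * R = lmon e"
    proof -
      have "X 1 ^ D * R = X 1 ^ nat (e $ 1) * (X 2 ^ nat (e $ 2) * X 3 ^ nat (e $ 3))"
        
      proof -
        have "D + N = nat (e $ 1)" using N by simp
        then show ?thesis unfolding R_def mult.assoc[symmetric] by (simp only: power_add[symmetric])
      qed
      also have "\<dots> = subst.power_prod X e" by (simp add: subst.power_prod_def prod_3)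
      finally show ?thesis using lmon_prod_X e'(1) by metis
    qed
    have "(shift (a i) G - lscale c (X 1 ^ D)) * R \<in> order_ge (1 + nat (e $ 2 + e $ 3))"
      by (rule order_ge_mult[OF G1 R2])
    moreover have "(shift (a i) G - lscale c (X 1 ^ D)) * R = shift (a i) h - lscale c (lmon e)"
      by (simp add: h_def shift_mult Gp Rp R1 left_diff_distrib lscale_times_left R3)
    ultimately show ?thesis by (simp add: add.commute)
  qed
  show thesis by (rule that[OF 1 2 3 4])
qed

text \<open>Downward induction on the order \<open>e $ 2 + e $ 3\<close>: the form of the previous lemma has the wanted leading
  coefficient, and its other coefficients have higher order at the same point.\<close>
lemma taylor_onto:
  assumes d: "(\<Sum>i\<in>{1..n}. m i) \<le> d"
  shows "taylor ` (polys \<inter> homog (int d)) = {t. keys t \<subseteq> taylor_exps d}"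
proof
  let ?S = "taylor ` (polys \<inter> homog (int d) :: 'a laurent set)"
  have PH: "is_subspace lscale (polys \<inter> homog (int d) :: 'a laurent set)"
    by (rule is_subspace_Int[OF _ is_subspace_homog]) (simp add: is_subspace_def polys_add polys_lscale)
  have S: "is_subspace lscale ?S"
  proof (rule is_subspaceI)
    show "0 \<in> ?S" using taylor_kernel[of 0] is_subspaceD(1)[OF PH] poly_idealD(2)[OF fat_ideal_poly_ideal]
      by (metis imageI polys_0)
    show "x + y \<in> ?S" if "x \<in> ?S" "y \<in> ?S" for x y
      using that is_subspaceD(2)[OF PH] by (elim imageE) (simp only: taylor_add[symmetric] imageI)
    show "lscale c x \<in> ?S" if "x \<in> ?S" for c x
      using that is_subspaceD(3)[OF PH] by (elim imageE) (simp only: taylor_lscale[symmetric] imageI)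
  qed
  have expand: "t \<in> ?S" if "\<And>i e. (i, e) \<in> keys t \<Longrightarrow> single (i, e) 1 \<in> ?S" for t
  proof -
    have "t = (\<Sum>k\<in>keys t. lscale (lookup t k) (single k 1))"
      by (rule poly_mapping_eqI) (simp add: lookup_sum lookup_single when_def in_keys_iff if_distrib sum.delta cong: if_cong)
    also have "\<dots> \<in> ?S"
      by (rule is_subspace_sum[OF S], rule is_subspaceD(3)[OF S]) (use that in force)
    finally show ?thesis .
  qed
  have single: "single (i, e) 1 \<in> ?S" if i: "i \<in> {1..n}" and e: "e \<in> low_exps d (m i)" for i e
    using e
  proof (induction "nat (int (m i) - e $ 2 - e $ 3)" arbitrary: e rule: less_induct)
    case less
    obtain h c where h: "h \<in> polys \<inter> homog (int d)" "c \<noteq> 0"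
      "\<And>k. k \<in> {1..n} \<Longrightarrow> k \<noteq> i \<Longrightarrow> shift (a k) h \<in> order_ge (m k)"
      "shift (a i) h - lscale c (lmon e) \<in> order_ge (nat (e $ 2 + e $ 3) + 1)"
      using taylor_witness[OF i less.prems d] by blast
    define r where "r = taylor h - lscale c (single (i, e) 1)"
    have e: "0 \<le> e $ 2" "0 \<le> e $ 3" "e $ 2 + e $ 3 < int (m i)" using less.prems by (auto simp: low_exps_def)
    have "single (k, e') 1 \<in> ?S" if ke: "(k, e') \<in> keys r" for k e'
    proof -
      have "k = i \<and> e' \<in> keys (shift (a i) h - lscale c (lmon e)) \<and> e' $ 2 + e' $ 3 < int (m i)"
      proof (cases "k = i")
        case True
        then show ?thesis using ke i e
          by (auto simp: r_def in_keys_iff lookup_minus lookup_taylor lookup_single when_def lookup_lmon split: if_splits)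
      next
        case False
        then have "lookup (taylor h) (k, e') \<noteq> 0"
          using ke by (auto simp: r_def in_keys_iff lookup_minus lookup_single when_def)
        then have "k \<in> {1..n}" "e' $ 2 + e' $ 3 < int (m k)" "e' \<in> keys (shift (a k) h)"
          by (auto simp: lookup_taylor in_keys_iff split: if_splits)
        then show ?thesis using h(3)[of k] False by (force simp: order_ge_def)
      qed
      then have k: "k = i" "e' \<in> keys (shift (a i) h - lscale c (lmon e))" "e' $ 2 + e' $ 3 < int (m i)"
        by auto
      have "e $ 2 + e $ 3 < e' $ 2 + e' $ 3" using h(4) k(2) e by (auto simp: order_ge_def)
      moreover have "e' \<in> low_exps d (m i)"
      proof -
        have "shift (a i) h \<in> homog (int d)" using h(1) by (simp add: shift_homog)
        moreover have "lscale c (lmon e) \<in> homog (int d)"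
          using less.prems lmon_homog[of e] is_subspaceD(3)[OF is_subspace_homog] by (auto simp: low_exps_def)
        ultimately have "shift (a i) h - lscale c (lmon e) \<in> homog (int d)"
          by (rule is_subspace_diff[OF vector_space_lscale is_subspace_homog])
        then show ?thesis using k h(4) by (auto simp: low_exps_def homog_iff order_ge_def polys_def)
      qed
      ultimately show ?thesis using less.hyps[of e'] k e by auto
    qed
    then have "r \<in> ?S" by (rule expand)
    then have "taylor h - r \<in> ?S" using h(1) by (intro is_subspace_diff[OF vector_space_lscale S] imageI)
    then have "lscale (inverse c) (taylor h - r) \<in> ?S" by (rule is_subspaceD(3)[OF S])
    then show ?case using h(2) by (simp add: r_def lscale_simps)
  qed
  show "{t. keys t \<subseteq> taylor_exps d} \<subseteq> ?S"
  proof
    fix t :: "(nat \<times> (int ^ 3)) \<Rightarrow>\<^sub>0 'a" assume "t \<in> {t. keys t \<subseteq> taylor_exps d}"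
    then have t: "keys t \<subseteq> taylor_exps d" by simp
    have "single (i, e) 1 \<in> ?S" if "(i, e) \<in> keys t" for i e
    proof (rule single)
      show "i \<in> {1..n}" "e \<in> low_exps d (m i)" using t that by (auto simp: taylor_exps_def)
    qed
    then show "t \<in> ?S" by (rule expand)
  qed
  show "?S \<subseteq> {t. keys t \<subseteq> taylor_exps d}" using taylor_keys by auto
qed

lemma card_taylor_exps:
  assumes "(\<Sum>i\<in>{1..n}. m i) \<le> d"
  shows "finite (taylor_exps d)" "card (taylor_exps d) = fat_length n m"
proof -
  have m: "m i \<le> d + 1" if "i \<in> {1..n}" for i
    using member_le_sum[OF that, of m] assms by simp
  show "finite (taylor_exps d)"
    unfolding taylor_exps_def by (intro finite_SigmaI finite_low_exps m) auto
  have "card (taylor_exps d) = (\<Sum>i\<in>{1..n}. card (low_exps d (m i)))"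
    unfolding taylor_exps_def by (rule card_SigmaI) (auto intro!: finite_low_exps m simp del: One_nat_def)
  also have "\<dots> = fat_length n m"
    unfolding fat_length_def by (intro sum.cong refl card_low_exps m)
  finally show "card (taylor_exps d) = fat_length n m" .
qed

theorem point_scheme_fat_ideal: "point_scheme (fat_ideal n m P) (fat_length n m)"
proof
  let ?Z = "fat_ideal n m P"
  show "poly_ideal ?Z" by (rule fat_ideal_poly_ideal)
  show "f \<in> ?Z" if "f \<in> polys" "X j * f \<in> ?Z" for f j using fat_ideal_X_cancel that .
  have "\<exists>w. has_dim (vs_of lscale (?Z \<inter> homog (int d))) w \<and> (d + 2) choose 2 = fat_length n m + w"
    if d: "(\<Sum>i\<in>{1..n}. m i) \<le> d" for d
  proof -
    let ?A = "polys \<inter> homog (int d) :: 'a laurent set" and ?B = "{t :: _ \<Rightarrow>\<^sub>0 'a. keys t \<subseteq> taylor_exps d}"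
    have PH: "is_subspace lscale ?A"
      by (rule is_subspace_Int[OF _ is_subspace_homog]) (simp add: is_subspace_def polys_add polys_lscale)
    have lin: "linear_map field_ring (vs_of lscale ?A) (vs_of lscale ?B) taylor"
      by (rule linear_mapI[OF vectorspace_vs_of[OF vector_space_lscale PH]
          vectorspace_vs_of[OF vector_space_lscale is_subspace_keys]])
        (use taylor_keys in \<open>auto simp: taylor_add taylor_lscale\<close>)
    have B: "has_dim (vs_of lscale ?B) (fat_length n m)"
      using has_dim_keys[OF card_taylor_exps(1)[OF d]] card_taylor_exps(2)[OF d] by simp
    have Z: "is_subspace lscale (?Z \<inter> homog (int d))"
      using poly_idealD[OF fat_ideal_poly_ideal] poly_ideal_lscale[OF fat_ideal_poly_ideal]
      by (intro is_subspace_Int is_subspace_homog) (auto simp: is_subspace_def)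
    have sub: "?Z \<inter> homog (int d) \<subseteq> ?A" using poly_idealD(1)[OF fat_ideal_poly_ideal] by auto
    obtain w where w: "has_dim (vs_of lscale (?Z \<inter> homog (int d))) w"
      using has_dim_subspace[OF vector_space_lscale PH Z sub has_dim_forms] by auto
    have "?Z \<inter> homog (int d) = {f \<in> ?A. taylor f = \<zero>\<^bsub>vs_of lscale ?B\<^esub>}"
      using sub taylor_kernel by auto
    from rank_nullity_surj[OF lin _ has_dim_forms B w this] taylor_onto[OF d] w
    show ?thesis by auto
  qed
  then show "\<exists>d0. \<forall>d\<ge>d0. \<exists>w. has_dim (vs_of lscale (?Z \<inter> homog (int d))) w \<and> (d + 2) choose 2 = fat_length n m + w"
    by blast
qed

end


section \<open>Sheaves supported off the coordinate lines\<close>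

text \<open>The sections of \<open>F/G\<close> are counted on any finite-dimensional space \<open>V\<close> of representatives.\<close>
lemma (in cech_supported) has_dim_H0_quot:
  assumes V: "has_dim (vs_of sc' V) v" and g: "linear_map field_ring (vs_of sc' V) (vs_of sc (F UNIV)) g"
    and dense: "\<And>x. x \<in> F UNIV \<Longrightarrow> \<exists>h\<in>V. x - g h \<in> G UNIV"
    and W: "has_dim (vs_of sc' {h \<in> V. g h \<in> G UNIV}) w" and v: "v = l + w"
  shows "has_dim (H0_quot sc F G) l"
proof -
  have gF: "g h \<in> F UNIV" if "h \<in> V" for h using linear_map_vs_ofD(1)[OF g that] by simp
  have lin: "linear_map field_ring (vs_of sc' V) (H0_quot sc F G) (\<lambda>h. local_lifts (g h))"
    by (rule linear_map_compose[OF g linear_local_lifts])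
  note l = linear_map_vs_ofD[OF linear_local_lifts]
  interpret B: vectorspace field_ring "H0_quot sc F G" using linear_qcl by (simp add: linear_map_def)
  have onto: "(\<lambda>h. local_lifts (g h)) ` V = carrier (H0_quot sc F G)"
  proof
    show "(\<lambda>h. local_lifts (g h)) ` V \<subseteq> carrier (H0_quot sc F G)" using l(1) gF by auto
    show "carrier (H0_quot sc F G) \<subseteq> (\<lambda>h. local_lifts (g h)) ` V"
      unfolding local_lifts_onto[symmetric]
    proof (rule image_subsetI)
      fix x assume x: "x \<in> F UNIV"
      then obtain h where h: "h \<in> V" "x - g h \<in> G UNIV" using dense by blast
      have d: "x - g h \<in> F UNIV" using h(2) GF by blast
      have "local_lifts x = local_lifts (x - g h) \<oplus>\<^bsub>H0_quot sc F G\<^esub> local_lifts (g h)"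
        using l(2)[OF d gF[OF h(1)]] by simp
      also have "local_lifts (x - g h) = \<zero>\<^bsub>H0_quot sc F G\<^esub>"
        using local_lifts_ker[OF d] h(2) by simp
      also have "\<zero>\<^bsub>H0_quot sc F G\<^esub> \<oplus>\<^bsub>H0_quot sc F G\<^esub> local_lifts (g h) = local_lifts (g h)"
        by (rule B.M.l_zero) (rule l(1)[OF gF[OF h(1)]])
      finally show "local_lifts x \<in> (\<lambda>h. local_lifts (g h)) ` V" using h(1) by blast
    qed
  qed
  obtain b where b: "has_dim (H0_quot sc F G) b" using has_dim_surj[OF lin _ V] onto by auto
  have "v = b + w"
  proof (rule rank_nullity_surj[OF lin onto V b W])
    show "{h \<in> V. g h \<in> G UNIV} = {h \<in> V. local_lifts (g h) = \<zero>\<^bsub>H0_quot sc F G\<^esub>}"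
      using local_lifts_ker[OF gF] by blast
  qed
  then show ?thesis using b v by simp
qed

text \<open>By rank and nullity the image has the dimension of the target.\<close>
lemma linear_onto_if_dim:
  assumes f: "linear_map field_ring (vs_of sc V) B f" and V: "has_dim (vs_of sc V) v" and B: "has_dim B b"
    and W: "has_dim (vs_of sc {x \<in> V. f x = \<zero>\<^bsub>B\<^esub>}) w" and eq: "v = b + w"
  shows "f ` V = carrier B"
proof -
  interpret B: vectorspace field_ring B using B by (simp add: has_dim_def)
  interpret f: linear_map field_ring "vs_of sc V" B f by fact
  let ?I = "B.vs (f ` V)"
  have im: "f.imT = f ` V" by (simp add: f.im_def)
  have sub: "submodule field_ring (f ` V) B" using f.im_is_submodule im by simp
  have vsI: "vectorspace field_ring ?I"
    using B.subspace_is_vs[of "f ` V"] sub B.vectorspace_axioms by (simp add: subspace_def)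
  interpret I: vectorspace field_ring ?I by (rule vsI)
  have lin: "linear_map field_ring (vs_of sc V) ?I f"
    by (rule linear_mapI[OF f.V.vectorspace_axioms vsI]) (use linear_map_vs_ofD[OF f] in auto)
  obtain i where i: "has_dim ?I i" using has_dim_surj[OF lin _ V] by auto
  have "v = i + w" by (rule rank_nullity_surj[OF lin _ V i W]) auto
  then have ib: "i = b" using eq by simp
  obtain S where S: "finite S" "I.basis S" using I.finite_basis_exists i by (auto simp: has_dim_def)
  have card: "card S = b" using I.dim_basis[OF S] i ib by (simp add: has_dim_def)
  have SI: "S \<subseteq> f ` V" "I.lin_indpt S" using S(2) by (auto simp: I.basis_def)
  have Sc: "S \<subseteq> carrier B" using SI(1) linear_map_vs_ofD(1)[OF f] by auto
  have "B.lin_indpt S" using B.span_li_not_depend(2)[OF SI(1) sub] SI(2) by simp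
  then have "B.basis S"
    using B.dim_li_is_basis[OF _ S(1) Sc] B card by (simp add: has_dim_def)
  then have "B.span S = carrier B" by (simp add: B.basis_def)
  moreover have "B.span S \<subseteq> f ` V" by (rule B.span_is_subset[OF SI(1) sub])
  moreover have "f ` V \<subseteq> carrier B" using linear_map_vs_ofD(1)[OF f] by auto
  ultimately show ?thesis by auto
qed

context point_scheme
begin

lemma is_subspace_forms: "is_subspace lscale (polys \<inter> homog d :: 'a laurent set)"
  by (rule is_subspace_Int[OF _ is_subspace_homog]) (simp add: is_subspace_def polys_add polys_lscale)

lemma is_subspace_Z: "is_subspace lscale Z"
  using poly_idealD[OF ideal] poly_ideal_lscale[OF ideal] by (simp add: is_subspace_def)

lemma is_subspace_Z_forms: "is_subspace lscale (Z \<inter> homog d)"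
  by (rule is_subspace_Int[OF is_subspace_Z is_subspace_homog])

lemma Z_polys: "f \<in> Z \<Longrightarrow> f \<in> polys" by (rule poly_idealD(1)[OF ideal])

text \<open>In the stable range, multiplication by \<open>x_j\<close> is an isomorphism of the graded pieces of the
  coordinate ring of the scheme: it is injective, and both have dimension \<open>l\<close>.\<close>
lemma X_surjective:
  assumes d: "\<forall>d\<ge>d0. \<exists>w. has_dim (vs_of lscale (Z \<inter> homog (int d))) w \<and> (d + 2) choose 2 = l + w"
    and "d0 \<le> d" and f: "f \<in> polys \<inter> homog (int d + 1)"
  shows "\<exists>g\<in>polys \<inter> homog (int d). f - X j * g \<in> Z"
proof -
  let ?A = "\<lambda>d. polys \<inter> homog d :: 'a laurent set" and ?Z = "\<lambda>d. Z \<inter> homog d"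
  obtain w where w: "has_dim (vs_of lscale (?Z (int d))) w" "(d + 2) choose 2 = l + w"
    using d assms(2) by blast
  obtain w' where w': "has_dim (vs_of lscale (?Z (int (Suc d)))) w'" "(Suc d + 2) choose 2 = l + w'"
    using d assms(2) le_SucI by blast
  have sub: "?Z (int (Suc d)) \<subseteq> ?A (int (Suc d))" using Z_polys by auto
  interpret Q: quotient_space "vs_of lscale (?A (int (Suc d)))" "?Z (int (Suc d))"
    by (rule quotient_spaceI[OF vector_space_lscale is_subspace_forms is_subspace_Z_forms sub])
  let ?Q = "quot (vs_of lscale (?A (int (Suc d)))) (?Z (int (Suc d)))"
  obtain b where b: "has_dim ?Q b"
    using has_dim_surj[OF Q.linear_cl _ has_dim_forms] Q.carrier_quot by auto
  have zero: "\<zero>\<^bsub>?Q\<^esub> = ?Z (int (Suc d))" by (rule Q.quot_ops)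
  have ker: "?Z (int (Suc d)) = {x \<in> ?A (int (Suc d)). Q.cl x = \<zero>\<^bsub>?Q\<^esub>}"
    unfolding zero using Q.cl_eq_W_iff sub by auto
  have "(Suc d + 2) choose 2 = b + w'"
    by (rule rank_nullity_surj[OF Q.linear_cl _ has_dim_forms b w'(1) ker]) (simp only: Q.carrier_quot vs_of_simps(1))
  then have bl: "b = l" using w'(2) by simp
  have Xh: "X j * g \<in> ?A (int (Suc d))" if "g \<in> ?A (int d)" for g
    using that homog_mult[OF homog_X, of g "int d" j] by (simp add: polys_mult add.commute)
  have mult: "linear_map field_ring (vs_of lscale (?A (int d))) (vs_of lscale (?A (int (Suc d)))) (\<lambda>g. X j * g)"
    by (rule linear_mapI[OF vectorspace_vs_of[OF vector_space_lscale is_subspace_forms]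
          vectorspace_vs_of[OF vector_space_lscale is_subspace_forms]])
      (use Xh in \<open>simp_all add: distrib_left lscale_times_right\<close>)
  have lin: "linear_map field_ring (vs_of lscale (?A (int d))) ?Q (\<lambda>g. Q.cl (X j * g))"
    by (rule linear_map_compose[OF mult Q.linear_cl])
  have "X j * g \<in> ?Z (int (Suc d)) \<longleftrightarrow> g \<in> ?Z (int d)" if g: "g \<in> ?A (int d)" for g
    using g Xh[OF g] X_cancel poly_idealD(4)[OF ideal polys_X] by auto
  then have "{g \<in> ?A (int d). Q.cl (X j * g) = \<zero>\<^bsub>?Q\<^esub>} = ?Z (int d)"
    unfolding zero using Q.cl_eq_W_iff Xh Z_polys by auto
  with w(1) have k: "has_dim (vs_of lscale {g \<in> ?A (int d). Q.cl (X j * g) = \<zero>\<^bsub>?Q\<^esub>}) w" by simp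
  have "(\<lambda>g. Q.cl (X j * g)) ` ?A (int d) = carrier ?Q"
    by (rule linear_onto_if_dim[OF lin has_dim_forms b k]) (simp only: bl w(2))
  moreover have fA: "f \<in> ?A (int (Suc d))" using f by (simp add: add.commute)
  then have "Q.cl f \<in> carrier ?Q" unfolding Q.carrier_quot by simp
  ultimately obtain g where g: "g \<in> ?A (int d)" "Q.cl f = Q.cl (X j * g)" by (metis (no_types, lifting) imageE)
  have "f \<in> Q.cl (X j * g)" using g(2) Q.a_rcos_self fA by (metis vs_of_simps(1))
  then have "\<exists>z\<in>?Z (int (Suc d)). f = z + X j * g" by (auto simp: a_r_coset_def r_coset_def)
  then have "f - X j * g \<in> Z" by auto
  then show ?thesis using g(1) by blast
qed

lemma lmon_supp_UNIV: "lmon (supp_exp N UNIV) = X 1 ^ N * (X 2 ^ N * (X 3 ^ N :: 'b::field laurent))"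
  unfolding prod_X_power[symmetric] by (simp add: prod_3 power_mult_distrib)

lemma X_power_cancel: "f \<in> polys \<Longrightarrow> X j ^ N * f \<in> Z \<Longrightarrow> f \<in> Z"
proof (induction N)
  case (Suc N)
  have "X j * (X j ^ N * f) \<in> Z" using Suc.prems(2) by (simp add: mult.assoc)
  then have "X j ^ N * f \<in> Z"
    by (rule X_cancel[rotated]) (rule polys_mult[OF polys_power[OF polys_X] Suc.prems(1)])
  then show ?case by (rule Suc.IH[OF Suc.prems(1)])
qed simp

lemma supp_cancel: assumes f: "f \<in> polys" shows "lmon (supp_exp N UNIV) * f \<in> Z \<longleftrightarrow> f \<in> Z"
proof
  note p = polys_power[OF polys_X, of _ N]
  assume "lmon (supp_exp N UNIV) * f \<in> Z"
  then have "X 1 ^ N * (X 2 ^ N * (X 3 ^ N * f)) \<in> Z" unfolding lmon_supp_UNIV mult.assoc .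
  from X_power_cancel[OF polys_mult[OF p polys_mult[OF p f]] this]
  have "X 2 ^ N * (X 3 ^ N * f) \<in> Z" .
  from X_power_cancel[OF polys_mult[OF p f] this] have "X 3 ^ N * f \<in> Z" .
  from X_power_cancel[OF f this] show "f \<in> Z" .
qed (rule poly_idealD(4)[OF ideal lmon_polys[OF supp_exp_nonneg]])

text \<open>Divide by one variable at a time.\<close>
lemma stable_degree:
  obtains d0 where "\<And>d. d0 \<le> d \<Longrightarrow> \<exists>w. has_dim (vs_of lscale (Z \<inter> homog (int d))) w \<and> (d + 2) choose 2 = l + w"
    and "\<And>d N f. d0 \<le> d \<Longrightarrow> f \<in> polys \<inter> homog (int (d + 3 * N)) \<Longrightarrow>
      \<exists>g\<in>polys \<inter> homog (int d). f - lmon (supp_exp N UNIV) * g \<in> Z"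
proof -
  obtain d0 where d0: "\<forall>d\<ge>d0. \<exists>w. has_dim (vs_of lscale (Z \<inter> homog (int d))) w \<and> (d + 2) choose 2 = l + w"
    using codim by blast
  have pow: "\<exists>g\<in>polys \<inter> homog (int d). f - X j ^ N * g \<in> Z"
    if "d0 \<le> d" "f \<in> polys \<inter> homog (int (d + N))" for d N f j
    using that
  proof (induction N arbitrary: f)
    case 0
    then show ?case using poly_idealD(2)[OF ideal] by (intro bexI[of _ f]) auto
  next
    case (Suc N)
    have "f \<in> polys \<inter> homog (int (d + N) + 1)" using Suc.prems(2) by (simp add: algebra_simps)
    then obtain g where g: "g \<in> polys \<inter> homog (int (d + N))" "f - X j * g \<in> Z"
      using X_surjective[OF d0, of "d + N" f j] Suc.prems(1) by auto
    obtain h where h: "h \<in> polys \<inter> homog (int d)" "g - X j ^ N * h \<in> Z"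
      using Suc.IH[OF Suc.prems(1) g(1)] by blast
    have "(f - X j * g) + X j * (g - X j ^ N * h) \<in> Z"
      by (intro poly_idealD(3)[OF ideal] poly_idealD(4)[OF ideal] g h polys_X)
    then show ?case using h(1) by (intro bexI[of _ h]) (auto simp: algebra_simps)
  qed
  show thesis
  proof (rule that)
    show "\<exists>w. has_dim (vs_of lscale (Z \<inter> homog (int d))) w \<and> (d + 2) choose 2 = l + w" if "d0 \<le> d" for d
      using d0 that by blast
    fix d N and f :: "'a laurent" assume d: "d0 \<le> d" and f: "f \<in> polys \<inter> homog (int (d + 3 * N))"
    have "f \<in> polys \<inter> homog (int ((d + N + N) + N))" using f by (simp add: algebra_simps)
    then obtain g1 where g1: "g1 \<in> polys \<inter> homog (int ((d + N) + N))" "f - X 1 ^ N * g1 \<in> Z"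
      using pow[of "d + N + N" f N 1] d by auto
    obtain g2 where g2: "g2 \<in> polys \<inter> homog (int (d + N))" "g1 - X 2 ^ N * g2 \<in> Z"
      using pow[of "d + N" g1 N 2] d g1(1) by auto
    obtain g3 where g3: "g3 \<in> polys \<inter> homog (int d)" "g2 - X 3 ^ N * g3 \<in> Z"
      using pow[of d g2 N 3] d g2(1) by auto
    have "(f - X 1 ^ N * g1) + X 1 ^ N * ((g1 - X 2 ^ N * g2) + X 2 ^ N * (g2 - X 3 ^ N * g3)) \<in> Z"
      by (intro poly_idealD(3)[OF ideal] poly_idealD(4)[OF ideal] g1 g2 g3 polys_X polys_power)
    then show "\<exists>g\<in>polys \<inter> homog (int d). f - lmon (supp_exp N UNIV) * g \<in> Z"
      using g3(1) unfolding lmon_supp_UNIV by (intro bexI[of _ g3]) (auto simp: algebra_simps)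
  qed
qed

lemma shf_Z_UNIV:
  assumes "lmon (supp_exp N UNIV) * f \<in> polys" "f \<in> shf Z d UNIV"
  shows "lmon (supp_exp N UNIV) * f \<in> Z"
proof -
  obtain M where "lmon (supp_exp M UNIV) * f \<in> Z" using assms(2) by (auto simp: shf_iff)
  then have "lmon (supp_exp N UNIV) * (lmon (supp_exp M UNIV) * f) \<in> Z"
    by (rule poly_idealD(4)[OF ideal lmon_polys[OF supp_exp_nonneg]])
  then have "lmon (supp_exp M UNIV) * (lmon (supp_exp N UNIV) * f) \<in> Z" by (simp add: mult_ac)
  then show ?thesis by (simp only: supp_cancel[OF assms(1)])
qed

text \<open>A section over the intersection of the charts becomes a form after multiplication by a power of
  \<open>x_1 x_2 x_3\<close>.  Multiplied by a further power of \<open>x_i\<close>, it can be divided by that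
  power of \<open>x_1 x_2 x_3\<close> modulo the ideal, which leaves a denominator in \<open>x_i\<close> only.\<close>
sublocale O: cech_supported lscale "shf polys d :: _ \<Rightarrow> 'a laurent set" "shf Z d" for d
proof (intro cech_supported.intro cech_pair.intro cech_supported_axioms.intro)
  show "is_subspace lscale (shf polys d S :: 'a laurent set)" "is_subspace lscale (shf Z d S)" for S
    by (intro is_subspace_shf ideal poly_ideal_polys)+
  show "shf Z d S \<subseteq> shf polys d S" for S by (rule shf_subset_polys[OF ideal])
  show "S \<subseteq> T \<Longrightarrow> shf polys d S \<subseteq> (shf polys d T :: 'a laurent set)" "S \<subseteq> T \<Longrightarrow> shf Z d S \<subseteq> shf Z d T" for S T
    by (rule shf_mono, rule poly_ideal_polys ideal, assumption)+
  show "shf polys d S \<inter> shf Z d UNIV \<subseteq> shf Z d S" for S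
  proof clarify
    fix f assume f: "f \<in> shf polys d S" "f \<in> shf Z d UNIV"
    obtain M where M: "lmon (supp_exp M S) * f \<in> polys" using f(1) by (auto simp: shf_iff)
    obtain N where "lmon (supp_exp N UNIV) * f \<in> Z" using f(2) by (auto simp: shf_iff)
    then have "lmon (supp_exp M S) * (lmon (supp_exp N UNIV) * f) \<in> Z"
      by (rule poly_idealD(4)[OF ideal lmon_polys[OF supp_exp_nonneg]])
    then have "lmon (supp_exp N UNIV) * (lmon (supp_exp M S) * f) \<in> Z" by (simp add: mult_ac)
    then have "lmon (supp_exp M S) * f \<in> Z" by (simp only: supp_cancel[OF M])
    then show "f \<in> shf Z d S" using f(1) by (auto simp: shf_iff)
  qed
  fix x :: "'a laurent" and i assume x: "x \<in> shf polys d UNIV"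
  obtain d0 where d0: "\<And>e N f. d0 \<le> e \<Longrightarrow> f \<in> polys \<inter> homog (int (e + 3 * N)) \<Longrightarrow>
      \<exists>g\<in>polys \<inter> homog (int e). f - lmon (supp_exp N UNIV) * g \<in> Z"
    using stable_degree by (metis (no_types, lifting))
  obtain N0 where N0: "lmon (supp_exp N0 UNIV) * x \<in> polys" using x by (auto simp: shf_iff)
  \<comment> \<open>the second term makes \<open>d + 3 N\<close> a degree in the stable range\<close>
  define N where "N = max N0 (d0 + nat \<bar>d\<bar>)"
  define e where "e = nat (d + 3 * int N)"
  have "int d0 + \<bar>d\<bar> \<le> int N" by (simp add: N_def)
  then have e: "int e = d + 3 * int N" "d0 \<le> e" unfolding e_def by linarith+
  let ?m = "lmon (supp_exp N UNIV) :: 'a laurent" and ?p = "lmon (axis i (3 * int N)) :: 'a laurent"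
  have "?m * x \<in> polys" using shf_denominator[OF poly_ideal_polys N0, of N UNIV] by (simp add: N_def)
  moreover have "?m * x \<in> homog (int e)"
    using homog_mult[OF lmon_homog[of "supp_exp N UNIV"], of x d] x by (simp add: shf_iff deg_supp_exp e add.commute mult.commute)
  moreover have p: "?p \<in> polys" "?p \<in> homog (3 * int N)"
    using lmon_homog[of "axis i (3 * int N)"] by (auto intro!: lmon_polys simp: axis_nth_if)
  ultimately have "?p * (?m * x) \<in> polys \<inter> homog (int (e + 3 * N))"
    using homog_mult[OF p(2), of "?m * x" "int e"] by (simp add: polys_mult add.commute)
  then obtain g where g: "g \<in> polys \<inter> homog (int e)" "?p * (?m * x) - ?m * g \<in> Z" using d0[OF e(2)] by blast
  define y where "y = lmon (- axis i (3 * int N)) * g"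
  have y: "y \<in> shf polys d {i}"
  proof -
    have "y \<in> homog d" using homog_mult[OF lmon_homog[of "- axis i (3 * int N)"], of g "int e"] g(1) e(1)
      by (simp add: y_def deg_uminus)
    moreover have "lmon (supp_exp (3 * N) {i}) * y = g"
    proof -
      have "supp_exp (3 * N) {i} = axis i (3 * int N)" by (simp add: supp_exp_def vec_eq_iff axis_nth_if)
      then show ?thesis by (simp add: y_def)
    qed
    ultimately show ?thesis using g(1) unfolding shf_iff by (metis IntD1)
  qed
  have "x - y \<in> shf Z d UNIV"
  proof -
    \<comment> \<open>\<open>(x_1 x_2 x_3)^(4 N)\<close> is a multiple of \<open>x_i^(3 N) (x_1 x_2 x_3)^N\<close>\<close>
    have "supp_exp (4 * N) UNIV = (supp_exp (3 * N) UNIV - axis i (3 * int N)) + (axis i (3 * int N) + supp_exp N UNIV)"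
      by (simp add: supp_exp_def vec_eq_iff)
    then have "lmon (supp_exp (4 * N) UNIV) =
        (lmon (supp_exp (3 * N) UNIV - axis i (3 * int N)) * (?p * ?m) :: 'a laurent)"
      by (simp only: lmon_add)
    then have "lmon (supp_exp (4 * N) UNIV) * (x - y) =
      lmon (supp_exp (3 * N) UNIV - axis i (3 * int N)) * (?p * (?m * x) - ?m * (?p * y))"
      by (simp only: right_diff_distrib left_diff_distrib mult_ac)
    moreover have "?p * y = g" by (simp add: y_def)
    ultimately have "lmon (supp_exp (4 * N) UNIV) * (x - y) \<in> Z"
      using poly_idealD(4)[OF ideal lmon_polys g(2), of "supp_exp (3 * N) UNIV - axis i (3 * int N)"]
      by (simp add: supp_exp_def axis_nth_if)
    moreover have "x - y \<in> homog d"
      using x y is_subspace_diff[OF vector_space_lscale is_subspace_homog] by (auto simp: shf_iff)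
    ultimately show ?thesis by (auto simp: shf_iff)
  qed
  then show "\<exists>y\<in>shf polys d {i}. x - y \<in> shf Z d UNIV" using y by blast
qed (rule vector_space_lscale)

text \<open>Cleared of denominators, a section becomes a form of large degree.  In the stable range the surplus
  power of \<open>x_1 x_2 x_3\<close> divides it modulo the ideal, so that one degree and one denominator serve for
  all sections.\<close>
lemma representatives:
  obtains e N where
    "\<exists>w. has_dim (vs_of lscale (Z \<inter> homog (int e))) w \<and> (e + 2) choose 2 = l + w"
    "\<And>h. h \<in> polys \<inter> homog (int e) \<Longrightarrow> lmon (- supp_exp N UNIV) * h \<in> (shf polys (int k) UNIV :: 'a laurent set)"
    "\<And>x. x \<in> shf polys (int k) UNIV \<Longrightarrow> \<exists>h\<in>polys \<inter> homog (int e). x - lmon (- supp_exp N UNIV) * h \<in> shf Z (int k) UNIV"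
    "\<And>h. h \<in> polys \<inter> homog (int e) \<Longrightarrow> lmon (- supp_exp N UNIV) * h \<in> shf Z (int k) UNIV \<longleftrightarrow> h \<in> Z"
proof -
  obtain d0 where d0: "\<And>d. d0 \<le> d \<Longrightarrow> \<exists>w. has_dim (vs_of lscale (Z \<inter> homog (int d))) w \<and> (d + 2) choose 2 = l + w"
    and div: "\<And>e N f. d0 \<le> e \<Longrightarrow> f \<in> polys \<inter> homog (int (e + 3 * N)) \<Longrightarrow>
      \<exists>g\<in>polys \<inter> homog (int e). f - lmon (supp_exp N UNIV) * g \<in> Z"
    using stable_degree by blast
  define e where "e = k + 3 * d0"
  let ?m = "\<lambda>N. lmon (supp_exp N UNIV) :: 'a laurent" and ?i = "lmon (- supp_exp d0 UNIV) :: 'a laurent"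
  have e: "d0 \<le> e" by (simp add: e_def)
  have hom: "?i * h \<in> homog (int k)" if "h \<in> polys \<inter> homog (int e)" for h
    using homog_mult[OF lmon_homog[of "- supp_exp d0 UNIV"], of h "int e"] that
    by (simp add: deg_uminus deg_supp_exp e_def)
  have in_F: "?i * h \<in> (shf polys (int k) UNIV :: 'a laurent set)" if "h \<in> polys \<inter> homog (int e)" for h
    using hom[OF that] that unfolding shf_iff by (intro conjI exI[of _ d0]) simp_all
  show thesis
  proof (rule that[of e d0])
    show "\<exists>w. has_dim (vs_of lscale (Z \<inter> homog (int e))) w \<and> (e + 2) choose 2 = l + w" by (rule d0[OF e])
    show "?i * h \<in> (shf polys (int k) UNIV :: 'a laurent set)" if "h \<in> polys \<inter> homog (int e)" for h by (rule in_F[OF that])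
    fix x :: "'a laurent" assume x: "x \<in> shf polys (int k) UNIV"
    obtain N0 where N0: "?m N0 * x \<in> polys" using x by (auto simp: shf_iff)
    define N where "N = max N0 d0"
    have mx: "?m N * x \<in> polys" using shf_denominator[OF poly_ideal_polys N0, of N UNIV] by (simp add: N_def)
    have "?m N * x \<in> homog (int N * 3 + int k)"
      using homog_mult[OF lmon_homog[of "supp_exp N UNIV"], of x "int k"] x by (simp add: shf_iff deg_supp_exp)
    moreover have "int N * 3 + int k = int (e + 3 * (N - d0))" by (simp add: e_def N_def of_nat_diff)
    ultimately obtain h where h: "h \<in> polys \<inter> homog (int e)" "?m N * x - ?m (N - d0) * h \<in> Z"
      using div[OF e, of "?m N * x" "N - d0"] mx by auto
    have "supp_exp N UNIV + - supp_exp d0 UNIV = supp_exp (N - d0) UNIV"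
      by (simp add: supp_exp_def vec_eq_iff N_def of_nat_diff)
    then have "?m N * (x - ?i * h) = ?m N * x - ?m (N - d0) * h"
      by (simp add: right_diff_distrib flip: mult.assoc lmon_add)
    then have "?m N * (x - ?i * h) \<in> Z" using h(2) by simp
    moreover have "x - ?i * h \<in> homog (int k)"
      using x hom[OF h(1)] is_subspace_diff[OF vector_space_lscale is_subspace_homog] by (auto simp: shf_iff)
    ultimately show "\<exists>h\<in>polys \<inter> homog (int e). x - ?i * h \<in> shf Z (int k) UNIV"
      using h(1) by (auto simp: shf_iff)
  next
    fix h :: "'a laurent" assume h: "h \<in> polys \<inter> homog (int e)"
    show "?i * h \<in> shf Z (int k) UNIV \<longleftrightarrow> h \<in> Z"
    proof
      assume "?i * h \<in> shf Z (int k) UNIV"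
      from shf_Z_UNIV[OF _ this, of d0] h show "h \<in> Z" by simp
    next
      assume "h \<in> Z"
      then show "?i * h \<in> shf Z (int k) UNIV"
        using hom[OF h] unfolding shf_iff by (intro conjI exI[of _ d0]) simp_all
    qed
  qed
qed

lemma linear_lmon_times:
  assumes "\<And>h. h \<in> polys \<inter> homog e \<Longrightarrow> lmon b * h \<in> (shf polys d UNIV :: 'a laurent set)"
  shows "linear_map field_ring (vs_of lscale (polys \<inter> homog e)) (vs_of lscale (shf polys d UNIV :: 'a laurent set))
    (\<lambda>h. lmon b * h)"
  by (rule linear_mapI[OF vectorspace_vs_of[OF vector_space_lscale is_subspace_forms]
        vectorspace_vs_of[OF vector_space_lscale is_subspace_shf[OF poly_ideal_polys]]])
    (simp_all only: vs_of_simps distrib_left lscale_times_right assms)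

lemma has_dim_O_Z: "has_dim (H0_quot lscale (shf polys (int k)) (shf Z (int k))) l"
proof (rule representatives[of k])
  fix e N
  assume w: "\<exists>w. has_dim (vs_of lscale (Z \<inter> homog (int e))) w \<and> (e + 2) choose 2 = l + w"
    and 1: "\<And>h. h \<in> polys \<inter> homog (int e) \<Longrightarrow> lmon (- supp_exp N UNIV) * h \<in> (shf polys (int k) UNIV :: 'a laurent set)"
    and 2: "\<And>x. x \<in> shf polys (int k) UNIV \<Longrightarrow> \<exists>h\<in>polys \<inter> homog (int e). x - lmon (- supp_exp N UNIV) * h \<in> shf Z (int k) UNIV"
    and 3: "\<And>h. h \<in> polys \<inter> homog (int e) \<Longrightarrow> lmon (- supp_exp N UNIV) * h \<in> shf Z (int k) UNIV \<longleftrightarrow> h \<in> Z"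
  obtain w where w: "has_dim (vs_of lscale (Z \<inter> homog (int e))) w" "(e + 2) choose 2 = l + w" using w by blast
  have "{h \<in> polys \<inter> homog (int e). lmon (- supp_exp N UNIV) * h \<in> shf Z (int k) UNIV} = Z \<inter> homog (int e)"
    using 3 Z_polys by blast
  with w(1) have k: "has_dim (vs_of lscale {h \<in> polys \<inter> homog (int e). lmon (- supp_exp N UNIV) * h \<in> shf Z (int k) UNIV}) w"
    by simp
  show ?thesis by (rule O.has_dim_H0_quot[OF has_dim_forms linear_lmon_times[OF 1] 2 k w(2)])
qed

end


lemma has_dim_linear_iso: "linear_iso A B f \<Longrightarrow> has_dim A n \<Longrightarrow> has_dim B n"
  unfolding linear_iso_def by (rule has_dim_iso[OF conjunct1 conjunct2])

section \<open>The two maps\<close>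

context point_scheme
begin

text \<open>Three copies of the ideal sheaf contain the twisted cotangent sheaf of the ideal, with quotient the
  twisted ideal sheaf.\<close>
sublocale E: cech_pair fscale "triples (shf Z k)" "Omega Z (k + 1)" for k
proof (intro cech_supported.intro cech_pair.intro cech_supported_axioms.intro)
  show "is_subspace fscale (triples (shf Z k) S)" for S
    by (rule is_subspace_triples) (rule is_subspace_shf[OF ideal])
  show "is_subspace fscale (Omega Z (k + 1) S)" for S by (rule is_subspace_Omega)
  show "Omega Z (k + 1) S \<subseteq> triples (shf Z k) S" for S using Omega_subset[OF ideal] by blast
  show "triples (shf Z k) S \<subseteq> triples (shf Z k) T" if "S \<subseteq> T" for S T
    using shf_mono[OF ideal that] by (auto simp: triples_def)
  show "Omega Z (k + 1) S \<subseteq> Omega Z (k + 1) T" if "S \<subseteq> T" for S T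
    by (rule Omega_mono[OF shf_mono[OF ideal that] that])
qed (rule vector_space_fscale)

text \<open>The kernel of the second map of the Euler sequence at a vector two of whose components are in
  the ideal: the third component is then in the ideal as well.\<close>
lemma Omega_UNIV_I:
  assumes c: "c \<in> triples (shf polys k) UNIV" "euler_sum c = 0" and "c $ 1 \<in> shf Z k UNIV" "c $ 2 \<in> shf Z k UNIV"
  shows "c \<in> Omega Z (k + 1) UNIV"
proof -
  have "X 3 * c $ 3 = - (X 1 * c $ 1 + X 2 * c $ 2)"
    using c(2) by (intro eq_neg_iff_add_eq_0[THEN iffD2]) (simp add: euler_sum_def sum_3 add.commute)
  also have "\<dots> \<in> shf Z (k + 1) UNIV"
    by (rule is_subspace_neg[OF vector_space_lscale is_subspace_shf[OF ideal]],
        rule is_subspaceD(2)[OF is_subspace_shf[OF ideal]])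
      (rule X_times_shf[OF ideal assms(3)] X_times_shf[OF ideal assms(4)])+
  finally have "c $ 3 \<in> shf Z k UNIV" using X_times_shf_iff[OF ideal, of 3 UNIV] by simp
  then show ?thesis using assms by (simp add: Omega_eq[OF ideal] triples_def forall_3)
qed

text \<open>Projection to the kernel of \<open>euler_sum\<close> along the \<open>i\<close>-th component, where \<open>x_i\<close> is invertible.\<close>
definition proj :: "3 \<Rightarrow> 'a laurent ^ 3 \<Rightarrow> 'a laurent ^ 3" where
  "proj i z = z - axis i (lmon (- axis i 1) * euler_sum z)"

lemma euler_sum_axis: "euler_sum (axis i f) = X i * f"
proof -
  have "euler_sum (axis i f) = (\<Sum>j\<in>UNIV. if j = i then X i * f else 0)"
    unfolding euler_sum_def by (rule sum.cong) (auto simp: axis_def)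
  then show ?thesis by simp
qed

lemma euler_sum_proj: "euler_sum (proj i z) = 0"
  by (simp add: proj_def euler_sum_diff euler_sum_axis X_lmon)

lemma proj_add: "proj i (y + z) = proj i y + proj i z"
  and proj_scale: "proj i (fscale c z) = fscale c (proj i z)"
proof -
  interpret vector_space "lscale :: 'a \<Rightarrow> 'a laurent \<Rightarrow> _" by (rule vector_space_lscale)
  show "proj i (y + z) = proj i y + proj i z"
    by (simp add: proj_def vec_eq_iff euler_sum_add distrib_left axis_def)
  show "proj i (fscale c z) = fscale c (proj i z)"
    by (simp add: proj_def vec_eq_iff euler_sum_scale lscale_times_right axis_def scale_right_diff_distrib)
qed

lemma proj_in:
  assumes I: "poly_ideal I" and "i \<in> S" and z: "z \<in> triples (shf I k) S"
  shows "proj i z \<in> Omega I (k + 1) S"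
proof -
  note sub = is_subspace_shf[OF I]
  have "euler_sum z \<in> shf I (k + 1) S" using z by (intro euler_sum_shf[OF I]) (simp add: triples_def)
  then have e: "lmon (- axis i 1) * euler_sum z \<in> shf I k S"
    using X_divide_shf[OF I, of "euler_sum z" "k + 1" S i] assms(2) by simp
  have "proj i z $ j \<in> shf I k S" for j
    unfolding proj_def vector_minus_component
    using z e is_subspaceD(1)[OF sub]
    by (intro is_subspace_diff[OF vector_space_lscale sub]) (auto simp: triples_def axis_def)
  moreover have "S \<noteq> {}" using assms(2) by blast
  ultimately show ?thesis by (simp add: Omega_eq[OF I] triples_def euler_sum_proj)
qed

sublocale W: cech_supported fscale "Omega polys (k + 1) :: _ \<Rightarrow> ('a laurent ^ 3) set" "Omega Z (k + 1)" for k
proof (intro cech_supported.intro cech_pair.intro cech_supported_axioms.intro)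
  show "is_subspace fscale (Omega polys (k + 1) S :: ('a laurent ^ 3) set)" for S by (rule is_subspace_Omega)
  show "is_subspace fscale (Omega Z (k + 1) S)" for S by (rule is_subspace_Omega)
  show "Omega Z (k + 1) S \<subseteq> Omega polys (k + 1) S" for S
    by (rule Omega_mono[OF shf_subset_polys[OF ideal] order_refl])
  show "Omega polys (k + 1) S \<subseteq> (Omega polys (k + 1) T :: ('a laurent ^ 3) set)" if "S \<subseteq> T" for S T
    by (rule Omega_mono[OF shf_mono[OF poly_ideal_polys that] that])
  show "Omega Z (k + 1) S \<subseteq> Omega Z (k + 1) T" if "S \<subseteq> T" for S T by (rule E.G_mono[OF that])
  show "Omega polys (k + 1) S \<inter> Omega Z (k + 1) UNIV \<subseteq> Omega Z (k + 1) S" if "S \<noteq> {}" for S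
  proof
    fix w assume "w \<in> Omega polys (k + 1) S \<inter> Omega Z (k + 1) UNIV"
    then have "w \<in> triples (shf polys k) S" "w \<in> triples (shf Z k) UNIV" "euler_sum w = 0"
      using Omega_subset[OF ideal] Omega_subset[OF poly_ideal_polys] by blast+
    then show "w \<in> Omega Z (k + 1) S"
      using O.G_eq[OF that] by (auto simp: Omega_eq[OF ideal that] triples_def)
  qed
  fix x :: "'a laurent ^ 3" and i assume x: "x \<in> Omega polys (k + 1) UNIV"
  have x': "x \<in> triples (shf polys k) UNIV" "euler_sum x = 0"
    using x Omega_subset[OF poly_ideal_polys] by blast+
  have "\<exists>y. y \<in> shf polys k {i} \<and> x $ j - y \<in> shf Z k UNIV" for j
  proof -
    have "x $ j \<in> shf polys k UNIV" using x'(1) by (simp add: triples_def)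
    from O.approx[OF this] show ?thesis by blast
  qed
  then obtain y where y: "\<And>j. y j \<in> shf polys k {i} \<and> x $ j - y j \<in> shf Z k UNIV" by metis
  have 1: "proj i (\<chi> j. y j) \<in> Omega polys (k + 1) {i}"
    using y by (intro proj_in[OF poly_ideal_polys]) (simp_all add: triples_def)
  have "proj i (x - (\<chi> j. y j)) \<in> Omega Z (k + 1) UNIV"
    using y by (intro proj_in[OF ideal]) (simp_all add: triples_def)
  moreover have "proj i (x - (\<chi> j. y j)) = x - proj i (\<chi> j. y j)"
    by (simp add: proj_def euler_sum_diff x'(2) vec_eq_iff axis_def)
  ultimately show "\<exists>y\<in>Omega polys (k + 1) {i}. x - y \<in> Omega Z (k + 1) UNIV" using 1 by auto
qed (rule vector_space_fscale)

subsection \<open>Dimensions\<close>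

lemma linear_proj_times:
  assumes V: "is_subspace lscale V" and b: "\<And>h. h \<in> V \<Longrightarrow> lmon b * h \<in> shf polys k UNIV"
  shows "linear_map field_ring (vs_of fscale (power_space J V))
     (vs_of fscale (Omega polys (k + 1) UNIV :: ('a laurent ^ 3) set)) (\<lambda>h. proj 3 (\<chi> j. lmon b * h $ j))"
proof (rule linear_mapI[OF vectorspace_vs_of[OF vector_space_fscale is_subspace_power_space[OF vector_space_lscale V]]
      vectorspace_vs_of[OF vector_space_fscale is_subspace_Omega]])
  fix h assume "h \<in> carrier (vs_of fscale (power_space J V))"
  then have "h $ j \<in> V" for j using is_subspaceD(1)[OF V] by (cases "j \<in> J") (auto simp: power_space_def)
  then show "proj 3 (\<chi> j. lmon b * h $ j) \<in> carrier (vs_of fscale (Omega polys (k + 1) UNIV))"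
    using proj_in[OF poly_ideal_polys, of 3 UNIV "\<chi> j. lmon b * h $ j" k] b by (simp add: triples_def)
next
  fix h h' :: "'a laurent ^ 3"
  have "(\<chi> j. lmon b * (h + h') $ j) = (\<chi> j. lmon b * h $ j) + (\<chi> j. lmon b * h' $ j)"
    by (simp add: vec_eq_iff distrib_left)
  then show "proj 3 (\<chi> j. lmon b * (h \<oplus>\<^bsub>vs_of fscale (power_space J V)\<^esub> h') $ j) =
    proj 3 (\<chi> j. lmon b * h $ j) \<oplus>\<^bsub>vs_of fscale (Omega polys (k + 1) UNIV)\<^esub> proj 3 (\<chi> j. lmon b * h' $ j)"
    by (simp add: proj_add)
next
  fix c and h :: "'a laurent ^ 3"
  have "(\<chi> j. lmon b * fscale c h $ j) = fscale c (\<chi> j. lmon b * h $ j)"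
    by (simp add: vec_eq_iff lscale_times_right)
  then show "proj 3 (\<chi> j. lmon b * (c \<odot>\<^bsub>vs_of fscale (power_space J V)\<^esub> h) $ j) =
    c \<odot>\<^bsub>vs_of fscale (Omega polys (k + 1) UNIV)\<^esub> proj 3 (\<chi> j. lmon b * h $ j)"
    by (simp add: proj_scale)
qed

text \<open>Off the line \<open>x_3 = 0\<close> the sheaf \<open>\<Omega>(k+1)\<close> is free on the components \<open>1\<close> and \<open>2\<close>, so
  \<open>H^0(\<Omega>(k+1)|_Z)\<close> has dimension \<open>2l\<close>.\<close>
lemma has_dim_Omega_Z:
  "has_dim (H0_quot fscale (Omega polys (int k + 1)) (Omega Z (int k + 1))) (2 * l)"
proof (rule representatives[of k])
  fix e N
  let ?b = "- supp_exp N UNIV"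
  let ?V = "power_space {1, 2} (polys \<inter> homog (int e) :: 'a laurent set)"
  let ?g = "\<lambda>h :: 'a laurent ^ 3. proj 3 (\<chi> j. lmon ?b * h $ j)"
  assume w: "\<exists>w. has_dim (vs_of lscale (Z \<inter> homog (int e))) w \<and> (e + 2) choose 2 = l + w"
    and 1: "\<And>h. h \<in> polys \<inter> homog (int e) \<Longrightarrow> lmon ?b * h \<in> (shf polys (int k) UNIV :: 'a laurent set)"
    and 2: "\<And>x. x \<in> (shf polys (int k) UNIV :: 'a laurent set) \<Longrightarrow> \<exists>h\<in>polys \<inter> homog (int e). x - lmon ?b * h \<in> shf Z (int k) UNIV"
    and 3: "\<And>h. h \<in> polys \<inter> homog (int e) \<Longrightarrow> lmon ?b * h \<in> shf Z (int k) UNIV \<longleftrightarrow> h \<in> Z"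
  obtain w where w: "has_dim (vs_of lscale (Z \<inter> homog (int e))) w" "(e + 2) choose 2 = l + w" using w by blast
  have two: "card {1, 2 :: 3} = 2" by simp
  have V: "has_dim (vs_of fscale ?V) (2 * ((e + 2) choose 2))"
    using has_dim_power_space[OF vector_space_lscale is_subspace_forms has_dim_forms, of "{1, 2}" e]
    unfolding two .
  have low: "?g h $ 1 = lmon ?b * h $ 1" "?g h $ 2 = lmon ?b * h $ 2" for h :: "'a laurent ^ 3"
    by (simp_all add: proj_def axis_def)
  have k: "{h \<in> ?V. ?g h \<in> Omega Z (int k + 1) UNIV} = power_space {1, 2} (Z \<inter> homog (int e))"
  proof (intro Set.set_eqI iffI)
    fix h assume "h \<in> {h \<in> ?V. ?g h \<in> Omega Z (int k + 1) UNIV}"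
    then have h: "h \<in> ?V" "?g h \<in> triples (shf Z (int k)) UNIV" using Omega_subset[OF ideal] by blast+
    have "?g h $ j \<in> shf Z (int k) UNIV" for j using h(2) by (simp add: triples_def)
    from this[of 1] this[of 2] have "h $ 1 \<in> Z" "h $ 2 \<in> Z"
      unfolding low using 3[of "h $ 1"] 3[of "h $ 2"] h(1) by (simp_all add: power_space_def)
    then show "h \<in> power_space {1, 2} (Z \<inter> homog (int e))" using h(1) by (auto simp: power_space_def)
  next
    fix h assume h: "h \<in> power_space {1, 2} (Z \<inter> homog (int e))"
    then have hV: "h \<in> ?V" using Z_polys by (auto simp: power_space_def)
    have "?g h \<in> Omega polys (int k + 1) UNIV"
      using linear_map_vs_ofD(1)[OF linear_proj_times[OF is_subspace_forms 1] hV] by simp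
    then have "?g h \<in> triples (shf polys (int k)) UNIV" "euler_sum (?g h) = 0"
      using Omega_subset[OF poly_ideal_polys] by blast+
    then have "?g h \<in> Omega Z (int k + 1) UNIV"
      using h hV 3[of "h $ 1"] 3[of "h $ 2"] low[of h] by (intro Omega_UNIV_I) (auto simp: power_space_def)
    then show "h \<in> {h \<in> ?V. ?g h \<in> Omega Z (int k + 1) UNIV}" using hV by simp
  qed
  have W: "has_dim (vs_of fscale {h \<in> ?V. ?g h \<in> Omega Z (int k + 1) UNIV}) (2 * w)"
    unfolding k using has_dim_power_space[OF vector_space_lscale is_subspace_Z_forms w(1), of "{1, 2}"] unfolding two .
  show ?thesis
  proof (rule W.has_dim_H0_quot[OF V linear_proj_times[OF is_subspace_forms 1] _ W])
    fix x :: "'a laurent ^ 3" assume "x \<in> Omega polys (int k + 1) UNIV"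
    then have x: "x \<in> triples (shf polys (int k)) UNIV" "euler_sum x = 0" "x \<in> Omega polys (int k + 1) UNIV"
      using Omega_subset[OF poly_ideal_polys] by blast+
    have "\<forall>j. \<exists>h\<in>polys \<inter> homog (int e). x $ j - lmon ?b * h \<in> shf Z (int k) UNIV"
      using 2 x(1) by (simp add: triples_def)
    then obtain h where h: "\<And>j. h j \<in> polys \<inter> homog (int e)" "\<And>j. x $ j - lmon ?b * h j \<in> shf Z (int k) UNIV"
      by metis
    define h' where "h' = (\<chi> j. if j \<in> {1, 2} then h j else 0)"
    have h': "h' \<in> ?V" using h(1) by (simp add: h'_def power_space_def)
    have "?g h' \<in> Omega polys (int k + 1) UNIV"
      using linear_map_vs_ofD(1)[OF linear_proj_times[OF is_subspace_forms 1] h'] by simp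
    from is_subspace_diff[OF vector_space_fscale is_subspace_Omega x(3) this]
    have "x - ?g h' \<in> triples (shf polys (int k)) UNIV" "euler_sum (x - ?g h') = 0"
      using Omega_subset[OF poly_ideal_polys] by blast+
    then have "x - ?g h' \<in> Omega Z (int k + 1) UNIV"
      using h(2)[of 1] h(2)[of 2] low[of h'] by (intro Omega_UNIV_I) (simp_all add: h'_def)
    then show "\<exists>h\<in>?V. x - ?g h \<in> Omega Z (int k + 1) UNIV" using h' by blast
  next
    show "2 * ((e + 2) choose 2) = 2 * l + 2 * w" using w(2) by linarith
  qed
qed

lemma linear_euler_sum:
  "linear_map field_ring (vs_of fscale (power_space UNIV (polys \<inter> homog d)))
     (vs_of lscale (polys \<inter> homog (d + 1) :: 'a laurent set)) euler_sum"
proof (rule linear_mapI[OF vectorspace_vs_of[OF vector_space_fscale is_subspace_power_space[OF vector_space_lscale is_subspace_forms]]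
      vectorspace_vs_of[OF vector_space_lscale is_subspace_forms]])
  fix w :: "'a laurent ^ 3" assume "w \<in> carrier (vs_of fscale (power_space UNIV (polys \<inter> homog d)))"
  then have w: "w $ j \<in> polys" "w $ j \<in> homog d" for j by (auto simp: power_space_def)
  have "X j * w $ j \<in> polys \<inter> homog (d + 1)" for j
    using homog_mult[OF homog_X w(2)] polys_mult[OF polys_X w(1)] by (simp add: add.commute)
  then show "euler_sum w \<in> carrier (vs_of lscale (polys \<inter> homog (d + 1)))"
    unfolding euler_sum_def vs_of_simps by (intro is_subspace_sum[OF is_subspace_forms])
qed (simp_all add: euler_sum_add euler_sum_scale)

lemma triple_choose: "3 * ((k + 2) choose 2) = ((k + 3) choose 2) + k * (k + 2)"
proof -
  have "2 * (n choose 2) = n * (n - 1)" for n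
  proof -
    have "even (n * (n - 1))" by (cases n) auto
    then show ?thesis by (simp add: choose_two)
  qed
  from this[of "k + 2"] this[of "k + 3"]
  have "2 * ((k + 2) choose 2) = (k + 2) * (k + 1)" "2 * ((k + 3) choose 2) = (k + 3) * (k + 2)"
    by simp_all
  moreover have "3 * ((k + 2) * (k + 1)) = (k + 3) * (k + 2) + 2 * (k * (k + 2))"
    by (simp add: algebra_simps)
  ultimately show ?thesis by linarith
qed

text \<open>The kernel of the surjection of \<open>H^0(O(k))^3\<close> onto \<open>H^0(O(k+1))\<close>.\<close>
lemma has_dim_rho_dom: "has_dim (rho_dom (int k) :: ('a, 'a laurent ^ 3) module) (k * (k + 2))"
proof -
  let ?V = "power_space UNIV (polys \<inter> homog (int k) :: 'a laurent set)"
  let ?B = "polys \<inter> homog (int k + 1) :: 'a laurent set"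
  have V: "has_dim (vs_of fscale ?V) (3 * ((k + 2) choose 2))"
    using has_dim_power_space[OF vector_space_lscale is_subspace_forms has_dim_forms, of UNIV k] by simp
  have B: "has_dim (vs_of lscale ?B) ((k + 3) choose 2)"
    using has_dim_forms[of "Suc k", where 'a = 'a] by (simp add: add.commute numeral_3_eq_3)
  have onto: "euler_sum ` ?V = carrier (vs_of lscale ?B)"
  proof
    show "euler_sum ` ?V \<subseteq> carrier (vs_of lscale ?B)"
      using linear_map_vs_ofD(1)[OF linear_euler_sum] by auto
    show "carrier (vs_of lscale ?B) \<subseteq> euler_sum ` ?V"
    proof
      fix s assume "s \<in> carrier (vs_of lscale ?B)"
      then show "s \<in> euler_sum ` ?V"
        using euler_sum_forms[of "int k + 1" s] by (auto simp: power_space_def image_iff)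
    qed
  qed
  have ker: "glob (Omega polys (int k + 1)) = {w \<in> ?V. euler_sum w = \<zero>\<^bsub>vs_of lscale ?B\<^esub>}"
    by (auto simp: glob_Omega[OF poly_ideal_polys] glob_shf_polys power_space_def)
  obtain r where r: "has_dim (vs_of fscale (glob (Omega polys (int k + 1)) :: ('a laurent ^ 3) set)) r"
    using has_dim_subspace[OF vector_space_fscale is_subspace_power_space[OF vector_space_lscale is_subspace_forms]
        W.sub_glob_F _ V, of "int k"] ker by auto
  have "3 * ((k + 2) choose 2) = ((k + 3) choose 2) + r"
    by (rule rank_nullity_surj[OF linear_euler_sum onto V B r ker])
  then have "r = k * (k + 2)" using triple_choose[of k] by simp
  then show ?thesis using r by (simp add: rho_dom_def H0_def)
qed

lemma has_dim_mu_dom: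
  assumes "has_dim (vs_of lscale (glob (shf Z k))) h" shows "has_dim (mu_dom Z k) (3 * h)"
proof -
  have sub: "is_subspace lscale (glob (shf Z k))" by (rule O.sub_glob_G)
  have eq: "power_space UNIV (glob (shf Z k)) = {w. \<forall>j. w $ j \<in> glob (shf Z k)}"
    by (simp add: power_space_def)
  have "is_subspace lscale (tensor (glob (shf Z k)) linear_forms)"
    unfolding tensor_def by (rule is_subspace_lin_span[OF vector_space_lscale])
  then have "linear_map field_ring (vs_of fscale (power_space UNIV (glob (shf Z k)))) (mu_dom Z k) euler"
    unfolding mu_dom_def
    by (intro linear_mapI[OF vectorspace_vs_of[OF vector_space_fscale is_subspace_power_space[OF vector_space_lscale sub]]
        vectorspace_vs_of[OF vector_space_lscale]])
      (simp_all add: tensor_linear_forms[OF sub] eq euler_add euler_scale)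
  moreover have "bij_betw euler (power_space UNIV (glob (shf Z k))) (carrier (mu_dom Z k))"
    by (simp add: mu_dom_def tensor_linear_forms[OF sub] eq bij_betw_def inj_on_def euler_inject)
  moreover have "has_dim (vs_of fscale (power_space UNIV (glob (shf Z k)))) (3 * h)"
    using has_dim_power_space[OF vector_space_lscale sub assms, of UNIV] by simp
  ultimately show ?thesis using has_dim_iso[of "vs_of fscale (power_space UNIV (glob (shf Z k)))"]
    by (simp only: vs_of_simps)
qed

subsection \<open>First cohomology of the ideal sheaf\<close>

abbreviation H1_zero :: "(3 set \<Rightarrow> 'v::ab_group_add set) \<Rightarrow> bool" where
  "H1_zero G \<equiv> Z1 G \<subseteq> coboundary ` C0 G"

lemma surjective_iff_H1:
  "surjective_map (H0 lscale (shf polys d)) (H0_quot lscale (shf polys d) (shf Z d)) (to_quot lscale (shf Z d))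
    \<longleftrightarrow> H1_zero (shf Z d)"
  unfolding surjective_map_def
  by (rule trans[OF O.surjective_iff_lifts[OF O.quot_sequence]]) (assumption, subst O.onto_Z1[OF line_bundle_H1], rule refl)

lemma good_postulation_iff: "good_postulation Z d \<longleftrightarrow> glob (shf Z d) = {0} \<or> H1_zero (shf Z d)"
  unfolding good_postulation_def Let_def surjective_iff_H1 O.injective_to_quot ..

text \<open>The number \<open>h^1\<close> detects the vanishing of \<open>H^1(I_Z(k))\<close> because this space is finite-dimensional, as a
  quotient of \<open>H^0(O_Z)\<close>.\<close>
lemma h1_zero:
  assumes "h1 Z (int k) = 0" shows "H1_zero (shf Z (int k))"
proof -
  let ?A = "H0 lscale (shf polys (int k)) :: ('a, 'a laurent) module"
  let ?B = "H0_quot lscale (shf polys (int k)) (shf Z (int k))"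
  let ?r = "to_quot lscale (shf Z (int k))"
  interpret C: quotient_space ?B "?r ` carrier ?A"
    using O.image_submodule[OF O.quot_sequence] O.linear_qcl by (simp add: quotient_space_def linear_map_def)
  obtain c where "has_dim (cok ?A ?B ?r) c"
    using has_dim_surj[OF C.linear_cl C.carrier_quot[symmetric] has_dim_O_Z] unfolding cok_def by blast
  then have "has_dim (H1 lscale (shf Z (int k))) c"
    by (rule has_dim_linear_iso[OF O.connecting_iso_quot[OF line_bundle_H1]])
  then have "has_dim (H1 lscale (shf Z (int k))) 0"
    using assms by (simp add: h1_def has_dim_def)
  then have car: "carrier (H1 lscale (shf Z (int k))) = {\<zero>\<^bsub>H1 lscale (shf Z (int k))\<^esub>}" by (rule has_dim_0_iff)
  interpret Q: quotient_space "vs_of (vscale (vscale lscale)) (Z1 (shf Z (int k)))" "coboundary ` C0 (shf Z (int k))"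
    by (rule O.quotient_H1)
  show ?thesis
  proof
    fix c assume c: "c \<in> Z1 (shf Z (int k))"
    then have "Q.cl c \<in> carrier (H1 lscale (shf Z (int k)))" unfolding H1_def Q.carrier_quot by simp
    then have "Q.cl c = coboundary ` C0 (shf Z (int k))" using car unfolding H1_def by simp
    then show "c \<in> coboundary ` C0 (shf Z (int k))" using Q.cl_eq_W_iff c by simp
  qed
qed

text \<open>If the forms of degree \<open>d\<close> surject onto \<open>H^0(O_Z)\<close>, then so do their multiples by \<open>x_1\<close>, which is
  invertible on the scheme.\<close>
lemma H1_zero_Suc:
  assumes "H1_zero (shf Z d)" shows "H1_zero (shf Z (d + 1))"
proof -
  have s: "\<forall>x\<in>shf polys d UNIV. \<exists>s\<in>glob (shf polys d). x - s \<in> shf Z d UNIV"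
    using assms unfolding surjective_iff_H1[symmetric] O.surjective_to_quot_iff .
  have "\<forall>x\<in>shf polys (d + 1) UNIV. \<exists>s\<in>glob (shf polys (d + 1)). x - s \<in> shf Z (d + 1) UNIV"
  proof
    fix x :: "'a laurent" assume x: "x \<in> shf polys (d + 1) UNIV"
    define y where "y = lmon (- axis 1 1) * x"
    have "y \<in> shf polys d UNIV"
      using X_divide_shf[OF poly_ideal_polys x, of 1] by (simp add: y_def)
    then obtain s where s: "s \<in> glob (shf polys d)" "y - s \<in> shf Z d UNIV" using s by blast
    have "X 1 * (y - s) \<in> shf Z (d + 1) UNIV" by (rule X_times_shf[OF ideal s(2)])
    moreover have "X 1 * (y - s) = x - X 1 * s" by (simp add: y_def X_lmon right_diff_distrib)
    moreover have "X 1 * s \<in> glob (shf polys (d + 1))"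
      using s(1) by (auto simp: glob_def intro: X_times_shf[OF poly_ideal_polys])
    ultimately show "\<exists>s\<in>glob (shf polys (d + 1)). x - s \<in> shf Z (d + 1) UNIV" by auto
  qed
  then show ?thesis unfolding surjective_iff_H1[symmetric] O.surjective_to_quot_iff .
qed

text \<open>Rank and nullity of the surjection \<open>H^0(O(k)) \<rightarrow> H^0(O_Z)\<close>.\<close>
lemma has_dim_glob:
  assumes "H1_zero (shf Z (int k))"
  obtains h where "has_dim (vs_of lscale (glob (shf Z (int k)))) h" "(k + 2) choose 2 = l + h"
proof -
  let ?A = "polys \<inter> homog (int k) :: 'a laurent set"
  let ?B = "H0_quot lscale (shf polys (int k)) (shf Z (int k))"
  have sub: "glob (shf Z (int k)) \<subseteq> ?A"
    unfolding glob_shf_polys[symmetric] using O.GF by (auto simp: glob_def)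
  obtain h where h: "has_dim (vs_of lscale (glob (shf Z (int k)))) h"
    using has_dim_subspace[OF vector_space_lscale is_subspace_forms O.sub_glob_G sub has_dim_forms] by blast
  have lin: "linear_map field_ring (vs_of lscale ?A) ?B (to_quot lscale (shf Z (int k)))"
    using O.linear_to_quot[of "int k"] by (simp add: H0_def glob_shf_polys)
  have onto: "to_quot lscale (shf Z (int k)) ` ?A = carrier ?B"
    using assms unfolding surjective_iff_H1[symmetric] by (simp add: surjective_map_def H0_def glob_shf_polys)
  have ker: "glob (shf Z (int k)) = {f \<in> ?A. to_quot lscale (shf Z (int k)) f = \<zero>\<^bsub>?B\<^esub>}"
  proof -
    have "to_quot lscale (shf Z (int k)) f = \<zero>\<^bsub>?B\<^esub> \<longleftrightarrow> f \<in> glob (shf Z (int k))" if "f \<in> ?A" for f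
      unfolding O.to_quot_eq using O.qcl_ker[OF O.const_lifts, of f "int k"] that
      by (simp add: O.const_C0_iff glob_shf_polys)
    then show ?thesis using sub by blast
  qed
  show thesis by (rule that[OF h rank_nullity_surj[OF lin onto has_dim_forms has_dim_O_Z h ker]])
qed

subsection \<open>The multiplication map\<close>

lemma mu_dom_carrier: "carrier (mu_dom Z k) = euler ` glob (triples (shf Z k))"
  unfolding mu_dom_def vs_of_simps tensor_linear_forms[OF O.sub_glob_G] glob_triples ..

lemma linear_mu: "linear_map field_ring (mu_dom Z k) (mu_cod Z k) mu"
proof (rule linear_mapI)
  interpret vector_space "lscale :: 'a \<Rightarrow> 'a laurent \<Rightarrow> _" by (rule vector_space_lscale)
  show "vectorspace field_ring (mu_dom Z k)"
    unfolding mu_dom_def tensor_def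
    by (rule vectorspace_vs_of[OF vector_space_lscale is_subspace_lin_span[OF vector_space_lscale]])
  show "vectorspace field_ring (mu_cod Z k)"
    unfolding mu_cod_def H0_def by (rule vectorspace_vs_of[OF vector_space_lscale O.sub_glob_G])
  show "mu x \<in> carrier (mu_cod Z k)" if "x \<in> carrier (mu_dom Z k)" for x
    using that by (auto simp: mu_dom_carrier mu_cod_def H0_def mult_map_euler triples_def glob_def
        intro!: euler_sum_shf[OF ideal])
  show "mu (x \<oplus>\<^bsub>mu_dom Z k\<^esub> y) = mu x \<oplus>\<^bsub>mu_cod Z k\<^esub> mu y" for x y
    by (simp add: mu_dom_def mu_cod_def H0_def mult_map_add)
  show "mu (c \<odot>\<^bsub>mu_dom Z k\<^esub> x) = c \<odot>\<^bsub>mu_cod Z k\<^esub> mu x" if x: "x \<in> carrier (mu_dom Z k)" for c x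
  proof -
    obtain w where "x = euler w" using x unfolding mu_dom_carrier by blast
    then show ?thesis
      by (simp add: mu_dom_def mu_cod_def H0_def mult_map_euler euler_sum_scale flip: euler_scale)
  qed
qed

lemma lifts_euler_sum:
  assumes "t \<in> E.lifts k" shows "euler_sum (t $ i) = euler_sum (t $ j)"
proof -
  have "t $ i - t $ j \<in> Omega Z (k + 1) {j, i}" using assms by (simp add: E.lifts_def)
  then have "euler_sum (t $ i - t $ j) = 0" using Omega_subset[OF ideal] by blast
  then show ?thesis by (simp add: euler_sum_diff)
qed

lemma lifts_iff: "t \<in> E.lifts k \<longleftrightarrow> t \<in> C0 (triples (shf Z k)) \<and> (\<forall>i j. euler_sum (t $ i) = euler_sum (t $ j))"
proof
  assume "t \<in> E.lifts k"
  then show "t \<in> C0 (triples (shf Z k)) \<and> (\<forall>i j. euler_sum (t $ i) = euler_sum (t $ j))"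
    using lifts_euler_sum by (auto simp: E.lifts_def)
next
  assume t: "t \<in> C0 (triples (shf Z k)) \<and> (\<forall>i j. euler_sum (t $ i) = euler_sum (t $ j))"
  have "t $ j - t $ i \<in> Omega Z (k + 1) {i, j}" for i j
  proof -
    have "t $ i \<in> triples (shf Z k) {i, j}" "t $ j \<in> triples (shf Z k) {i, j}"
      using t E.F_mono[of "{i}" "{i, j}" k] E.F_mono[of "{j}" "{i, j}" k] by (auto simp: C0_def)
    then have "t $ j - t $ i \<in> triples (shf Z k) {i, j}"
      by (intro is_subspace_diff[OF vector_space_fscale E.F])
    moreover have "euler_sum (t $ j - t $ i) = 0" using t by (simp add: euler_sum_diff)
    ultimately show ?thesis by (simp add: Omega_eq[OF ideal])
  qed
  then show "t \<in> E.lifts k" using t by (simp add: E.lifts_def)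
qed

lemma linear_p: "linear_map field_ring (vs_of (vscale fscale) (E.lifts k)) (mu_cod Z k) (\<lambda>t. euler_sum (t $ 1))"
proof (rule linear_mapI[OF vectorspace_vs_of[OF E.vsc E.sub_lifts]])
  show "vectorspace field_ring (mu_cod Z k)" using linear_mu by (simp add: linear_map_def)
  fix t assume "t \<in> carrier (vs_of (vscale fscale) (E.lifts k))"
  then have t: "t \<in> E.lifts k" by simp
  have "euler_sum (t $ i) \<in> shf Z (k + 1) {i}" for i
    using t by (intro euler_sum_shf[OF ideal]) (simp add: E.lifts_def C0_def triples_def)
  then have "euler_sum (t $ 1) \<in> shf Z (k + 1) {i}" for i
    using lifts_euler_sum[OF t, of 1 i] by simp
  then show "euler_sum (t $ 1) \<in> carrier (mu_cod Z k)"
    by (simp add: mu_cod_def H0_def glob_def)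
qed (simp_all add: mu_cod_def H0_def euler_sum_add euler_sum_scale)

text \<open>Division by \<open>x_i\<close> shows that locally every section of the ideal sheaf is in the image.\<close>
lemma p_onto: "(\<lambda>t. euler_sum (t $ 1)) ` E.lifts k = carrier (mu_cod Z k)"
proof
  show "(\<lambda>t. euler_sum (t $ 1)) ` E.lifts k \<subseteq> carrier (mu_cod Z k)"
    using linear_map_vs_ofD(1)[OF linear_p] by auto
  show "carrier (mu_cod Z k) \<subseteq> (\<lambda>t. euler_sum (t $ 1)) ` E.lifts k"
  proof
    fix s assume "s \<in> carrier (mu_cod Z k)"
    then have s: "s \<in> shf Z (k + 1) {i}" for i by (simp add: mu_cod_def H0_def glob_def)
    define t where "t = (\<chi> i. axis i (lmon (- axis i 1) * s))"
    have e: "euler_sum (t $ i) = s" for i by (simp add: t_def euler_sum_axis X_lmon)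
    have "t $ i $ j \<in> shf Z k {i}" for i j
      using X_divide_shf[OF ideal s, of i i] is_subspaceD(1)[OF is_subspace_shf[OF ideal]]
      by (simp add: t_def axis_def)
    then have "t \<in> E.lifts k" by (simp add: lifts_iff C0_def triples_def e)
    then show "s \<in> (\<lambda>t. euler_sum (t $ 1)) ` E.lifts k" using e by force
  qed
qed

lemma p_ker: "t \<in> E.lifts k \<Longrightarrow> euler_sum (t $ 1) = \<zero>\<^bsub>mu_cod Z k\<^esub> \<longleftrightarrow> t \<in> C0 (Omega Z (k + 1))"
proof -
  assume t: "t \<in> E.lifts k"
  have "euler_sum (t $ 1) = 0 \<longleftrightarrow> (\<forall>i. euler_sum (t $ i) = 0)" using lifts_euler_sum[OF t, of _ 1] by auto
  moreover have "t $ i \<in> triples (shf Z k) {i}" for i using t by (simp add: E.lifts_def C0_def)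
  ultimately show ?thesis by (auto simp: mu_cod_def H0_def C0_def Omega_eq[OF ideal])
qed

lemma mu_image: "mu ` carrier (mu_dom Z k) = (\<lambda>t. euler_sum (t $ 1)) ` const_vec ` glob (triples (shf Z k))"
  by (simp add: mu_dom_carrier image_image mult_map_euler)

lemmas mu_sequence = linear_mu linear_p p_onto p_ker mu_image

text \<open>In terms of triples instead of tensors, \<open>delta_mu\<close> has the shape of the maps in \<open>connecting_iso\<close>.\<close>
lemma delta_mu_eq: "delta_mu Z k Y = coboundary ` {t \<in> E.lifts k. euler_sum (t $ 1) \<in> Y}"
proof (intro Set.set_eqI iffI)
  fix c assume "c \<in> delta_mu Z k Y"
  then obtain s t where s: "s \<in> Y" and t: "\<And>i. t $ i \<in> tensor (shf Z k {i}) linear_forms" "\<And>i. mult_map (t $ i) = s"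
    and c: "\<And>i j. c $ i $ j \<in> Omega Z (k + 1) {i, j}" "\<And>i j. euler (c $ i $ j) = t $ j - t $ i"
    unfolding delta_mu_def by blast
  have "\<forall>i. \<exists>w. w \<in> triples (shf Z k) {i} \<and> t $ i = euler w"
    using t(1) unfolding tensor_linear_forms[OF is_subspace_shf[OF ideal]] triples_def by blast
  then obtain w where w: "\<And>i. w i \<in> triples (shf Z k) {i} \<and> t $ i = euler (w i)" by metis
  have "c $ i $ j = w j - w i" for i j
    using c(2)[of i j] w by (simp add: euler_inject flip: euler_diff)
  then have "c = coboundary (\<chi> i. w i)" by (simp add: vec_eq_iff)
  moreover have e: "euler_sum (w i) = s" for i using t(2)[of i] w by (simp add: mult_map_euler)
  then have "(\<chi> i. w i) \<in> E.lifts k" using w by (simp add: lifts_iff C0_def)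
  ultimately show "c \<in> coboundary ` {t \<in> E.lifts k. euler_sum (t $ 1) \<in> Y}" using e s by simp
next
  fix c assume "c \<in> coboundary ` {t \<in> E.lifts k. euler_sum (t $ 1) \<in> Y}"
  then obtain t where t: "t \<in> E.lifts k" "euler_sum (t $ 1) \<in> Y" and c: "c = coboundary t" by blast
  show "c \<in> delta_mu Z k Y"
    unfolding delta_mu_def
  proof (intro CollectI bexI exI conjI allI)
    show "euler_sum (t $ 1) \<in> Y" by (rule t(2))
    fix i j
    have "t $ i \<in> triples (shf Z k) {i}" using t(1) by (simp add: E.lifts_def C0_def)
    then show "(\<chi> i. euler (t $ i)) $ i \<in> tensor (shf Z k {i}) linear_forms"
      unfolding tensor_linear_forms[OF is_subspace_shf[OF ideal]] by (simp add: triples_def)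
    show "mult_map ((\<chi> i. euler (t $ i)) $ i) = euler_sum (t $ 1)"
      using lifts_euler_sum[OF t(1), of i 1] by (simp add: mult_map_euler)
    show "c $ i $ j \<in> Omega Z (k + 1) {i, j}" using t(1) by (simp add: c E.lifts_def)
    show "euler (c $ i $ j) = (\<chi> i. euler (t $ i)) $ j - (\<chi> i. euler (t $ i)) $ i"
      by (simp add: c euler_diff)
  qed
qed

subsection \<open>Comparison\<close>

lemma injective_mu_iff: "injective_map (mu_dom Z k) mu \<longleftrightarrow> glob (Omega Z (k + 1)) = {0}"
proof -
  have inj: "injective_map (mu_dom Z k) mu \<longleftrightarrow> inj_on euler_sum (glob (triples (shf Z k)))"
    by (auto simp: injective_map_def mu_dom_carrier inj_on_def mult_map_euler euler_inject)
  have glob: "glob (Omega Z (k + 1)) = {w \<in> glob (triples (shf Z k)). euler_sum w = 0}"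
    by (auto simp: glob_Omega[OF ideal] glob_triples)
  have T: "is_subspace fscale (glob (triples (shf Z k)))" by (rule E.sub_glob_F)
  have "inj_on euler_sum (glob (triples (shf Z k))) \<longleftrightarrow> (\<forall>w\<in>glob (triples (shf Z k)). euler_sum w = 0 \<longrightarrow> w = 0)"
  proof
    assume "inj_on euler_sum (glob (triples (shf Z k)))"
    then show "\<forall>w\<in>glob (triples (shf Z k)). euler_sum w = 0 \<longrightarrow> w = 0"
      using is_subspaceD(1)[OF T] by (auto dest: inj_onD[of _ _ _ 0])
  next
    assume *: "\<forall>w\<in>glob (triples (shf Z k)). euler_sum w = 0 \<longrightarrow> w = 0"
    show "inj_on euler_sum (glob (triples (shf Z k)))"
    proof (rule inj_onI)
      fix v w assume vw: "v \<in> glob (triples (shf Z k))" "w \<in> glob (triples (shf Z k))" "euler_sum v = euler_sum w"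
      have "v - w \<in> glob (triples (shf Z k))" by (rule is_subspace_diff[OF vector_space_fscale T vw(1,2)])
      then show "v = w" using * vw(3) by (auto simp: euler_sum_diff)
    qed
  qed
  then show ?thesis unfolding inj glob using is_subspaceD(1)[OF T] by auto
qed

lemma injective_rho_iff: "injective_map (rho_dom k) (rho Z k) \<longleftrightarrow> glob (Omega Z (k + 1)) = {0}"
  unfolding rho_dom_def rho_def by (rule W.injective_to_quot)

lemma surjective_rho_iff:
  assumes "0 \<le> k" shows "surjective_map (rho_dom k) (rho_cod Z k) (rho Z k) \<longleftrightarrow> H1_zero (Omega Z (k + 1))"
  unfolding rho_dom_def rho_def rho_cod_def surjective_map_def
  by (rule trans[OF W.surjective_iff_lifts[OF W.quot_sequence]]) (assumption, subst W.onto_Z1[OF Omega_H1[OF assms]], rule refl)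

lemma surjective_mu_iff:
  "surjective_map (mu_dom Z k) (mu_cod Z k) mu \<longleftrightarrow> coboundary ` E.lifts k \<subseteq> coboundary ` C0 (Omega Z (k + 1))"
  unfolding surjective_map_def by (rule E.surjective_iff_lifts[OF mu_sequence])

lemma surjective_mu_if: "H1_zero (Omega Z (k + 1)) \<Longrightarrow> surjective_map (mu_dom Z k) (mu_cod Z k) mu"
  unfolding surjective_mu_iff using E.coboundary_lifts by blast

lemma surjective_mu_iff_H1:
  assumes "H1_zero (shf Z k)"
  shows "surjective_map (mu_dom Z k) (mu_cod Z k) mu \<longleftrightarrow> H1_zero (Omega Z (k + 1))"
  unfolding surjective_mu_iff E.onto_Z1[OF triples_H1[OF assms]] ..

text \<open>A nonzero target forces a nonzero source, and then good postulation means vanishing of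
  \<open>H^1(I_Z(k))\<close>.\<close>
lemma surjective_mu_iff_rho:
  assumes "0 \<le> k" "good_postulation Z k" "glob (shf Z (k + 1)) \<noteq> {0}"
  shows "surjective_map (mu_dom Z k) (mu_cod Z k) mu \<longleftrightarrow> surjective_map (rho_dom k) (rho_cod Z k) (rho Z k)"
proof
  assume s: "surjective_map (mu_dom Z k) (mu_cod Z k) mu"
  have "glob (shf Z k) \<noteq> {0}"
  proof
    assume 0: "glob (shf Z k) = {0}"
    then have "glob (triples (shf Z k)) \<subseteq> {0}" by (auto simp: glob_triples vec_eq_iff)
    then have "carrier (mu_dom Z k) \<subseteq> {0}" unfolding mu_dom_carrier by (auto simp: euler_0)
    then have "mu ` carrier (mu_dom Z k) \<subseteq> {0}" by (auto simp: mult_map_def)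
    then have "glob (shf Z (k + 1)) \<subseteq> {0}" using s by (simp add: surjective_map_def mu_cod_def H0_def)
    then show False using assms(3) is_subspaceD(1)[OF O.sub_glob_G, of "k + 1"] by blast
  qed
  then have "H1_zero (shf Z k)" using assms(2) by (simp add: good_postulation_iff)
  then show "surjective_map (rho_dom k) (rho_cod Z k) (rho Z k)"
    using s surjective_mu_iff_H1 surjective_rho_iff[OF assms(1)] by simp
next
  assume "surjective_map (rho_dom k) (rho_cod Z k) (rho Z k)"
  then show "surjective_map (mu_dom Z k) (mu_cod Z k) mu"
    using surjective_rho_iff[OF assms(1)] surjective_mu_if by blast
qed

lemma delta_mu_iso:
  assumes "H1_zero (shf Z k)" shows "linear_iso (cok (mu_dom Z k) (mu_cod Z k) mu) (H1_Omega Z k) (delta_mu Z k)"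
  using E.connecting_iso[OF mu_sequence triples_H1[OF assms]]
  unfolding H1_Omega_def delta_mu_eq[abs_def] .

lemma delta_rho_iso:
  assumes "0 \<le> k" shows "linear_iso (cok (rho_dom k) (rho_cod Z k) (rho Z k)) (H1_Omega Z k) delta_rho"
  using W.connecting_iso_quot[OF Omega_H1[OF assms]]
  unfolding H1_Omega_def rho_dom_def rho_cod_def rho_def delta_rho_def[abs_def] .

text \<open>With \<open>H^1(I(k)) = 0\<close> also \<open>H^1(I(k+1)) = 0\<close>, so both sides of \<open>\<mu>_k\<close> have the dimension that counting
  conditions predicts.\<close>
lemma exp_dim_cok_mu:
  assumes "H1_zero (shf Z (int k))"
  shows "exp_dim_cok (mu_dom Z (int k)) (mu_cod Z (int k)) = max 0 (2 * int l - int k * (int k + 2))"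
proof -
  obtain h where h: "has_dim (vs_of lscale (glob (shf Z (int k)))) h" "(k + 2) choose 2 = l + h"
    using has_dim_glob[OF assms] .
  have "H1_zero (shf Z (int (Suc k)))" using H1_zero_Suc[OF assms] by (simp add: add.commute)
  then obtain h' where h': "has_dim (vs_of lscale (glob (shf Z (int (Suc k))))) h'" "(Suc k + 2) choose 2 = l + h'"
    by (rule has_dim_glob)
  have "dimension (mu_cod Z (int k)) = h'"
    using h'(1) by (simp add: mu_cod_def H0_def has_dim_def add.commute)
  moreover have "dimension (mu_dom Z (int k)) = 3 * h"
    by (rule has_dim_dimension[OF has_dim_mu_dom[OF h(1)]])
  moreover have "3 * (l + h) = (l + h') + k * (k + 2)"
  proof -
    have "Suc k + 2 = k + 3" by simp
    then show ?thesis using triple_choose[of k] h(2) h'(2) by metis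
  qed
  then have "3 * (int l + int h) = (int l + int h') + int k * (int k + 2)"
    by (metis (mono_tags) of_nat_add of_nat_mult of_nat_numeral)
  then have "int h' - int (3 * h) = 2 * int l - int k * (int k + 2)" by simp
  ultimately show ?thesis by (simp only: exp_dim_cok_def)
qed

lemma exp_dim_cok_rho:
  "exp_dim_cok (rho_dom (int k) :: ('a, _) module) (rho_cod Z (int k)) = max 0 (2 * int l - int k * (int k + 2))"
  using has_dim_dimension[OF has_dim_rho_dom[of k]] has_dim_dimension[OF has_dim_Omega_Z[of k]]
  by (simp add: exp_dim_cok_def rho_cod_def algebra_simps)

end


section \<open>General points\<close>

definition monomial_value :: "(nat \<Rightarrow> 'a::field ^ 3) \<Rightarrow> (nat \<times> 3 \<Rightarrow>\<^sub>0 nat) \<Rightarrow> 'a" where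
  "monomial_value P e = (\<Prod>(i, j)\<in>keys e. (P i $ j) ^ lookup e (i, j))"

lemma monomial_value_superset:
  "finite A \<Longrightarrow> keys e \<subseteq> A \<Longrightarrow>
   monomial_value P e = (\<Prod>(i, j)\<in>A. (P i $ j) ^ lookup e (i, j))"
  unfolding monomial_value_def by (intro prod.mono_neutral_left) (auto simp: in_keys_iff)

lemma monomial_value_add: "monomial_value P (a + b) = monomial_value P a * monomial_value P b"
proof -
  let ?A = "keys a \<union> keys b"
  have "monomial_value P (a + b) = (\<Prod>(i, j)\<in>?A. (P i $ j) ^ lookup (a + b) (i, j))"
    using keys_add[of a b] by (intro monomial_value_superset) auto
  also have "\<dots> = monomial_value P a * monomial_value P b"
    using monomial_value_superset[of ?A a P] monomial_value_superset[of ?A b P]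
    by (simp add: lookup_add power_add split_def prod.distrib)
  finally show ?thesis .
qed

lemma multi_evaluation: "monoid_evaluation (\<lambda>x. x) (monomial_value P) UNIV"
  by unfold_locales (simp_all add: monomial_value_add monomial_value_def[of P 0])

lemma multi_eval_eq: "multi_eval P F = monoid_evaluation.evaluate (\<lambda>x. x) (monomial_value P) F"
  by (simp add: multi_eval_def monomial_value_def monoid_evaluation.evaluate_def[OF multi_evaluation])

lemma multi_eval_add: "multi_eval P (F + G) = multi_eval P F + multi_eval P G"
  unfolding multi_eval_eq by (rule monoid_evaluation.evaluate_add[OF multi_evaluation])

lemma multi_eval_mult: "multi_eval P (F * G) = multi_eval P F * multi_eval P G"
  unfolding multi_eval_eq by (rule monoid_evaluation.evaluate_mult[OF multi_evaluation]) simp_all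

lemma multi_eval_one: "multi_eval P 1 = 1"
  unfolding multi_eval_eq by (rule monoid_evaluation.evaluate_one[OF multi_evaluation])

definition coord :: "nat \<Rightarrow> 3 \<Rightarrow> (nat \<times> 3 \<Rightarrow>\<^sub>0 nat) \<Rightarrow>\<^sub>0 'a::field" where
  "coord i j = single (single (i, j) 1) 1"

lemma multi_eval_coord: "multi_eval P (coord i j) = P i $ j"
  by (simp add: coord_def multi_eval_def)

lemma multi_eval_diff: "multi_eval P (F - G) = multi_eval P F - multi_eval P G"
  using multi_eval_add[of P "F - G" G] by simp

definition multidegree :: "nat \<Rightarrow> (nat \<Rightarrow> nat) \<Rightarrow> ((nat \<times> 3 \<Rightarrow>\<^sub>0 nat) \<Rightarrow>\<^sub>0 'a::field) \<Rightarrow> bool" where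
  "multidegree n d F \<longleftrightarrow> (\<forall>e\<in>keys F. keys e \<subseteq> {1..n} \<times> UNIV \<and>
     (\<forall>i\<in>{1..n}. (\<Sum>j\<in>UNIV. lookup e (i, j)) = d i))"

lemma multidegree_mult:
  assumes "multidegree n c F" "multidegree n d G" shows "multidegree n (\<lambda>i. c i + d i) (F * G)"
  unfolding multidegree_def
proof
  fix e assume "e \<in> keys (F * G)"
  then obtain a b where ab: "e = a + b" "a \<in> keys F" "b \<in> keys G"
    using keys_mult[of F G] by blast
  have "keys e \<subseteq> {1..n} \<times> UNIV"
    using assms ab keys_add[of a b] unfolding multidegree_def by blast
  moreover have "(\<Sum>j\<in>UNIV. lookup e (i, j)) = c i + d i" if "i \<in> {1..n}" for i
    using assms ab that by (simp add: multidegree_def lookup_add sum.distrib)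
  ultimately show "keys e \<subseteq> {1..n} \<times> UNIV \<and>
      (\<forall>i\<in>{1..n}. (\<Sum>j\<in>UNIV. lookup e (i, j)) = c i + d i)" by blast
qed

lemma multidegree_diff:
  "multidegree n d F \<Longrightarrow> multidegree n d G \<Longrightarrow> multidegree n d (F - G)"
  unfolding multidegree_def by (metis (no_types, lifting) diff_zero in_keys_iff lookup_minus)

lemma multidegree_coord:
  assumes "i \<in> {1..n}" shows "multidegree n (\<lambda>k. if k = i then 1 else 0) (coord i j)"
  using assms by (auto simp: multidegree_def coord_def lookup_single when_def if_distrib sum.delta cong: if_cong)

definition separates :: "nat \<Rightarrow> nat \<Rightarrow> (nat \<times> 3 \<Rightarrow>\<^sub>0 nat) \<Rightarrow>\<^sub>0 'a::field" where
  "separates i k = coord i 2 * coord k 1 - coord k 2 * coord i 1"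

text \<open>A multihomogeneous polynomial whose nonvanishing locus is \<open>good_points\<close>.\<close>
definition discriminant :: "nat \<Rightarrow> (nat \<times> 3 \<Rightarrow>\<^sub>0 nat) \<Rightarrow>\<^sub>0 'a::field" where
  "discriminant n = (\<Prod>i\<in>{1..n}. \<Prod>j\<in>UNIV. coord i j) *
     (\<Prod>i\<in>{1..n}. \<Prod>k\<in>{1..n} - {i}. separates i k)"

lemma multi_eval_prod: "multi_eval P (\<Prod>i\<in>I. F i) = (\<Prod>i\<in>I. multi_eval P (F i))"
  by (induction I rule: infinite_finite_induct) (simp_all add: multi_eval_mult multi_eval_one)

lemma multidegree_one: "multidegree n (\<lambda>_. 0) 1"
  by (simp add: multidegree_def)

lemma multidegree_prod:
  "(\<And>i. i \<in> I \<Longrightarrow> \<exists>d. multidegree n d (F i)) \<Longrightarrow> \<exists>d. multidegree n d (\<Prod>i\<in>I. F i)"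
proof (induction I rule: infinite_finite_induct)
  case (insert i I)
  obtain c where "multidegree n c (F i)" using insert.prems by blast
  moreover obtain d where "multidegree n d (\<Prod>i\<in>I. F i)" using insert.IH insert.prems by blast
  ultimately have "multidegree n (\<lambda>i. c i + d i) (F i * (\<Prod>i\<in>I. F i))" by (rule multidegree_mult)
  then show ?case using insert.hyps by auto
qed (auto intro: multidegree_one)

lemma multihomogeneous_discriminant: "multihomogeneous n (discriminant n :: _ \<Rightarrow>\<^sub>0 'a::field)"
proof -
  have c: "\<exists>d. multidegree n d (coord i j :: _ \<Rightarrow>\<^sub>0 'a)" if "i \<in> {1..n}" for i j
    using multidegree_coord[OF that] by blast
  have s: "\<exists>d. multidegree n d (separates i k :: _ \<Rightarrow>\<^sub>0 'a)" if "i \<in> {1..n}" "k \<in> {1..n}" for i k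
  proof -
    let ?d = "\<lambda>l. (if l = i then 1 else 0) + (if l = k then 1 else 0)"
    have "multidegree n ?d (coord i 2 * coord k 1 :: _ \<Rightarrow>\<^sub>0 'a)"
      by (rule multidegree_mult[OF multidegree_coord multidegree_coord]) (fact that)+
    moreover have "multidegree n ?d (coord k 2 * coord i 1 :: _ \<Rightarrow>\<^sub>0 'a)"
      using multidegree_mult[OF multidegree_coord[OF that(1)] multidegree_coord[OF that(2)], of 1 2]
      by (simp add: mult.commute)
    ultimately have "multidegree n ?d (separates i k :: _ \<Rightarrow>\<^sub>0 'a)"
      unfolding separates_def by (rule multidegree_diff)
    then show ?thesis by (rule exI[where x = ?d])
  qed
  have "\<exists>d. multidegree n d (\<Prod>i\<in>{1..n}. \<Prod>j\<in>UNIV. coord i j :: _ \<Rightarrow>\<^sub>0 'a)"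
  proof (rule multidegree_prod, rule multidegree_prod)
    fix i and j :: 3 assume "i \<in> {1..n}"
    then show "\<exists>d. multidegree n d (coord i j :: _ \<Rightarrow>\<^sub>0 'a)" by (rule c)
  qed
  then obtain a where "multidegree n a (\<Prod>i\<in>{1..n}. \<Prod>j\<in>UNIV. coord i j :: _ \<Rightarrow>\<^sub>0 'a)" ..
  moreover have "\<exists>d. multidegree n d (\<Prod>i\<in>{1..n}. \<Prod>k\<in>{1..n} - {i}. separates i k :: _ \<Rightarrow>\<^sub>0 'a)"
  proof (rule multidegree_prod, rule multidegree_prod)
    fix i k assume "i \<in> {1..n}" "k \<in> {1..n} - {i}"
    then show "\<exists>d. multidegree n d (separates i k :: _ \<Rightarrow>\<^sub>0 'a)" by (intro s) auto
  qed
  then obtain b where "multidegree n b (\<Prod>i\<in>{1..n}. \<Prod>k\<in>{1..n} - {i}. separates i k :: _ \<Rightarrow>\<^sub>0 'a)" ..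
  ultimately have "multidegree n (\<lambda>i. a i + b i) (discriminant n :: _ \<Rightarrow>\<^sub>0 'a)"
    unfolding discriminant_def by (rule multidegree_mult)
  then have "\<exists>d. multidegree n d (discriminant n :: _ \<Rightarrow>\<^sub>0 'a)" by blast
  then show ?thesis by (simp add: multihomogeneous_def multidegree_def)
qed

lemma good_points_iff: "multi_eval P (discriminant n) \<noteq> 0 \<longleftrightarrow> good_points n P"
  by (auto simp: discriminant_def separates_def good_points_def multi_eval_mult multi_eval_prod
      multi_eval_diff multi_eval_coord)

text \<open>Over a finite field \<open>1 + \<Prod>(x - a)\<close> takes only the value \<open>1\<close>.\<close>
lemma infinite_alg_closed: "infinite (UNIV :: 'a::alg_closed_field set)"
proof
  assume fin: "finite (UNIV :: 'a set)"
  define p :: "'a poly" where "p = 1 + (\<Prod>a\<in>UNIV. [:- a, 1:])"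
  have d: "Polynomial.degree (\<Prod>a\<in>UNIV. [:- a :: 'a, 1:]) = card (UNIV :: 'a set)"
    by (subst degree_prod_eq_sum_degree) auto
  have "0 < card (UNIV :: 'a set)" using fin by (simp add: card_gt_0_iff)
  then have "Polynomial.degree p > 0" unfolding p_def by (subst degree_add_eq_right) (simp_all add: d)
  then obtain x where "poly p x = 0" using alg_closed_imp_poly_has_root by blast
  moreover have "poly p x = 1" using fin by (simp add: p_def poly_prod)
  ultimately show False by simp
qed

lemma good_points_exist: "\<exists>P :: nat \<Rightarrow> 'a::alg_closed_field ^ 3. (\<forall>i. P i \<noteq> 0) \<and> good_points n P"
proof -
  have "infinite (UNIV - {0 :: 'a})" using infinite_alg_closed by simp
  then obtain c :: "nat \<Rightarrow> 'a" where c: "inj c" "range c \<subseteq> UNIV - {0}"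
    using infinite_countable_subset by blast
  define P :: "nat \<Rightarrow> 'a ^ 3" where "P i = (\<chi> j. if j = 2 then c i else 1)" for i
  have "c i \<noteq> 0" for i using c(2) by blast
  then have "P i $ j \<noteq> 0" for i j by (simp add: P_def)
  moreover have "P i $ 2 * P k $ 1 \<noteq> P k $ 2 * P i $ 1" if "i \<noteq> k" for i k
    using that c(1) by (simp add: P_def inj_eq)
  ultimately have "good_points n P" "\<forall>i. P i \<noteq> 0" by (auto simp: good_points_def vec_eq_iff)
  then show ?thesis by blast
qed

lemma for_general_points_good:
  assumes "\<And>P :: nat \<Rightarrow> 'a::alg_closed_field ^ 3. good_points n P \<Longrightarrow> Q P"
  shows "for_general_points n Q"
proof -
  let ?U = "{P :: nat \<Rightarrow> 'a ^ 3. (\<forall>i\<in>{1..n}. P i \<noteq> 0) \<and> (\<exists>F\<in>{discriminant n}. multi_eval P F \<noteq> 0)}"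
  have "zariski_open n ?U"
    unfolding zariski_open_def using multihomogeneous_discriminant by blast
  moreover have "?U \<noteq> {}" using good_points_exist[of n, where 'a = 'a] by (auto simp: good_points_iff)
  moreover have "\<forall>P\<in>?U. Q P" using assms by (auto simp: good_points_iff)
  ultimately show ?thesis unfolding for_general_points_def by blast
qed

section \<open>The theorem\<close>

theorem lemma3p1:
  fixes k n :: nat and m :: "nat \<Rightarrow> nat"
  assumes "1 \<le> k"
  shows "for_general_points n (\<lambda>P :: nat \<Rightarrow> 'a::alg_closed_field ^ 3.
    let Z = fat_ideal n m P in
    (good_postulation Z (int k) \<and> good_postulation Z (int k + 1) \<longrightarrow>
      (injective_map (mu_dom Z k) mu \<longleftrightarrow> injective_map (rho_dom k) (rho Z k)) \<and>
      (surjective_map (rho_dom k) (rho_cod Z k) (rho Z k) \<longrightarrow>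
        surjective_map (mu_dom Z k) (mu_cod Z k) mu) \<and>
      (glob (shf Z (int k + 1)) \<noteq> {0} \<longrightarrow>
        (surjective_map (mu_dom Z k) (mu_cod Z k) mu \<longleftrightarrow>
         surjective_map (rho_dom k) (rho_cod Z k) (rho Z k)))) \<and>
    (h1 Z (int k) = 0 \<longrightarrow>
      exp_dim_cok (mu_dom Z k) (mu_cod Z k) =
        max 0 (2 * int (fat_length n m) - int k * (int k + 2)) \<and>
      exp_dim_cok (rho_dom k :: ('a, _) module) (rho_cod Z k) =
        max 0 (2 * int (fat_length n m) - int k * (int k + 2)) \<and>
      linear_iso (cok (mu_dom Z k) (mu_cod Z k) mu) (H1_Omega Z k) (delta_mu Z k) \<and>
      linear_iso (cok (rho_dom k) (rho_cod Z k) (rho Z k)) (H1_Omega Z k) delta_rho))"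
proof (rule for_general_points_good, goal_cases)
  case P: (1 P)
  define Z where "Z = fat_ideal n m P"
  interpret point_scheme Z "fat_length n m"
    unfolding Z_def by (rule point_scheme_fat_ideal[OF P])
  have k: "0 \<le> int k" by simp
  have "injective_map (mu_dom Z (int k)) mu \<longleftrightarrow> injective_map (rho_dom (int k)) (rho Z (int k))"
    by (simp only: injective_mu_iff injective_rho_iff)
  moreover have "surjective_map (rho_dom (int k)) (rho_cod Z (int k)) (rho Z (int k)) \<Longrightarrow>
      surjective_map (mu_dom Z (int k)) (mu_cod Z (int k)) mu"
    using surjective_rho_iff[OF k] surjective_mu_if by blast
  moreover note surjective_mu_iff_rho[OF k] exp_dim_cok_mu[OF h1_zero, of k] exp_dim_cok_rho[of k]
    delta_mu_iso[OF h1_zero[of k]] delta_rho_iso[OF k]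
  ultimately show ?case
    unfolding Let_def Z_def[symmetric] by (intro conjI impI; blast)
qed


end
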